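(* Let $(X,\mathcal F)$ be a transitive compact Polish foliated space, let $\mathcal U$ be a regular foliated atlas of $(X,\mathcal F)$, write $v(x,r)=v_{\mathcal U}(x,r)$, and let $X_{0,\mathrm d}\subset X$ be the union of the leaves that are dense and without holonomy. Then there are $a_1,a_3\in[1,\infty]$, $a_2,a_4\in[0,\infty)$ and $p\ge1$ such that \[ \limsup_{r\to\infty}\frac{\log v(x,r)}{\log r}=a_1,\qquad a_2\le\liminf_{r\to\infty}\frac{\log v(x,r)}{r}\le p\,a_2, \] \[ \liminf_{r\to\infty}\frac{\log v(x,r)}{\log r}=a_3,\qquad \limsup_{r\to\infty}\frac{\log v(x,r)}{r}=a_4 \] for residually many points $x$ in $X$. Moreover \[ \liminf_{r\to\infty}\frac{\log v(x,r)}{\log r}\ge a_3,\qquad \limsup_{r\to\infty}\frac{\log v(x,r)}{r}\le a_4 \] for all $x\in X_{0,\mathrm d}$.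
   Context: Foliated spaces. A (topological) foliated structure $\mathcal F$ of dimension $n$ on a space $X$ is given by an atlas $\{(U_i,\phi_i)\}$, where $\{U_i\}$ is an open cover of $X$ and $\phi_i:U_i\to B_i\times Z_i$ are homeomorphisms, with $B_i\subset\mathbb R^n$ an open ball and $Z_i$ a locally compact Polish space, whose changes of coordinates are locally of the form $\phi_j\phi_i^{-1}(x,z)=(x_{ij}(x,z),h_{ij}(z))$. The sets $\phi_i^{-1}(B_i\times\{z\})$ are the plaques; the leaves are the connected components of $X$ with the (leaf) topology whose basic open sets are the plaques of all foliated charts. $L_x$ is the leaf through $x$. $(X,\mathcal F)$ is a compact Polish foliated space if $X$ is compact, Hausdorff and second countable. It is transitive if some leaf is dense in $X$. Regular atlas and holonomy. A foliated atlas $\mathcal U=\{(U_i,\phi_i)\}$ is regular if: each $(U_i,\phi_i)$ is the restriction of a foliated chart $(\widetilde U_i,\tilde\phi_i)$ with $\overline{U_i}\subset\widetilde U_i$; $\{U_i\}$ is locally finite; and the closure of every plaque of $(U_i,\phi_i)$ meets at most the closure of one plaque of $(U_j,\phi_j)$, for all $i,j$. Let $p_i:U_i\to Z_i$ be $\phi_i$ followed by the second projection; there are homeomorphisms $h_{ij}:p_i(U_i\cap U_j)\to p_j(U_i\cap U_j)$ with $p_j=h_{ij}p_i$ on $U_i\cap U_j$, generating the holonomy pseudogroup $\mathcal H$ on $\bigsqcup_iZ_i$. The holonomy group of the leaf through $x\in U_i$ is the group of germs at $p_i(x)$ of maps in $\mathcal H$ fixing $p_i(x)$; a leaf is without holonomy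 if this group is trivial. Growth functions. For $x,y$ in the same leaf, $d^*_{\mathcal U}(x,y)=0$ if $x=y$, and otherwise it is the minimum number of $\mathcal U$-plaques whose union is connected and contains $x$ and $y$. For $x\in X$ and $r>0$, $v_{\mathcal U}(x,r)$ is the number of $\mathcal U$-plaques that meet the ball of center $x$ and radius $r$ in $(L_x,d^*_{\mathcal U})$. Residually many. A subset is residual if it contains a countable intersection of dense open subsets. "For residually many points $x$ in $X$" means for all $x$ in some residual subset of $X$.
   Formalization: It is additionally assumed that X is not itself a single leaf (and that n ≥ 1). Otherwise X is a compact manifold or a point, such as the circle with one leaf; then v(x,r) is bounded and limsup log v/log r = 0, which is not in [1,∞], so the claim fails. *)

theory Defs
  imports "HOL-Analysis.Analysis"
begin

section \<open>Foliated spaces\<close>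

text \<open>A chart is a homeomorphism from \<open>dom\<close> onto \<open>ball \<times> trans\<close>; the values of \<open>chart\<close> outside
  \<open>dom\<close> are irrelevant. The transversals of different charts may be different topological spaces:
  only the ambient type of their points is shared.\<close>

record ('a, 'n::finite, 'z) fchart =
  dom :: "'a set"
  chart :: "'a \<Rightarrow> (real^'n) \<times> 'z"
  cball :: "(real^'n) set"
  trans :: "'z topology"

hide_const (open) dom chart cball trans

definition polish_space :: "'a topology \<Rightarrow> bool" where
  "polish_space Z \<longleftrightarrow> separable_space Z \<and> completely_metrizable_space Z"

definition foliated_chart :: "'a topology \<Rightarrow> ('a, 'n::finite, 'z) fchart \<Rightarrow> bool" where
  "foliated_chart X c \<longleftrightarrow>
     openin X (fchart.dom c) \<and>
     (\<exists>b r. 0 < r \<and> fchart.cball c = ball b r) \<and>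
     polish_space (fchart.trans c) \<and> locally_compact_space (fchart.trans c) \<and>
     homeomorphic_map (subtopology X (fchart.dom c))
       (prod_topology (top_of_set (fchart.cball c)) (fchart.trans c)) (fchart.chart c)"

text \<open>The change of coordinates from \<open>c\<close> to \<open>d\<close> is locally of the form
  \<open>(b, z) \<mapsto> (x (b, z), h z)\<close>. Continuity of \<open>x\<close> and \<open>h\<close> follows from that of the charts.\<close>

definition foliated_change ::
  "'a topology \<Rightarrow> ('a, 'n::finite, 'z) fchart \<Rightarrow> ('a, 'n, 'z) fchart \<Rightarrow> bool" where
  "foliated_change X c d \<longleftrightarrow>
     (\<forall>u \<in> fchart.dom c \<inter> fchart.dom d.
        \<exists>W x h. openin X W \<and> u \<in> W \<and> W \<subseteq> fchart.dom c \<inter> fchart.dom d \<and>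
          (\<forall>(b, z) \<in> fchart.chart c ` W.
             fchart.chart d (inv_into (fchart.dom c) (fchart.chart c) (b, z)) = (x (b, z), h z)))"

definition foliated_atlas :: "'a topology \<Rightarrow> ('a, 'n::finite, 'z) fchart set \<Rightarrow> bool" where
  "foliated_atlas X A \<longleftrightarrow>
     (\<forall>c\<in>A. foliated_chart X c) \<and>
     (\<Union>c\<in>A. fchart.dom c) = topspace X \<and>
     (\<forall>c\<in>A. \<forall>d\<in>A. foliated_change X c d)"

text \<open>A foliated structure is represented by any foliated atlas \<open>F\<close> defining it; its charts are all
  the charts compatible with \<open>F\<close>.\<close>

definition charts_of :: "'a topology \<Rightarrow> ('a, 'n::finite, 'z) fchart set \<Rightarrow> ('a, 'n, 'z) fchart set" where
  "charts_of X F =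
     {c. foliated_chart X c \<and> (\<forall>d\<in>F. foliated_change X c d \<and> foliated_change X d c)}"

definition plaques :: "('a, 'n::finite, 'z) fchart \<Rightarrow> 'a set set" where
  "plaques c =
     {{x \<in> fchart.dom c. fchart.chart c x \<in> fchart.cball c \<times> {z}} |z. z \<in> topspace (fchart.trans c)}"

definition leaf_topology :: "'a topology \<Rightarrow> ('a, 'n::finite, 'z) fchart set \<Rightarrow> 'a topology" where
  "leaf_topology X F = topology_generated_by (\<Union>c \<in> charts_of X F. plaques c)"

definition leaves :: "'a topology \<Rightarrow> ('a, 'n::finite, 'z) fchart set \<Rightarrow> 'a set set" where
  "leaves X F = connected_components_of (leaf_topology X F)"

definition leaf :: "'a topology \<Rightarrow> ('a, 'n::finite, 'z) fchart set \<Rightarrow> 'a \<Rightarrow> 'a set" where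
  "leaf X F x = connected_component_of_set (leaf_topology X F) x"

definition dense_set :: "'a topology \<Rightarrow> 'a set \<Rightarrow> bool" where
  "dense_set X S \<longleftrightarrow> X closure_of S = topspace X"

definition compact_polish_foliated_space ::
  "'a topology \<Rightarrow> ('a, 'n::finite, 'z) fchart set \<Rightarrow> bool" where
  "compact_polish_foliated_space X F \<longleftrightarrow>
     foliated_atlas X F \<and> compact_space X \<and> Hausdorff_space X \<and> second_countable X"

definition transitive_foliation :: "'a topology \<Rightarrow> ('a, 'n::finite, 'z) fchart set \<Rightarrow> bool" where
  "transitive_foliation X F \<longleftrightarrow> (\<exists>L \<in> leaves X F. dense_set X L)"


section \<open>Regular atlases and holonomy\<close>

definition regular_foliated_atlas ::
  "'a topology \<Rightarrow> ('a, 'n::finite, 'z) fchart set \<Rightarrow> ('a, 'n, 'z) fchart set \<Rightarrow> bool" where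
  "regular_foliated_atlas X F A \<longleftrightarrow>
     foliated_atlas X A \<and> A \<subseteq> charts_of X F \<and>
     (\<forall>c\<in>A. \<exists>c' \<in> charts_of X F.
        X closure_of (fchart.dom c) \<subseteq> fchart.dom c' \<and>
        (\<forall>x \<in> fchart.dom c. fchart.chart c x = fchart.chart c' x)) \<and>
     (\<forall>x \<in> topspace X. \<exists>V. openin X V \<and> x \<in> V \<and> finite {c\<in>A. fchart.dom c \<inter> V \<noteq> {}}) \<and>
     (\<forall>c\<in>A. \<forall>d\<in>A. \<forall>P \<in> plaques c. \<forall>Q \<in> plaques d. \<forall>Q' \<in> plaques d.
        X closure_of P \<inter> X closure_of Q \<noteq> {} \<longrightarrow>
        X closure_of P \<inter> X closure_of Q' \<noteq> {} \<longrightarrow> Q = Q')"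

definition transverse_proj :: "('a, 'n::finite, 'z) fchart \<Rightarrow> 'a \<Rightarrow> 'z" where
  "transverse_proj c x = snd (fchart.chart c x)"

text \<open>Local homeomorphisms of a space \<open>T\<close> are represented by their graphs. Composition, inversion
  and restriction are then relational composition, converse and intersection; a family of maps can
  be glued to a local homeomorphism exactly if the union of the graphs is the graph of an
  injective map.\<close>

inductive_set generated_pseudogroup ::
  "'t topology \<Rightarrow> ('t \<times> 't) set set \<Rightarrow> ('t \<times> 't) set set"
  for T :: "'t topology" and G :: "('t \<times> 't) set set" where
  gen: "g \<in> G \<Longrightarrow> g \<in> generated_pseudogroup T G"
| ident: "Id_on (topspace T) \<in> generated_pseudogroup T G"
| inverse: "f \<in> generated_pseudogroup T G \<Longrightarrow> f\<inverse> \<in> generated_pseudogroup T G"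
| comp: "\<lbrakk>f \<in> generated_pseudogroup T G; g \<in> generated_pseudogroup T G\<rbrakk>
    \<Longrightarrow> f O g \<in> generated_pseudogroup T G"
| restrict: "\<lbrakk>f \<in> generated_pseudogroup T G; openin T V\<rbrakk>
    \<Longrightarrow> f \<inter> V \<times> UNIV \<in> generated_pseudogroup T G"
| glue: "\<lbrakk>\<forall>f\<in>S. f \<in> generated_pseudogroup T G;
      single_valued (\<Union>S); single_valued ((\<Union>S)\<inverse>)\<rbrakk>
    \<Longrightarrow> \<Union>S \<in> generated_pseudogroup T G"

definition total_transversal ::
  "('a, 'n::finite, 'z) fchart set \<Rightarrow> (('a, 'n, 'z) fchart \<times> 'z) topology" where
  "total_transversal A = sum_topology fchart.trans A"

text \<open>The graph of \<open>h\<^sub>c\<^sub>d\<close>, which is determined by \<open>p\<^sub>d = h\<^sub>c\<^sub>d \<circ> p\<^sub>c\<close> on the overlap of the charts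
  (and is single-valued for a regular atlas).\<close>

definition holonomy_map :: "('a, 'n::finite, 'z) fchart \<Rightarrow> ('a, 'n, 'z) fchart \<Rightarrow>
    ((('a, 'n, 'z) fchart \<times> 'z) \<times> (('a, 'n, 'z) fchart \<times> 'z)) set" where
  "holonomy_map c d =
     (\<lambda>x. ((c, transverse_proj c x), (d, transverse_proj d x))) ` (fchart.dom c \<inter> fchart.dom d)"

definition holonomy_pseudogroup :: "('a, 'n::finite, 'z) fchart set \<Rightarrow>
    ((('a, 'n, 'z) fchart \<times> 'z) \<times> (('a, 'n, 'z) fchart \<times> 'z)) set set" where
  "holonomy_pseudogroup A =
     generated_pseudogroup (total_transversal A) {holonomy_map c d |c d. c \<in> A \<and> d \<in> A}"

definition same_germ :: "'t topology \<Rightarrow> 't \<Rightarrow> (('t \<times> 't) set \<times> ('t \<times> 't) set) set" where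
  "same_germ T t = {(f, g). \<exists>V. openin T V \<and> t \<in> V \<and> f \<inter> V \<times> UNIV = g \<inter> V \<times> UNIV}"

text \<open>The set of elements of the holonomy group at \<open>p\<^sub>c(x)\<close>, for \<open>x\<close> in the domain of \<open>c\<close>; germs are
  equivalence classes of elements of the pseudogroup. The group is trivial if and only if this set
  has exactly one element, namely the germ of the identity.\<close>

definition holonomy_group :: "('a, 'n::finite, 'z) fchart set \<Rightarrow> ('a, 'n, 'z) fchart \<Rightarrow> 'a \<Rightarrow>
    ((('a, 'n, 'z) fchart \<times> 'z) \<times> (('a, 'n, 'z) fchart \<times> 'z)) set set set" where
  "holonomy_group A c x =
     (let t = (c, transverse_proj c x);
          H = {f \<in> holonomy_pseudogroup A. (t, t) \<in> f}
      in H // (same_germ (total_transversal A) t \<inter> H \<times> H))"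

definition without_holonomy :: "('a, 'n::finite, 'z) fchart set \<Rightarrow> 'a set \<Rightarrow> bool" where
  "without_holonomy A L \<longleftrightarrow>
     (\<forall>x\<in>L. \<forall>c\<in>A. x \<in> fchart.dom c \<longrightarrow> is_singleton (holonomy_group A c x))"

definition dense_leaves_without_holonomy ::
  "'a topology \<Rightarrow> ('a, 'n::finite, 'z) fchart set \<Rightarrow> ('a, 'n, 'z) fchart set \<Rightarrow> 'a set" where
  "dense_leaves_without_holonomy X F A =
     \<Union>{L \<in> leaves X F. dense_set X L \<and> without_holonomy A L}"


section \<open>Growth of leaves\<close>

definition atlas_plaques :: "('a, 'n::finite, 'z) fchart set \<Rightarrow> 'a set set" where
  "atlas_plaques A = (\<Union>c\<in>A. plaques c)"

text \<open>Only meaningful for \<open>x\<close> and \<open>y\<close> in the same leaf.\<close>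

definition plaque_dist :: "'a topology \<Rightarrow> ('a, 'n::finite, 'z) fchart set \<Rightarrow>
    ('a, 'n, 'z) fchart set \<Rightarrow> 'a \<Rightarrow> 'a \<Rightarrow> nat" where
  "plaque_dist X F A x y =
     (if x = y then 0
      else LEAST k. \<exists>\<P>. \<P> \<subseteq> atlas_plaques A \<and> finite \<P> \<and> card \<P> = k \<and>
             connectedin (leaf_topology X F) (\<Union>\<P>) \<and> x \<in> \<Union>\<P> \<and> y \<in> \<Union>\<P>)"

definition leaf_ball :: "'a topology \<Rightarrow> ('a, 'n::finite, 'z) fchart set \<Rightarrow>
    ('a, 'n, 'z) fchart set \<Rightarrow> 'a \<Rightarrow> real \<Rightarrow> 'a set" where
  "leaf_ball X F A x r = {y \<in> leaf X F x. real (plaque_dist X F A x y) < r}"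

definition growth :: "'a topology \<Rightarrow> ('a, 'n::finite, 'z) fchart set \<Rightarrow>
    ('a, 'n, 'z) fchart set \<Rightarrow> 'a \<Rightarrow> real \<Rightarrow> nat" where
  "growth X F A x r = card {P \<in> atlas_plaques A. P \<inter> leaf_ball X F A x r \<noteq> {}}"


section \<open>Residual sets\<close>

definition residual_in :: "'a topology \<Rightarrow> 'a set \<Rightarrow> bool" where
  "residual_in X S \<longleftrightarrow> S \<subseteq> topspace X \<and>
     (\<exists>\<G>. countable \<G> \<and> (\<forall>G\<in>\<G>. openin X G \<and> dense_set X G) \<and> topspace X \<inter> \<Inter>\<G> \<subseteq> S)"

definition residually_many :: "'a topology \<Rightarrow> ('a \<Rightarrow> bool) \<Rightarrow> bool" where
  "residually_many X P \<longleftrightarrow> (\<exists>S. residual_in X S \<and> (\<forall>x\<in>S. P x))"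

end

theory Submission
  imports Defs "HOL-Real_Asymp.Real_Asymp"
begin

text \<open>The number of plaques within distance \<open>r\<close> of \<open>x\<close> agrees up to a bounded factor with the
  number of pairs (chart, transverse coordinate) reached from \<open>x\<close> by chains of \<open>\<lceil>r\<rceil>\<close> plaques, each
  meeting the next. Chains persist under small moves of \<open>x\<close> and Hausdorff transversals keep distinct
  ends distinct, so this number is lower semicontinuous in \<open>x\<close>. Growth at one point of a dense leaf
  is thus attained, at arbitrarily large radii, on a dense open set: the upper limits on residually
  many leaves equal their suprema over all dense leaves.

  In the other direction, a limit of chains is only a chain of closed plaques. Shrinking the charts
  to compact sets \<open>C\<^sub>i\<close> repairs this: by compactness every plaque is crossed in a uniformly
  bounded number \<open>K\<close> of steps inside the \<open>C\<^sub>i\<close>, and such steps are closed conditions. At a point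
  where chains with the same end have the same germ, counts at radius \<open>r\<close> at nearby points are then
  bounded by a multiple of the count at radius \<open>K r\<close>. These points are residual, because the boundary of the
  closed set where two chains agree is nowhere dense, and they include the leaves without holonomy.
  Hence the lower limits on residually many leaves are given by infima over such leaves, exactly for
  \<open>ln v / ln r\<close> and up to the factor \<open>p = K\<close> for \<open>ln v / r\<close>.\<close>

section \<open>Chains of plaques\<close>

text \<open>Points are compared through codes, that is, lists of charts. A plaque belongs to one
  leaf, whereas a code can be tried from any point, and there are finitely many codes of each
  length; every semicontinuity statement becomes finitely many conditions, open or closed in the
  starting point.

  The two directions are not symmetric. The rooms \<open>C i\<close> cure the first at the price of
  a radius \<open>K r\<close>, and excluding branching cures the second. This price is a term
  \<open>ln K\<close> added to \<open>ln r\<close>, but a factor \<open>K\<close> on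
  \<open>r\<close>, so only the lower limit of \<open>ln v / r\<close> keeps a gap.

  The bounds \<open>1 \<le> a1\<close> and \<open>1 \<le> a3\<close> hold because a dense leaf is
  not closed: as soon as a step meets no new plaque, the leaf arises from a point by finitely many
  closed saturations, so it is closed. A leaf both dense and closed would be all of the space.
  Finiteness of \<open>a2\<close> and \<open>a4\<close> comes from there being at most
  \<open>card I ^ n\<close> codes of length \<open>n\<close>.\<close>

text \<open>On \<open>S\<close> the map \<open>f\<close> factors through \<open>g\<close>. Both will
  be ends of the same codes seen from two nearby points: one assignment of the roles gives lower
  semicontinuity, the other the upper bound at unbranched points.\<close>

lemma card_image_le_of_factor:
  assumes "finite S" "\<And>a b. a \<in> S \<Longrightarrow> b \<in> S \<Longrightarrow> g a = g b \<Longrightarrow> f a = f b"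
  shows "card (f ` S) \<le> card (g ` S)"
proof -
  have "f ` S \<subseteq> (\<lambda>c. f (SOME a. a \<in> S \<and> g a = c)) ` g ` S"
  proof
    fix u assume "u \<in> f ` S"
    then obtain a where a: "a \<in> S" "u = f a" by blast
    have "(SOME b. b \<in> S \<and> g b = g a) \<in> S \<and> g (SOME b. b \<in> S \<and> g b = g a) = g a"
      by (rule someI[of _ a]) (use a in auto)
    then have "f a = f (SOME b. b \<in> S \<and> g b = g a)" using assms(2) a by metis
    then show "u \<in> (\<lambda>c. f (SOME a. a \<in> S \<and> g a = c)) ` g ` S" using a by blast
  qed
  then show ?thesis by (rule surj_card_le[OF finite_imageI[OF assms(1)]])
qed

lemma eventually_nhdsin_topspace: "\<forall>\<^sub>F y in nhdsin X x. y \<in> topspace X"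
  unfolding eventually_nhdsin using openin_topspace by blast

text \<open>The plaques are the fibres of the \<open>q i\<close>, and openness of \<open>q i\<close>
  lets nearby plaques follow a given one. \<open>coherent\<close> is the form in which regularity
  enters: the points that a plaque of \<open>i\<close> has in \<open>U j\<close> lie on one plaque
  of \<open>j\<close>.\<close>

locale transverse_atlas =
  fixes X :: "'a topology" and I :: "'i set" and U :: "'i \<Rightarrow> 'a set"
    and Z :: "'i \<Rightarrow> 'z topology" and q :: "'i \<Rightarrow> 'a \<Rightarrow> 'z"
  assumes finite_I: "finite I"
    and open_U: "i \<in> I \<Longrightarrow> openin X (U i)"
    and cover: "(\<Union>i\<in>I. U i) = topspace X"
    and cont_q: "i \<in> I \<Longrightarrow> continuous_map (subtopology X (U i)) (Z i) (q i)"
    and open_q: "i \<in> I \<Longrightarrow> open_map (subtopology X (U i)) (Z i) (q i)"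
    and Hausdorff_Z: "i \<in> I \<Longrightarrow> Hausdorff_space (Z i)"
    and coherent: "\<lbrakk>i \<in> I; j \<in> I; x \<in> U i \<inter> U j; y \<in> U i \<inter> U j; q i x = q i y\<rbrakk> \<Longrightarrow> q j x = q j y"
begin

definition same :: "'i \<Rightarrow> ('a \<times> 'a) set" where
  "same i = {(x, y). x \<in> U i \<and> y \<in> U i \<and> q i x = q i y}"

text \<open>Each intermediate point lies on two consecutive plaques, so a code of length
  \<open>n\<close> describes \<open>n\<close> plaques, each meeting the next.\<close>

fun chain :: "'i list \<Rightarrow> ('a \<times> 'a) set" where
  "chain [] = Id_on (topspace X)"
| "chain (i # is) = same i O chain is"

definition step :: "('a \<times> 'a) set" where
  "step = (\<Union>i\<in>I. same i)"

definition codes :: "nat \<Rightarrow> 'a \<Rightarrow> 'i list set" where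
  "codes n x = {is \<in> lists I. length is = n \<and> x \<in> Domain (chain is)}"

text \<open>For a nonempty chain the coordinate does not depend on the choice of \<open>y\<close> (\<open>endp_eq\<close>).\<close>

definition endp :: "'i list \<Rightarrow> 'a \<Rightarrow> 'i \<times> 'z" where
  "endp is x = (last is, q (last is) (SOME y. (x, y) \<in> chain is))"

definition reach :: "nat \<Rightarrow> 'a \<Rightarrow> ('i \<times> 'z) set" where
  "reach n x = (\<lambda>is. endp is x) ` codes n x"

definition nreach :: "nat \<Rightarrow> 'a \<Rightarrow> nat" where
  "nreach n x = card (reach n x)"

section \<open>Chains and the plaques on which they end\<close>

lemma U_topspace: "i \<in> I \<Longrightarrow> x \<in> U i \<Longrightarrow> x \<in> topspace X"
  using cover by blast

lemma same_sym: "(x, y) \<in> same i \<Longrightarrow> (y, x) \<in> same i"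
  by (auto simp: same_def)

lemma same_coherent:
  assumes "i \<in> I" "j \<in> I" "(x, y) \<in> same i" "x \<in> U j" "y \<in> U j"
  shows "(x, y) \<in> same j"
  using coherent[of i j x y] assms by (auto simp: same_def)

lemma chain_topspace:
  "is \<in> lists I \<Longrightarrow> (x, y) \<in> chain is \<Longrightarrow> x \<in> topspace X \<and> y \<in> topspace X"
proof (induction "is" arbitrary: x)
  case (Cons i "is") then show ?case using U_topspace by (auto simp: same_def)
qed auto

lemma chain_append:
  "is \<in> lists I \<Longrightarrow> chain (is @ js) = chain is O chain js" if "js \<in> lists I"
proof (induction "is")
  case Nil then show ?case using chain_topspace[OF that] by (auto simp: relcomp_unfold Id_on_def)
qed auto

lemma chain_last:
  "is \<in> lists I \<Longrightarrow> is \<noteq> [] \<Longrightarrow> (x, y) \<in> chain is \<Longrightarrow> y \<in> U (last is)"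
proof (induction "is" arbitrary: x)
  case (Cons i "is")
  then show ?case by (cases "is = []") (auto simp: same_def)
qed auto

text \<open>Coherence hands a common plaque on from each chart of the code to the next, because both
  intermediate points lie in both charts. Thus the code and the first plaque determine the last
  plaque.\<close>

lemma chain_coherent:
  assumes "is \<in> lists I" "is \<noteq> []" "(x, y) \<in> chain is" "(x', y') \<in> chain is" "(x, x') \<in> same (hd is)"
  shows "(y, y') \<in> same (last is)"
  using assms
proof (induction "is" arbitrary: x x' rule: list.induct)
  case (Cons i "is")
  then obtain u u' where u: "(x, u) \<in> same i" "(u, y) \<in> chain is" "(x', u') \<in> same i" "(u', y') \<in> chain is"
    by auto
  have uu: "(u, u') \<in> same i"
    using u Cons.prems by (auto simp: same_def)
  show ?case
  proof (cases "is = []")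
    case True
    then show ?thesis using u uu by auto
  next
    case False
    then obtain j js where js: "is = j # js" by (cases "is") auto
    then have "u \<in> U j" "u' \<in> U j" using u by (auto simp: same_def)
    moreover have "i \<in> I" "j \<in> I" using Cons.prems js by auto
    ultimately have "(u, u') \<in> same (hd is)"
      using same_coherent[of i j u u'] uu js by simp
    then show ?thesis using Cons.IH[of u u'] Cons.prems u False by auto
  qed
qed auto

lemma chain_hd:
  "is \<noteq> [] \<Longrightarrow> (x, y) \<in> chain is \<Longrightarrow> (x, x) \<in> same (hd is)"
  by (cases "is") (auto simp: same_def)

lemma chain_end_same:
  assumes "is \<in> lists I" "is \<noteq> []" "(x, y) \<in> chain is" "(x, y') \<in> chain is"
  shows "(y, y') \<in> same (last is)"
  using chain_coherent[OF assms] chain_hd assms by blast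

lemma endp_eq:
  assumes "is \<in> lists I" "is \<noteq> []" "(x, y) \<in> chain is"
  shows "endp is x = (last is, q (last is) y)"
proof -
  have "(x, SOME y. (x, y) \<in> chain is) \<in> chain is" using assms(3) by (rule someI)
  from chain_end_same[OF assms(1,2) this assms(3)] show ?thesis
    by (simp add: endp_def same_def)
qed

section \<open>Dependence of a chain on its starting point\<close>

lemma same_image_open:
  assumes "i \<in> I" "openin X S" shows "openin X (same i `` S)"
proof -
  have "openin (subtopology X (U i)) (U i \<inter> S)"
    using assms by (simp add: openin_subtopology_Int2)
  then have o: "openin (Z i) (q i ` (U i \<inter> S))"
    using open_q[OF assms(1)] by (simp add: open_map_def)
  \<comment> \<open>The plaques of \<open>i\<close> that meet \<open>S\<close> together fill the
    preimage under \<open>q i\<close> of an open image.\<close>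
  have "openin (subtopology X (U i)) {x \<in> topspace (subtopology X (U i)). q i x \<in> q i ` (U i \<inter> S)}"
    by (rule openin_continuous_map_preimage[OF cont_q[OF assms(1)] o])
  moreover have "{x \<in> topspace (subtopology X (U i)). q i x \<in> q i ` (U i \<inter> S)} = same i `` S"
    by (auto simp: same_def U_topspace[OF assms(1)]) (metis IntI imageI)
  ultimately show ?thesis using open_U[OF assms(1)] openin_trans_full by fastforce
qed

lemma chain_preimage_open:
  "is \<in> lists I \<Longrightarrow> openin X S \<Longrightarrow> openin X {x. \<exists>y\<in>S. (x, y) \<in> chain is}"
proof (induction "is")
  case Nil
  have "{x. \<exists>y\<in>S. (x, y) \<in> chain []} = S" using openin_subset[OF Nil(2)] by auto
  then show ?case using Nil by simp
next
  case (Cons i "is")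
  have "{x. \<exists>y\<in>S. (x, y) \<in> chain (i # is)} = same i `` {x. \<exists>y\<in>S. (x, y) \<in> chain is}"
    using same_sym by (fastforce simp: relcomp_unfold)
  then show ?case using Cons same_image_open by simp
qed

lemma Domain_chain_open:
  assumes "is \<in> lists I" shows "openin X (Domain (chain is))"
proof -
  have "Domain (chain is) = {x. \<exists>y\<in>topspace X. (x, y) \<in> chain is}"
    using chain_topspace[OF assms] by auto
  then show ?thesis using chain_preimage_open[OF assms, of "topspace X"] by simp
qed

lemma chain_rev:
  "is \<in> lists I \<Longrightarrow> (x, y) \<in> chain is \<Longrightarrow> (y, x) \<in> chain (rev is)"
proof (induction "is" arbitrary: x)
  case (Cons i "is")
  then obtain u where u: "(x, u) \<in> same i" "(u, y) \<in> chain is" by auto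
  have "(u, x) \<in> chain [i]" using same_sym[OF u(1)] U_topspace Cons.prems
    by (auto simp: same_def relcomp_unfold Id_on_def)
  moreover have "rev is \<in> lists I" "[i] \<in> lists I" using Cons.prems by auto
  ultimately show ?case
    using chain_append[of "[i]" "rev is"] Cons.IH[of u] u Cons.prems(1) by auto
qed auto

text \<open>Continuity of the last plaque in the starting point for a fixed code. With Hausdorff
  transversals it keeps distinct ends distinct.\<close>

lemma endp_preimage_open:
  assumes "is \<in> lists I" "is \<noteq> []" "openin (Z (last is)) N"
  shows "openin X {x \<in> Domain (chain is). snd (endp is x) \<in> N}"
proof -
  let ?d = "last is"
  have d: "?d \<in> I" using assms by auto
  have "openin (subtopology X (U ?d)) {x \<in> topspace (subtopology X (U ?d)). q ?d x \<in> N}"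
    by (rule openin_continuous_map_preimage[OF cont_q[OF d] assms(3)])
  then have "openin X {x \<in> topspace (subtopology X (U ?d)). q ?d x \<in> N}"
    using open_U[OF d] by (rule openin_trans_full)
  moreover have "{x \<in> Domain (chain is). snd (endp is x) \<in> N} =
    {x. \<exists>y\<in>{x \<in> topspace (subtopology X (U ?d)). q ?d x \<in> N}. (x, y) \<in> chain is}" (is "?L = ?R")
  proof (intro equalityI subsetI)
    fix x assume "x \<in> ?L"
    then obtain y where y: "(x, y) \<in> chain is" "snd (endp is x) \<in> N" by blast
    then have "y \<in> {x \<in> topspace (subtopology X (U ?d)). q ?d x \<in> N}"
      using endp_eq[OF assms(1,2) y(1)] chain_last[OF assms(1,2) y(1)] chain_topspace[OF assms(1) y(1)]
      by simp
    then show "x \<in> ?R" using y(1) by blast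
  next
    fix x assume "x \<in> ?R"
    then obtain y where y: "(x, y) \<in> chain is" "q ?d y \<in> N" by blast
    then show "x \<in> ?L" using endp_eq[OF assms(1,2) y(1)] by auto
  qed
  ultimately show ?thesis using chain_preimage_open[OF assms(1)] by (simp only:)
qed

lemma endp_in: "is \<in> lists I \<Longrightarrow> is \<noteq> [] \<Longrightarrow> x \<in> Domain (chain is) \<Longrightarrow>
  snd (endp is x) \<in> topspace (Z (last is))"
proof -
  assume a: "is \<in> lists I" "is \<noteq> []" "x \<in> Domain (chain is)"
  then obtain y where y: "(x, y) \<in> chain is" by auto
  have d: "last is \<in> I" using a by auto
  have "y \<in> U (last is)" using chain_last a y by blast
  then have "q (last is) y \<in> topspace (Z (last is))"
    using continuous_map_image_subset_topspace[OF cont_q[OF d]] U_topspace[OF d] by auto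
  then show ?thesis using endp_eq[OF a(1,2) y] by simp
qed

section \<open>Counting ends, by codes and by powers of \<open>step\<close>\<close>

lemma finite_codes: "finite (codes n x)"
proof (rule finite_subset)
  show "codes n x \<subseteq> {is. set is \<subseteq> I \<and> length is = n}" by (auto simp: codes_def)
qed (rule finite_lists_length_eq[OF finite_I])

lemma finite_reach [simp]: "finite (reach n x)"
  by (simp add: reach_def finite_codes)

lemma nreach_le_power: "nreach n x \<le> card I ^ n"
proof -
  have "nreach n x \<le> card (codes n x)" unfolding nreach_def reach_def by (rule card_image_le[OF finite_codes])
  also have "\<dots> \<le> card {is. set is \<subseteq> I \<and> length is = n}"
    by (rule card_mono) (auto simp: codes_def finite_lists_length_eq[OF finite_I])
  finally show ?thesis by (simp add: card_lists_length_eq[OF finite_I])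
qed

text \<open>For \<open>n = 0\<close> the only code is empty and \<open>last []\<close> carries no
  meaning; this is the reason for \<open>0 < n\<close> here and below.\<close>

lemma reach_iff:
  assumes "n > 0"
  shows "(d, z) \<in> reach n x \<longleftrightarrow>
    (\<exists>is y. is \<in> lists I \<and> length is = n \<and> last is = d \<and> (x, y) \<in> chain is \<and> y \<in> U d \<and> q d y = z)"
proof
  assume "(d, z) \<in> reach n x"
  then obtain "is" where i: "is \<in> codes n x" "(d, z) = endp is x" by (auto simp: reach_def)
  then obtain y where "(x, y) \<in> chain is" "is \<in> lists I" "length is = n" by (auto simp: codes_def)
  with i endp_eq[of "is" x y] chain_last[of "is" x y] assms
  show "\<exists>is y. is \<in> lists I \<and> length is = n \<and> last is = d \<and> (x, y) \<in> chain is \<and> y \<in> U d \<and> q d y = z"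
    by (intro exI[of _ "is"] exI[of _ y]) auto
next
  assume "\<exists>is y. is \<in> lists I \<and> length is = n \<and> last is = d \<and> (x, y) \<in> chain is \<and> y \<in> U d \<and> q d y = z"
  then obtain "is" y where i: "is \<in> lists I" "length is = n" "last is = d" "(x, y) \<in> chain is" "q d y = z"
    by blast
  then have "is \<in> codes n x" "is \<noteq> []" using assms by (auto simp: codes_def)
  moreover have "endp is x = (d, z)" using endp_eq[of "is" x y] i \<open>is \<noteq> []\<close> by simp
  ultimately show "(d, z) \<in> reach n x" unfolding reach_def by (metis imageI)
qed

lemma step_refl: "x \<in> topspace X \<Longrightarrow> (x, x) \<in> step"
  using cover by (auto simp: step_def same_def)

lemma step_sym: "sym step"
  using same_sym by (auto simp: step_def sym_def)

lemma relpow_step_iff: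
  assumes "x \<in> topspace X"
  shows "(x, y) \<in> step ^^ n \<longleftrightarrow> (\<exists>is\<in>lists I. length is = n \<and> (x, y) \<in> chain is)"
  using assms
proof (induction n arbitrary: x)
  case 0
  then show ?case by auto
next
  case (Suc n)
  have "(x, y) \<in> step ^^ Suc n \<longleftrightarrow> (\<exists>u. (x, u) \<in> step \<and> (u, y) \<in> step ^^ n)"
    by (metis relpow_Suc_D2 relpow_Suc_I2)
  also have "\<dots> \<longleftrightarrow> (\<exists>u. \<exists>i\<in>I. (x, u) \<in> same i \<and> (\<exists>is\<in>lists I. length is = n \<and> (u, y) \<in> chain is))"
  proof -
    have "(u, y) \<in> step ^^ n \<longleftrightarrow> (\<exists>is\<in>lists I. length is = n \<and> (u, y) \<in> chain is)"
      if "i \<in> I" "(x, u) \<in> same i" for i u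
      using Suc.IH[of u] U_topspace[of i u] that by (simp add: same_def)
    then show ?thesis unfolding step_def by blast
  qed
  also have "\<dots> \<longleftrightarrow> (\<exists>is\<in>lists I. length is = Suc n \<and> (x, y) \<in> chain is)"
  proof
    assume "\<exists>u. \<exists>i\<in>I. (x, u) \<in> same i \<and> (\<exists>is\<in>lists I. length is = n \<and> (u, y) \<in> chain is)"
    then obtain u i "is" where "i \<in> I" "(x, u) \<in> same i" "is \<in> lists I" "length is = n" "(u, y) \<in> chain is"
      by blast
    then show "\<exists>is\<in>lists I. length is = Suc n \<and> (x, y) \<in> chain is"
      by (intro bexI[of _ "i # is"]) auto
  next
    assume "\<exists>is\<in>lists I. length is = Suc n \<and> (x, y) \<in> chain is"
    then obtain i "is" where "i # is \<in> lists I" "length is = n" "(x, y) \<in> chain (i # is)"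
      by (metis length_Suc_conv)
    then show "\<exists>u. \<exists>i\<in>I. (x, u) \<in> same i \<and> (\<exists>is\<in>lists I. length is = n \<and> (u, y) \<in> chain is)"
      by auto
  qed
  finally show ?case .
qed

lemma step_topspace: "(x, y) \<in> step \<Longrightarrow> x \<in> topspace X \<and> y \<in> topspace X"
  using U_topspace by (auto simp: step_def same_def)

lemma relpow_step_topspace: "(x, y) \<in> step ^^ n \<Longrightarrow> x \<in> topspace X \<Longrightarrow> y \<in> topspace X"
  by (cases n) (auto dest: step_topspace)

lemma relpow_step_sym: "(x, y) \<in> step ^^ n \<Longrightarrow> (y, x) \<in> step ^^ n"
proof (induction n arbitrary: y)
  case (Suc n)
  then obtain u where "(x, u) \<in> step ^^ n" "(u, y) \<in> step" by (elim relpow_Suc_E)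
  then show ?case using Suc.IH[of u] step_sym by (meson relpow_Suc_I2 symD)
qed auto

lemma relpow_step_mono:
  assumes "(x, y) \<in> step ^^ m" "m \<le> n" "x \<in> topspace X"
  shows "(x, y) \<in> step ^^ n"
  using assms(2,1,3)
proof (induction rule: dec_induct)
  case (step n)
  then have "(x, y) \<in> step ^^ n" by simp
  moreover have "(y, y) \<in> step" using step relpow_step_topspace[of x y m] step_refl by blast
  ultimately show ?case by auto
qed auto

text \<open>The last letter of a code selects a plaque through the point reached by the other
  letters, so \<open>n\<close> steps followed by a plaque make a code of length
  \<open>Suc n\<close>.\<close>

lemma reach_iff_step:
  assumes "x \<in> topspace X"
  shows "(d, z) \<in> reach (Suc n) x \<longleftrightarrow> d \<in> I \<and> (\<exists>y \<in> U d. (x, y) \<in> step ^^ n \<and> q d y = z)"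
proof
  assume "(d, z) \<in> reach (Suc n) x"
  then obtain "is" y where i: "is \<in> lists I" "length is = Suc n" "last is = d" "(x, y) \<in> chain is" "y \<in> U d" "q d y = z"
    using reach_iff[of "Suc n"] by auto
  have ne: "is \<noteq> []" using i by auto
  then have isd: "is = butlast is @ [d]" using i append_butlast_last_id by metis
  have l: "butlast is \<in> lists I" "d \<in> I" using i ne by (auto dest: in_set_butlastD)
  then obtain u where u: "(x, u) \<in> chain (butlast is)" "(u, y) \<in> same d"
    using chain_append[of "[d]" "butlast is"] i isd by auto
  have "length (butlast is) = n" using i by simp
  then have "(x, u) \<in> step ^^ n" using relpow_step_iff[OF assms, of u n] l u by blast
  then show "d \<in> I \<and> (\<exists>y \<in> U d. (x, y) \<in> step ^^ n \<and> q d y = z)"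
    using u l i by (auto simp: same_def)
next
  assume a: "d \<in> I \<and> (\<exists>y \<in> U d. (x, y) \<in> step ^^ n \<and> q d y = z)"
  then obtain y "is" where y: "y \<in> U d" "q d y = z" "is \<in> lists I" "length is = n" "(x, y) \<in> chain is"
    using relpow_step_iff[OF assms, of _ n] by auto
  have "(y, y) \<in> chain [d]" using y a U_topspace[of d y] by (auto simp: same_def)
  then have "(x, y) \<in> chain (is @ [d])"
    using chain_append[of "[d]" "is"] a y by auto
  moreover have "is @ [d] \<in> lists I" "length (is @ [d]) = Suc n" "last (is @ [d]) = d" using y a by auto
  ultimately show "(d, z) \<in> reach (Suc n) x"
    unfolding reach_iff[OF zero_less_Suc] using y by blast
qed

lemma reach_mono:
  assumes "x \<in> topspace X" "0 < m" "m \<le> n"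
  shows "reach m x \<subseteq> reach n x"
proof -
  obtain m' n' where [simp]: "m = Suc m'" "n = Suc n'" "m' \<le> n'"
    using assms by (metis Suc_le_mono gr0_conv_Suc order_less_le_trans)
  show ?thesis
  proof clarify
    fix d z assume "(d, z) \<in> reach m x"
    then show "(d, z) \<in> reach n x"
      using relpow_step_mono[of x _ m' n'] assms(1) by (fastforce simp: reach_iff_step)
  qed
qed

lemma nreach_mono: "x \<in> topspace X \<Longrightarrow> 0 < m \<Longrightarrow> m \<le> n \<Longrightarrow> nreach m x \<le> nreach n x"
  unfolding nreach_def by (intro card_mono reach_mono) auto

text \<open>Moving the base point inside its leaf costs a constant in the radius. This is what lets
  growth at one point speak for its whole, possibly dense, leaf.\<close>

lemma nreach_leaf:
  assumes "x \<in> topspace X" "(x, x') \<in> step ^^ k" "0 < n"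
  shows "nreach n x' \<le> nreach (n + k) x"
proof -
  obtain n' where [simp]: "n = Suc n'" using assms(3) gr0_conv_Suc by blast
  have x': "x' \<in> topspace X" using assms relpow_step_topspace by blast
  have "reach n x' \<subseteq> reach (Suc (k + n')) x"
  proof clarify
    fix d z assume "(d, z) \<in> reach n x'"
    then obtain y where "d \<in> I" "y \<in> U d" "(x', y) \<in> step ^^ n'" "q d y = z"
      using reach_iff_step[OF x'] by auto
    then show "(d, z) \<in> reach (Suc (k + n')) x"
      using assms(2) relpow_add[of k n' step] by (auto simp: reach_iff_step[OF assms(1)])
  qed
  then have "card (reach n x') \<le> card (reach (Suc (k + n')) x)" by (intro card_mono) auto
  then show ?thesis unfolding nreach_def by (simp add: add.commute)
qed

lemma nreach_pos:
  assumes "x \<in> topspace X" "0 < n" shows "0 < nreach n x"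
proof -
  obtain n' where [simp]: "n = Suc n'" using assms(2) gr0_conv_Suc by blast
  obtain d where "d \<in> I" "x \<in> U d" using cover assms by blast
  moreover have "(x, x) \<in> step ^^ n'" using relpow_step_mono[of x x 0 n'] assms by auto
  ultimately have "(d, q d x) \<in> reach n x" using reach_iff_step[OF assms(1)] by auto
  then show ?thesis unfolding nreach_def using card_gt_0_iff finite_reach by blast
qed

section \<open>Lower semicontinuity of the number of ends\<close>

lemma eventually_Domain_chain:
  assumes "is \<in> lists I" "x \<in> Domain (chain is)"
  shows "\<forall>\<^sub>F y in nhdsin X x. y \<in> Domain (chain is)"
  unfolding eventually_nhdsin using Domain_chain_open assms by blast

lemma eventually_endp_neq:
  assumes "is \<in> lists I" "js \<in> lists I" "is \<noteq> []" "js \<noteq> []" "x \<in> Domain (chain is)" "x \<in> Domain (chain js)"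
    and ne: "endp is x \<noteq> endp js x"
  shows "\<forall>\<^sub>F y in nhdsin X x. endp is y \<noteq> endp js y"
proof (cases "last is = last js")
  case False
  then show ?thesis by (simp add: endp_def)
next
  case True
  let ?d = "last is"
  have "snd (endp is x) \<noteq> snd (endp js x)" using True ne by (simp add: endp_def)
  moreover have "snd (endp is x) \<in> topspace (Z ?d)" "snd (endp js x) \<in> topspace (Z ?d)"
    using endp_in[OF assms(1,3,5)] endp_in[OF assms(2,4,6)] True by simp_all
  moreover have "Hausdorff_space (Z ?d)" using Hausdorff_Z assms by auto
  ultimately obtain N M where NM: "openin (Z ?d) N" "openin (Z ?d) M"
    "snd (endp is x) \<in> N" "snd (endp js x) \<in> M" "disjnt N M"
    unfolding Hausdorff_space_def by blast
  let ?S = "{x \<in> Domain (chain is). snd (endp is x) \<in> N} \<inter> {x \<in> Domain (chain js). snd (endp js x) \<in> M}"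
  have "openin X ?S"
    using NM True by (intro openin_Int endp_preimage_open assms) auto
  moreover have "x \<in> ?S" using NM assms by auto
  moreover have "\<forall>y\<in>?S. endp is y \<noteq> endp js y" using NM by (auto simp: disjnt_iff)
  ultimately show ?thesis unfolding eventually_nhdsin by (intro disjI2 exI[of _ ?S] conjI)
qed

lemma codes_ne: "0 < n \<Longrightarrow> is \<in> codes n x \<Longrightarrow> is \<in> lists I \<and> is \<noteq> [] \<and> x \<in> Domain (chain is)"
  by (auto simp: codes_def)

text \<open>Only the finitely many codes available at \<open>x\<close> matter: they stay available
  and their distinct ends stay distinct. Further codes at \<open>y\<close> can only increase the
  count.\<close>

lemma eventually_nreach_ge:
  assumes "0 < n"
  shows "\<forall>\<^sub>F y in nhdsin X x. nreach n x \<le> nreach n y"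
proof -
  let ?S = "codes n x"
  have "\<forall>\<^sub>F y in nhdsin X x. \<forall>is\<in>?S. y \<in> Domain (chain is)"
    by (intro eventually_ball_finite finite_codes ballI eventually_Domain_chain)
      (use codes_ne[OF assms] in auto)
  moreover have "\<forall>\<^sub>F y in nhdsin X x. \<forall>p\<in>?S \<times> ?S. endp (fst p) x \<noteq> endp (snd p) x \<longrightarrow> endp (fst p) y \<noteq> endp (snd p) y"
  proof (rule eventually_ball_finite, intro finite_cartesian_product finite_codes, rule ballI)
    fix p assume p: "p \<in> ?S \<times> ?S"
    show "\<forall>\<^sub>F y in nhdsin X x. endp (fst p) x \<noteq> endp (snd p) x \<longrightarrow> endp (fst p) y \<noteq> endp (snd p) y"
    proof (cases "endp (fst p) x = endp (snd p) x")
      case False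
      have "fst p \<in> codes n x" "snd p \<in> codes n x" using p by auto
      from codes_ne[OF assms this(1)] codes_ne[OF assms this(2)]
      have "\<forall>\<^sub>F y in nhdsin X x. endp (fst p) y \<noteq> endp (snd p) y"
        using False by (intro eventually_endp_neq) blast+
      then show ?thesis by eventually_elim simp
    qed auto
  qed
  ultimately show ?thesis
  proof eventually_elim
    case (elim y)
    have "?S \<subseteq> codes n y" using elim(1) by (auto simp: codes_def)
    then have "(\<lambda>is. endp is y) ` ?S \<subseteq> reach n y" by (auto simp: reach_def)
    then have "card ((\<lambda>is. endp is y) ` ?S) \<le> nreach n y" unfolding nreach_def by (intro card_mono) auto
    moreover have "nreach n x \<le> card ((\<lambda>is. endp is y) ` ?S)"
      unfolding nreach_def reach_def
    proof (rule card_image_le_of_factor[OF finite_codes])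
      fix a b assume "a \<in> ?S" "b \<in> ?S" "endp a y = endp b y"
      then show "endp a x = endp b x" using bspec[OF elim(2), of "(a, b)"] by auto
    qed
    ultimately show ?case by simp
  qed
qed

end

section \<open>Points without branching\<close>

context transverse_atlas begin

text \<open>Triviality of the holonomy group at \<open>x\<close>, expressed by chains only.\<close>

definition unbranched :: "'a \<Rightarrow> bool" where
  "unbranched x \<longleftrightarrow> x \<in> topspace X \<and>
     (\<forall>is\<in>lists I - {[]}. \<forall>js\<in>lists I - {[]}. x \<in> Domain (chain is) \<longrightarrow> x \<in> Domain (chain js) \<longrightarrow>
        endp is x = endp js x \<longrightarrow> (\<forall>\<^sub>F y in nhdsin X x. endp is y = endp js y))"

lemma unbranchedD:
  assumes "unbranched x" "is \<in> lists I" "is \<noteq> []" "js \<in> lists I" "js \<noteq> []"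
    "x \<in> Domain (chain is)" "x \<in> Domain (chain js)" "endp is x = endp js x"
  shows "\<forall>\<^sub>F y in nhdsin X x. endp is y = endp js y"
  using assms(1)[unfolded unbranched_def, THEN conjunct2, THEN bspec[of _ _ "is"], THEN bspec[of _ _ js]] assms(2-)
  by blast

text \<open>Codes at \<open>x'\<close> become codes at \<open>x\<close> with the same ends when
  preceded by \<open>ks\<close>, and points near \<open>x'\<close> are joined by
  \<open>rev ks\<close> to points near \<open>x\<close>.\<close>

lemma unbranched_chain:
  assumes "unbranched x" "ks \<in> lists I" "ks \<noteq> []" "(x, x') \<in> chain ks"
  shows "unbranched x'"
  unfolding unbranched_def
proof (intro conjI ballI impI)
  have xt: "x \<in> topspace X" and x't: "x' \<in> topspace X"
    using chain_topspace[OF assms(2,4)] by auto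
  show "x' \<in> topspace X" by (fact x't)
  fix "is" js assume i: "is \<in> lists I - {[]}" and j: "js \<in> lists I - {[]}"
    and xi: "x' \<in> Domain (chain is)" and xj: "x' \<in> Domain (chain js)" and eq: "endp is x' = endp js x'"
  have ap: "y \<in> Domain (chain (ks @ ls)) \<and> endp (ks @ ls) y = endp ls y'"
    if l: "ls \<in> lists I - {[]}" and y: "(y, y') \<in> chain ks" "y' \<in> Domain (chain ls)" for ls y y'
  proof -
    obtain u where u: "(y', u) \<in> chain ls" using y by blast
    then have "(y, u) \<in> chain (ks @ ls)" using chain_append[of ls ks] l y assms(2) by auto
    moreover have "ks @ ls \<in> lists I" using l assms(2) by auto
    ultimately show ?thesis using endp_eq[of ls y' u] endp_eq[of "ks @ ls" y u] l u by auto
  qed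
  have "\<forall>\<^sub>F y in nhdsin X x. endp (ks @ is) y = endp (ks @ js) y"
    using ap[OF i assms(4) xi] ap[OF j assms(4) xj] eq i j assms(2)
    by (intro unbranchedD[OF assms(1)]) simp_all
  then obtain V where V: "openin X V" "x \<in> V" "\<And>y. y \<in> V \<Longrightarrow> endp (ks @ is) y = endp (ks @ js) y"
    using xt unfolding eventually_nhdsin by auto
  have rk: "rev ks \<in> lists I" using assms(2) by auto
  let ?V = "{y'. \<exists>y\<in>V. (y', y) \<in> chain (rev ks)}"
  have "x' \<in> ?V" using V(2) chain_rev[OF assms(2,4)] by auto
  then have "\<forall>\<^sub>F y' in nhdsin X x'. y' \<in> ?V"
    unfolding eventually_nhdsin using chain_preimage_open[OF rk V(1)] by (intro disjI2 exI[of _ ?V]) simp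
  moreover have "\<forall>\<^sub>F y' in nhdsin X x'. y' \<in> Domain (chain is)"
    using i xi by (intro eventually_Domain_chain) auto
  moreover have "\<forall>\<^sub>F y' in nhdsin X x'. y' \<in> Domain (chain js)"
    using j xj by (intro eventually_Domain_chain) auto
  ultimately show "\<forall>\<^sub>F y' in nhdsin X x'. endp is y' = endp js y'"
  proof eventually_elim
    case (elim y')
    then obtain y where y: "y \<in> V" "(y', y) \<in> chain (rev ks)" by blast
    have "(y, y') \<in> chain ks" using chain_rev[OF rk y(2)] by simp
    from ap[OF i this elim(2)] ap[OF j this elim(3)] V(3)[OF y(1)] show ?case by simp
  qed
qed

lemma unbranched_step_rtrancl:
  assumes "unbranched x" "(x, y) \<in> step\<^sup>*"
  shows "unbranched y"
  using assms(2,1)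
proof (induction rule: rtrancl_induct)
  case (step y z)
  then obtain i where "i \<in> I" "(y, z) \<in> same i" by (auto simp: step_def)
  then have "(y, z) \<in> chain [i]" using U_topspace by (auto simp: same_def relcomp_unfold Id_on_def)
  then show ?case using unbranched_chain[of y "[i]" z] step \<open>i \<in> I\<close> by auto
qed

definition agree :: "'i list \<Rightarrow> 'i list \<Rightarrow> 'a set" where
  "agree is js = {x \<in> Domain (chain is) \<inter> Domain (chain js). endp is x = endp js x}"

lemma residual_unbranched: "residual_in X {x. unbranched x}"
proof -
  \<comment> \<open>The complement of the frontier of the set where two codes agree. There are
    countably many pairs of codes, since there are finitely many charts.\<close>
  define G where "G p = X interior_of (agree (fst p) (snd p)) \<union> (topspace X - X closure_of (agree (fst p) (snd p)))" for p
  let ?P = "(lists I - {[]}) \<times> (lists I - {[]})"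
  have "countable (lists I)" using finite_I countable_finite by auto
  then have "countable (G ` ?P)" by auto
  moreover have "openin X (G p) \<and> dense_set X (G p)" if p: "p \<in> ?P" for p
  proof
    obtain "is" js where pij: "p = (is, js)" by (cases p)
    then have i: "is \<in> lists I" "is \<noteq> []" and j: "js \<in> lists I" "js \<noteq> []" using p by auto
    let ?E = "agree is js" and ?W = "Domain (chain is) \<inter> Domain (chain js)"
    have G: "G p = X interior_of ?E \<union> (topspace X - X closure_of ?E)" by (simp add: G_def pij)
    show "openin X (G p)" unfolding G by (intro openin_Un openin_diff) auto
    have W: "openin X ?W" using Domain_chain_open i j by blast
    have sub: "?W \<subseteq> topspace X" using openin_subset[OF W] .
    \<comment> \<open>Distinct ends stay distinct nearby, so \<open>?E\<close> is closed relative to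
      the open set \<open>?W\<close> where both codes are available.\<close>
    have "openin X (?W - ?E)"
    proof (subst openin_subopen, intro ballI)
      fix x assume x: "x \<in> ?W - ?E"
      have "\<forall>\<^sub>F y in nhdsin X x. endp is y \<noteq> endp js y"
        using x i j by (intro eventually_endp_neq) (auto simp: agree_def)
      then obtain S where S: "openin X S" "x \<in> S" "\<forall>y\<in>S. endp is y \<noteq> endp js y"
        unfolding eventually_nhdsin using x sub by blast
      then show "\<exists>T. openin X T \<and> x \<in> T \<and> T \<subseteq> ?W - ?E"
        using W x by (intro exI[of _ "S \<inter> ?W"]) (auto simp: agree_def)
    qed
    then have clo: "X closure_of ?E \<inter> ?W \<subseteq> ?E"
      using openin_Int_closure_of_eq_empty[of X "?W - ?E" ?E] by blast
    \<comment> \<open>An open \<open>V\<close> missing \<open>G p\<close> would lie in the closure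
      of \<open>?E\<close> and meet \<open>?E\<close>. Its part in \<open>?W\<close> would lie in
      \<open>?E\<close> itself, being open even in the interior of \<open>?E\<close>, which is
      contained in \<open>G p\<close>.\<close>
    have "V \<inter> G p \<noteq> {}" if V: "openin X V" "V \<noteq> {}" for V
    proof
      assume em: "V \<inter> G p = {}"
      then have VE: "V \<subseteq> X closure_of ?E" using openin_subset[OF V(1)] unfolding G by blast
      then have "V \<inter> ?E \<noteq> {}" using V openin_Int_closure_of_eq_empty[OF V(1), of ?E] by blast
      then obtain x where x: "x \<in> V \<inter> ?E" by blast
      have "V \<inter> ?W \<subseteq> ?E" using VE clo by blast
      then have "V \<inter> ?W \<subseteq> X interior_of ?E" by (rule interior_of_maximal) (use V W in blast)
      moreover have "x \<in> V \<inter> ?W" using x by (auto simp: agree_def)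
      ultimately show False using em unfolding G by blast
    qed
    then show "dense_set X (G p)"
      unfolding dense_set_def dense_intersects_open by blast
  qed
  moreover have "topspace X \<inter> \<Inter>(G ` ?P) \<subseteq> {x. unbranched x}"
  proof
    fix x assume x: "x \<in> topspace X \<inter> \<Inter>(G ` ?P)"
    have *: "\<forall>\<^sub>F y in nhdsin X x. endp is y = endp js y"
      if i: "is \<in> lists I - {[]}" and j: "js \<in> lists I - {[]}"
        and "x \<in> Domain (chain is)" "x \<in> Domain (chain js)" "endp is x = endp js x" for "is" js
    proof -
      have "agree is js \<subseteq> topspace X"
        using openin_subset[OF Domain_chain_open[of "is"]] i by (auto simp: agree_def)
      moreover have "x \<in> agree is js" using that by (simp add: agree_def)
      moreover have "x \<in> G (is, js)" using x i j by blast
      ultimately have "x \<in> X interior_of agree is js"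
        using closure_of_subset[of "agree is js" X] by (auto simp: G_def)
      moreover have "\<forall>y\<in>X interior_of agree is js. endp is y = endp js y"
        using interior_of_subset[of X "agree is js"] by (auto simp: agree_def)
      ultimately show ?thesis unfolding eventually_nhdsin
        by (intro disjI2 exI[of _ "X interior_of agree is js"]) simp
    qed
    have "unbranched x" unfolding unbranched_def
      by (intro conjI ballI impI *) (use x in simp_all)
    then show "x \<in> {x. unbranched x}" by simp
  qed
  moreover have "{x. unbranched x} \<subseteq> topspace X" by (auto simp: unbranched_def)
  ultimately show ?thesis unfolding residual_in_def
    by (intro conjI exI[of _ "G ` ?P"]) blast+
qed

end

text \<open>The \<open>C i\<close> are the shrunk charts, called rooms. The relation in
  \<open>room_steps\<close> is the later \<open>rstep\<close>, written out because that is defined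
  inside the locale. One \<open>K\<close> serves all plaques, and it becomes the constant
  \<open>p\<close> of the theorem.\<close>

locale roomy_atlas = transverse_atlas +
  fixes C :: "'b \<Rightarrow> 'a set" and K :: nat
  assumes compact_X: "compact_space X"
    and closed_C: "i \<in> I \<Longrightarrow> closedin X (C i)"
    and C_subset: "i \<in> I \<Longrightarrow> C i \<subseteq> U i"
    and K_pos: "0 < K"
    and room_steps: "\<lbrakk>i \<in> I; x \<in> U i; y \<in> U i; q i x = q i y\<rbrakk> \<Longrightarrow>
      (x, y) \<in> (\<Union>j\<in>I. {(x, y). x \<in> C j \<and> y \<in> C j \<and> q j x = q j y}) ^^ K"
begin

definition room :: "'b \<Rightarrow> ('a \<times> 'a) set" where
  "room i = {(x, y). x \<in> C i \<and> y \<in> C i \<and> q i x = q i y}"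

definition rstep :: "('a \<times> 'a) set" where
  "rstep = (\<Union>i\<in>I. room i)"

fun rchain :: "'b list \<Rightarrow> ('a \<times> 'a) set" where
  "rchain [] = Id_on (topspace X)"
| "rchain (i # is) = room i O rchain is"

section \<open>Closed steps inside the rooms\<close>

lemma room_sym: "(x, y) \<in> room i \<Longrightarrow> (y, x) \<in> room i"
  by (auto simp: room_def)

lemma room_same: "i \<in> I \<Longrightarrow> room i \<subseteq> same i"
  using C_subset by (auto simp: room_def same_def)

lemma rchain_chain: "is \<in> lists I \<Longrightarrow> rchain is \<subseteq> chain is"
proof (induction "is" rule: list.induct)
  case (Cons i "is")
  then have "i \<in> I" "rchain is \<subseteq> chain is" by auto
  then show ?case using room_same[of i] by (auto simp: relcomp_unfold)
qed auto

lemma room_image_closed: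
  assumes "i \<in> I" "closedin X S" shows "closedin X (room i `` S)"
proof -
  let ?Y = "subtopology X (U i)"
  have "compactin X (C i \<inter> S)"
    using closedin_compact_space[OF compact_X] closed_C assms by blast
  then have "compactin ?Y (C i \<inter> S)"
    using C_subset[OF assms(1)] by (auto simp: compactin_subtopology)
  then have "compactin (Z i) (q i ` (C i \<inter> S))"
    by (rule image_compactin[OF _ cont_q[OF assms(1)]])
  then have "closedin (Z i) (q i ` (C i \<inter> S))"
    by (rule compactin_imp_closedin[OF Hausdorff_Z[OF assms(1)]])
  then have "closedin ?Y {x \<in> topspace ?Y. q i x \<in> q i ` (C i \<inter> S)}"
    by (rule closedin_continuous_map_preimage[OF cont_q[OF assms(1)]])
  then obtain T where T: "closedin X T" "{x \<in> topspace ?Y. q i x \<in> q i ` (C i \<inter> S)} = T \<inter> U i"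
    unfolding closedin_subtopology by blast
  have "room i `` S = C i \<inter> {x \<in> topspace ?Y. q i x \<in> q i ` (C i \<inter> S)}"
    using C_subset[OF assms(1)] U_topspace[OF assms(1)] by (auto simp: room_def) (metis IntI imageI)
  also have "\<dots> = C i \<inter> T" using T(2) C_subset[OF assms(1)] by blast
  finally show ?thesis using T(1) closed_C[OF assms(1)] by auto
qed

lemma Domain_rchain_closed:
  "is \<in> lists I \<Longrightarrow> closedin X (Domain (rchain is))"
proof (induction "is" rule: list.induct)
  case (Cons i "is")
  have "Domain (rchain (i # is)) = room i `` Domain (rchain is)"
    using room_sym[of _ _ i] by (fastforce simp: relcomp_unfold Image_def Domain_unfold)
  moreover have "i \<in> I" "closedin X (Domain (rchain is))" using Cons by auto
  ultimately show ?case using room_image_closed by simp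
qed auto

lemma room_topspace: "i \<in> I \<Longrightarrow> (x, y) \<in> room i \<Longrightarrow> x \<in> topspace X \<and> y \<in> topspace X"
  using C_subset[of i] U_topspace[of i] by (auto simp: room_def)

lemma relpow_rstep_rchain:
  assumes "x \<in> topspace X" "(x, y) \<in> rstep ^^ n"
  obtains "is" where "is \<in> lists I" "length is = n" "(x, y) \<in> rchain is"
  using assms
proof (induction n arbitrary: x thesis)
  case 0
  then show ?case by (auto intro: 0(1)[of "[]"])
next
  case (Suc n)
  then obtain u i where u: "i \<in> I" "(x, u) \<in> room i" "(u, y) \<in> rstep ^^ n"
    by (metis (no_types, lifting) UN_E relpow_Suc_D2 rstep_def)
  have "u \<in> topspace X" using room_topspace u by blast
  then obtain "is" where "is \<in> lists I" "length is = n" "(u, y) \<in> rchain is"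
    using Suc.IH u(3) by blast
  then show ?case using u by (intro Suc.prems(1)[of "i # is"]) auto
qed

lemma step_rstep: "step \<subseteq> rstep ^^ K"
  using room_steps unfolding step_def same_def rstep_def room_def by auto

lemma relpow_step_rstep: "step ^^ n \<subseteq> rstep ^^ (K * n)"
proof (induction n)
  case (Suc n)
  have "step ^^ Suc n \<subseteq> rstep ^^ (K * n) O rstep ^^ K" using Suc step_rstep by (auto simp: relcomp_unfold)
  also have "\<dots> = rstep ^^ (K * Suc n)" by (simp add: relpow_add[symmetric] add.commute)
  finally show ?case .
qed auto

lemma rstep_step: "rstep \<subseteq> step"
  using room_same by (auto simp: rstep_def step_def)

lemma relpow_rstep_closed: "closedin X S \<Longrightarrow> closedin X ((rstep ^^ n) `` S)"
proof (induction n)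
  case (Suc n)
  have "(rstep ^^ Suc n) `` S = (\<Union>i\<in>I. room i `` ((rstep ^^ n) `` S))"
    by (auto simp: rstep_def)
  then show ?case using Suc room_image_closed finite_I by (auto intro!: closedin_Union)
qed auto

text \<open>If one further step meets no new plaque, then no later step leaves the set already
  reached, so boundedly many steps exhaust the leaf. Replacing them by steps in rooms exhibits it as
  an iterated closed saturation of the point \<open>x\<close>.\<close>

lemma nreach_eq_imp_closed:
  assumes x: "x \<in> topspace X" and "Hausdorff_space X" and eq: "nreach (Suc n) x = nreach (Suc (Suc n)) x"
  shows "closedin X (step\<^sup>* `` {x})"
proof -
  have R: "reach (Suc n) x = reach (Suc (Suc n)) x"
    by (intro card_subset_eq reach_mono x finite_reach eq[unfolded nreach_def]) simp_all
  then have st: "(x, y) \<in> step ^^ Suc n" if xy: "(x, y) \<in> step ^^ Suc (Suc n)" for y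
  proof -
    obtain u where "(x, u) \<in> step ^^ Suc n" "(u, y) \<in> step" using xy by (rule relpow_Suc_E)
    then obtain i where u: "(x, u) \<in> step ^^ Suc n" "i \<in> I" "(u, y) \<in> same i"
      unfolding step_def by blast
    then have "u \<in> U i" by (simp add: same_def)
    \<comment> \<open>The plaque of \<open>i\<close> through \<open>u\<close> and \<open>y\<close>
      was already met after \<open>n\<close> steps, at some \<open>u'\<close>, and one step leads
      from \<open>u'\<close> to \<open>y\<close>.\<close>
    then have "(i, q i u) \<in> reach (Suc n) x" unfolding R reach_iff_step[OF x] using u by blast
    then obtain u' where "u' \<in> U i" "(x, u') \<in> step ^^ n" "q i u' = q i u"
      unfolding reach_iff_step[OF x] by blast
    moreover then have "(u', y) \<in> step" using u by (auto simp: step_def same_def)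
    ultimately show ?thesis by (metis relpow_Suc_I)
  qed
  have sub: "(x, y) \<in> step ^^ Suc n" if "(x, y) \<in> step\<^sup>*" for y
    using that
  proof (induction rule: rtrancl_induct)
    case base
    then show ?case using relpow_step_mono[of x x 0 "Suc n"] x by simp
  next
    case (step y z)
    then have "(x, z) \<in> step ^^ Suc (Suc n)" by (metis relpow_Suc_I)
    then show ?case by (rule st)
  qed
  have "step\<^sup>* `` {x} = (rstep ^^ (K * Suc n)) `` {x}"
  proof (intro equalityI subsetI)
    fix y assume "y \<in> step\<^sup>* `` {x}"
    then show "y \<in> (rstep ^^ (K * Suc n)) `` {x}" using sub relpow_step_rstep[of "Suc n"] by blast
  next
    fix y assume "y \<in> (rstep ^^ (K * Suc n)) `` {x}"
    then have "(x, y) \<in> rstep\<^sup>*" using relpow_imp_rtrancl by blast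
    then show "y \<in> step\<^sup>* `` {x}" using rtrancl_mono[OF rstep_step] by blast
  qed
  then show ?thesis
    using relpow_rstep_closed[of "{x}"] closedin_Hausdorff_singleton[OF assms(2) x] by metis
qed

text \<open>On a leaf that is not closed the count never stalls, so it gains at least one in each
  step. This is the source of the lower bound 1 for the polynomial exponents.\<close>

lemma nreach_ge:
  assumes x: "x \<in> topspace X" and "Hausdorff_space X" and nc: "\<not> closedin X (step\<^sup>* `` {x})"
  shows "Suc n \<le> nreach (Suc n) x"
proof (induction n)
  case 0
  then show ?case using nreach_pos[OF x] by (simp add: Suc_le_eq)
next
  case (Suc n)
  have "nreach (Suc n) x \<le> nreach (Suc (Suc n)) x" using nreach_mono[OF x] by simp
  moreover have "nreach (Suc n) x \<noteq> nreach (Suc (Suc n)) x" using nreach_eq_imp_closed assms by blast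
  ultimately show ?case using Suc by simp
qed

lemma eventually_rchain_codes:
  "\<forall>\<^sub>F y in nhdsin X x. \<forall>is\<in>lists I. length is = m \<longrightarrow> y \<in> Domain (rchain is) \<longrightarrow> is \<in> codes m x"
proof -
  let ?L = "{is. set is \<subseteq> I \<and> length is = m} - codes m x"
  have "\<forall>\<^sub>F y in nhdsin X x. \<forall>is\<in>?L. y \<notin> Domain (rchain is)"
  proof (intro eventually_ball_finite ballI)
    show "finite ?L" using finite_lists_length_eq[OF finite_I, of m] by auto
    fix "is" assume i: "is \<in> ?L"
    then have "is \<in> lists I" "x \<notin> Domain (rchain is)" using rchain_chain[of "is"] by (auto simp: codes_def)
    then show "\<forall>\<^sub>F y in nhdsin X x. y \<notin> Domain (rchain is)"
      unfolding eventually_nhdsin using openin_diff[OF openin_topspace Domain_rchain_closed]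
      by (metis Diff_iff)
  qed
  then show ?thesis by eventually_elim auto
qed

text \<open>A chain from \<open>y\<close> is rewritten as a room chain of length
  \<open>K * n\<close>, whose code is then available at \<open>x\<close> as well. Since
  \<open>x\<close> is unbranched, codes with the same end at \<open>x\<close> have the same end at
  \<open>y\<close>, so the count at \<open>x\<close> controls the count at \<open>y\<close>.\<close>

lemma eventually_nreach_le:
  assumes x: "unbranched x" and n: "0 < n"
  shows "\<forall>\<^sub>F y in nhdsin X x. nreach n y \<le> card I * nreach (K * n) x"
proof -
  let ?m = "K * n"
  let ?S = "codes ?m x"
  have m: "0 < ?m" using K_pos n by simp
  have "\<forall>\<^sub>F y in nhdsin X x. \<forall>p\<in>?S \<times> ?S. endp (fst p) x = endp (snd p) x \<longrightarrow> endp (fst p) y = endp (snd p) y"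
  proof (rule eventually_ball_finite, intro finite_cartesian_product finite_codes, rule ballI)
    fix p assume p: "p \<in> ?S \<times> ?S"
    show "\<forall>\<^sub>F y in nhdsin X x. endp (fst p) x = endp (snd p) x \<longrightarrow> endp (fst p) y = endp (snd p) y"
    proof (cases "endp (fst p) x = endp (snd p) x")
      case True
      have "fst p \<in> ?S" "snd p \<in> ?S" using p by auto
      from codes_ne[OF m this(1)] codes_ne[OF m this(2)]
      have "\<forall>\<^sub>F y in nhdsin X x. endp (fst p) y = endp (snd p) y"
        using True by (intro unbranchedD[OF x]) auto
      then show ?thesis by eventually_elim simp
    qed auto
  qed
  then show ?thesis using eventually_nhdsin_topspace[of X x] eventually_rchain_codes[where x = x and m = ?m]
  proof eventually_elim
    case (elim y)
    let ?T = "(\<lambda>is. endp is y) ` ?S"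
    have T: "card ?T \<le> nreach ?m x" unfolding nreach_def reach_def
    proof (rule card_image_le_of_factor[OF finite_codes])
      fix a b assume "a \<in> ?S" "b \<in> ?S" "endp a x = endp b x"
      then show "endp a y = endp b y" using bspec[OF elim(1), of "(a, b)"] by auto
    qed
    \<comment> \<open>The room chain ends in a chart \<open>e\<close> that need not be
      \<open>d\<close>. The plaque of \<open>d\<close> is recovered from the plaque
      \<open>(e, t)\<close> through any common point, and coherence makes the choice immaterial; not
      knowing \<open>d\<close> costs the factor \<open>card I\<close>.\<close>
    let ?f = "\<lambda>(d, e, t). (d, q d (SOME u. u \<in> U d \<and> u \<in> U e \<and> q e u = t))"
    have "reach n y \<subseteq> ?f ` (I \<times> ?T)"
    proof clarify
      fix d z assume "(d, z) \<in> reach n y"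
      then obtain "is" y' where i: "is \<in> lists I" "length is = n" "last is = d" "(y, y') \<in> chain is" "y' \<in> U d" "q d y' = z"
        using reach_iff[OF n] by auto
      have d: "d \<in> I" using i n by auto
      have "(y, y') \<in> step ^^ n" using relpow_step_iff[OF elim(2)] i by blast
      then have "(y, y') \<in> rstep ^^ ?m" using relpow_step_rstep by blast
      then obtain fs where fs: "fs \<in> lists I" "length fs = ?m" "(y, y') \<in> rchain fs"
        using relpow_rstep_rchain[OF elim(2)] by metis
      then have fS: "fs \<in> ?S" using elim(3) by blast
      have fc: "(y, y') \<in> chain fs" "fs \<noteq> []" using rchain_chain[OF fs(1)] fs m by auto
      let ?e = "last fs"
      have e: "?e \<in> I" using fs fc by auto
      have E: "endp fs y = (?e, q ?e y')" using endp_eq fs fc by blast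
      have y': "y' \<in> U ?e" using chain_last fs fc by blast
      let ?u = "SOME u. u \<in> U d \<and> u \<in> U ?e \<and> q ?e u = q ?e y'"
      have "?u \<in> U d \<and> ?u \<in> U ?e \<and> q ?e ?u = q ?e y'"
        by (rule someI[of _ y']) (use i y' in auto)
      then have "q d ?u = q d y'" using coherent[OF e d, of ?u y'] y' i by auto
      then have "(d, z) = ?f (d, endp fs y)" using E i by simp
      then show "(d, z) \<in> ?f ` (I \<times> ?T)" using d fS by blast
    qed
    then have "nreach n y \<le> card (I \<times> ?T)"
      unfolding nreach_def by (rule surj_card_le[rotated]) (simp add: finite_I finite_codes)
    also have "\<dots> \<le> card I * nreach ?m x" using T by (simp add: card_cartesian_product)
    finally show ?case .
  qed
qed

end

section \<open>Residual sets and upper and lower limits\<close>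

lemma residually_many_iff:
  "residually_many X P \<longleftrightarrow> (\<exists>\<G>. countable \<G> \<and> (\<forall>G\<in>\<G>. openin X G \<and> dense_set X G) \<and>
     (\<forall>x \<in> topspace X \<inter> \<Inter>\<G>. P x))"
proof
  assume "\<exists>\<G>. countable \<G> \<and> (\<forall>G\<in>\<G>. openin X G \<and> dense_set X G) \<and> (\<forall>x \<in> topspace X \<inter> \<Inter>\<G>. P x)"
  then obtain \<G> where "countable \<G>" "\<forall>G\<in>\<G>. openin X G \<and> dense_set X G" "\<forall>x \<in> topspace X \<inter> \<Inter>\<G>. P x"
    by blast
  then show "residually_many X P"
    unfolding residually_many_def residual_in_def by (intro exI[of _ "topspace X \<inter> \<Inter>\<G>"]) blast
next
  assume "residually_many X P"
  then obtain S \<G> where S: "\<forall>x\<in>S. P x" "topspace X \<inter> \<Inter>\<G> \<subseteq> S"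
    and G: "countable \<G>" "\<forall>G\<in>\<G>. openin X G \<and> dense_set X G"
    unfolding residually_many_def residual_in_def by blast
  have "\<forall>x \<in> topspace X \<inter> \<Inter>\<G>. P x" using S by (meson subsetD)
  with G show "\<exists>\<G>. countable \<G> \<and> (\<forall>G\<in>\<G>. openin X G \<and> dense_set X G) \<and>
      (\<forall>x \<in> topspace X \<inter> \<Inter>\<G>. P x)" by (intro exI[of _ \<G>] conjI)
qed

lemma residually_many_mono:
  assumes "residually_many X P" "\<And>x. x \<in> topspace X \<Longrightarrow> P x \<Longrightarrow> Q x"
  shows "residually_many X Q"
proof -
  from assms(1) obtain \<G> where "countable \<G>" "\<forall>G\<in>\<G>. openin X G \<and> dense_set X G" "\<forall>x \<in> topspace X \<inter> \<Inter>\<G>. P x"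
    unfolding residually_many_iff by blast
  then show ?thesis unfolding residually_many_iff using assms(2)
    by (intro exI[of _ \<G>]) blast
qed

lemma residually_many_ball:
  assumes "countable A" "\<And>a. a \<in> A \<Longrightarrow> residually_many X (P a)"
  shows "residually_many X (\<lambda>x. \<forall>a\<in>A. P a x)"
proof -
  have "\<forall>a\<in>A. \<exists>\<G>. countable \<G> \<and> (\<forall>G\<in>\<G>. openin X G \<and> dense_set X G) \<and> (\<forall>x \<in> topspace X \<inter> \<Inter>\<G>. P a x)"
    using assms(2) unfolding residually_many_iff by blast
  then obtain \<G> where G: "\<forall>a\<in>A. countable (\<G> a) \<and> (\<forall>G\<in>\<G> a. openin X G \<and> dense_set X G) \<and>
      (\<forall>x \<in> topspace X \<inter> \<Inter>(\<G> a). P a x)"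
    by metis
  have "\<forall>x \<in> topspace X \<inter> \<Inter>(\<Union>a\<in>A. \<G> a). \<forall>a\<in>A. P a x"
  proof (intro ballI)
    fix x a assume x: "x \<in> topspace X \<inter> \<Inter>(\<Union>a\<in>A. \<G> a)" and a: "a \<in> A"
    then have "x \<in> topspace X \<inter> \<Inter>(\<G> a)" by auto
    then show "P a x" using G a by blast
  qed
  moreover have "countable (\<Union>a\<in>A. \<G> a)" using assms(1) G by (intro countable_UN) auto
  moreover have "\<forall>V\<in>\<Union>a\<in>A. \<G> a. openin X V \<and> dense_set X V" using G by blast
  ultimately show ?thesis unfolding residually_many_iff
    by (intro exI[of _ "\<Union>a\<in>A. \<G> a"] conjI)
qed

lemma residually_many_conj:
  assumes "residually_many X P" "residually_many X Q"
  shows "residually_many X (\<lambda>x. P x \<and> Q x)"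
proof -
  have "residually_many X (\<lambda>x. \<forall>b\<in>UNIV. (if b then P else Q) x)"
    by (rule residually_many_ball) (use assms in auto)
  then show ?thesis by (rule residually_many_mono) (metis UNIV_I)
qed

text \<open>For each \<open>j\<close> the points with a neighbourhood on which \<open>Q\<close>
  holds at one radius beyond \<open>j\<close> form an open set containing the dense set
  \<open>L\<close>. A point in all these sets satisfies \<open>Q\<close> at arbitrarily large
  radii.\<close>

lemma residually_many_frequently:
  fixes Q :: "'a \<Rightarrow> real \<Rightarrow> bool"
  assumes L: "L \<subseteq> topspace X" "dense_set X L"
    and Q: "\<And>x R. x \<in> L \<Longrightarrow> \<exists>r\<ge>R. \<forall>\<^sub>F y in nhdsin X x. Q y r"
  shows "residually_many X (\<lambda>y. \<exists>\<^sub>F r in at_top. Q y r)"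
proof -
  define G :: "nat \<Rightarrow> 'a set" where "G j = \<Union>{V. openin X V \<and> (\<exists>r\<ge>real j. \<forall>y\<in>V. Q y r)}" for j
  have "openin X (G j)" for j unfolding G_def by blast
  moreover have "dense_set X (G j)" for j
  proof -
    have "L \<subseteq> G j"
    proof
      fix x assume x: "x \<in> L"
      then obtain r where "r \<ge> real j" "\<forall>\<^sub>F y in nhdsin X x. Q y r" using Q by blast
      then show "x \<in> G j" unfolding eventually_nhdsin G_def using L x by blast
    qed
    then show ?thesis using L closure_of_mono[of L "G j" X] closure_of_subset_topspace[of X "G j"]
      by (auto simp: dense_set_def)
  qed
  moreover have "\<exists>\<^sub>F r in at_top. Q x r" if "x \<in> topspace X \<inter> \<Inter>(range G)" for x
    unfolding frequently_def eventually_at_top_linorder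
  proof clarify
    fix R assume R: "\<forall>r\<ge>R. \<not> Q x r"
    obtain j where j: "R \<le> real j" using real_arch_simple by blast
    have "x \<in> G j" using that by blast
    then obtain V r where "r \<ge> real j" "\<forall>y\<in>V. Q y r" "x \<in> V" unfolding G_def by blast
    then show False using R j by force
  qed
  ultimately show ?thesis unfolding residually_many_iff by (intro exI[of _ "range G"]) auto
qed

section \<open>Upper and lower limits under changes of the radius\<close>

lemma frequently_imp_le_Limsup:
  fixes f :: "'b \<Rightarrow> ereal"
  assumes "\<exists>\<^sub>F r in F. c \<le> f r" shows "c \<le> Limsup F f"
proof (rule ccontr)
  assume "\<not> c \<le> Limsup F f"
  then have "\<forall>\<^sub>F r in F. f r < c" by (intro Limsup_lessD) auto
  then show False using assms by (simp add: frequently_def not_le)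
qed

lemma frequently_imp_Liminf_le:
  fixes f :: "'b \<Rightarrow> ereal"
  assumes "\<exists>\<^sub>F r in F. f r \<le> c" shows "Liminf F f \<le> c"
proof (rule ccontr)
  assume "\<not> Liminf F f \<le> c"
  then have "\<forall>\<^sub>F r in F. c < f r" by (intro less_LiminfD) auto
  then show False using assms by (simp add: frequently_def not_le)
qed

text \<open>A number \<open>c'\<close> strictly between \<open>c\<close> and the upper limit leaves
  enough slack to absorb both the shift \<open>k\<close> of the radius and the additive constant
  \<open>b\<close>, since \<open>g r / g (r + k)\<close> tends to 1 and \<open>g\<close> to
  infinity.\<close>

lemma frequently_shift_of_Limsup:
  fixes f g :: "real \<Rightarrow> real"
  assumes g: "filterlim g at_top at_top" and gk: "((\<lambda>r. g r / g (r + k)) \<longlongrightarrow> 1) at_top"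
    and c: "ereal c < Limsup at_top (\<lambda>r. ereal (f r / g r))"
  shows "\<exists>\<^sub>F r in at_top. c * g (r + k) < f r - b"
proof -
  obtain c' where c': "ereal c < ereal c'" "ereal c' < Limsup at_top (\<lambda>r. ereal (f r / g r))"
    using ereal_dense2[OF c] by blast
  have fr: "\<exists>\<^sub>F r in at_top. c' < f r / g r"
  proof (rule ccontr)
    assume "\<not> ?thesis"
    then have "\<forall>\<^sub>F r in at_top. ereal (f r / g r) \<le> ereal c'" by (simp add: frequently_def not_less)
    then have "Limsup at_top (\<lambda>r. ereal (f r / g r)) \<le> ereal c'" by (rule Limsup_bounded)
    then show False using c' by simp
  qed
  have "filterlim (\<lambda>r. r + k) at_top at_top" by real_asymp
  from filterlim_compose[OF g this] have gs: "filterlim (\<lambda>r. g (r + k)) at_top at_top" .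
  have "\<forall>\<^sub>F r in at_top. c < (c' * g r - b) / g (r + k)"
  proof -
    have "((\<lambda>r. b / g (r + k)) \<longlongrightarrow> 0) at_top"
      by (intro real_tendsto_divide_at_top[OF _ gs]) auto
    then have "((\<lambda>r. c' * (g r / g (r + k)) - b / g (r + k)) \<longlongrightarrow> c' * 1 - 0) at_top"
      by (intro tendsto_intros gk)
    then have "((\<lambda>r. (c' * g r - b) / g (r + k)) \<longlongrightarrow> c') at_top"
      by (simp add: diff_divide_distrib)
    then show ?thesis using c' by (intro order_tendstoD) auto
  qed
  moreover have "\<forall>\<^sub>F r in at_top. g r > 0" using g by (simp add: filterlim_at_top_dense)
  moreover have "\<forall>\<^sub>F r in at_top. g (r + k) > 0" using gs by (simp add: filterlim_at_top_dense)
  ultimately have "\<forall>\<^sub>F r in at_top. c' < f r / g r \<longrightarrow> c * g (r + k) < f r - b"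
  proof eventually_elim
    case (elim r)
    show ?case
    proof
      assume "c' < f r / g r"
      with elim have "c * g (r + k) < c' * g r - b" "c' * g r < f r"
        by (simp_all add: pos_less_divide_eq)
      then show "c * g (r + k) < f r - b" by linarith
    qed
  qed
  then show ?thesis using fr by (rule frequently_mp)
qed

text \<open>The same slack absorbs \<open>m\<close> and \<open>b\<close>, but the dilation by
  \<open>K\<close> survives as the limit \<open>p\<close> of
  \<open>g (K * r + m) / g r\<close>.\<close>

lemma frequently_scale_of_Liminf:
  fixes f g :: "real \<Rightarrow> real"
  assumes g: "filterlim g at_top at_top" and gk: "((\<lambda>r. g (K * r + m) / g r) \<longlongrightarrow> p) at_top"
    and K: "K > 0" and p: "p > 0"
    and c: "Liminf at_top (\<lambda>r. ereal (f r / g r)) < ereal c"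
  shows "\<exists>\<^sub>F r in at_top. f (K * r + m) + b < p * c * g r"
proof -
  obtain c' where c': "Liminf at_top (\<lambda>r. ereal (f r / g r)) < ereal c'" "ereal c' < ereal c"
    using ereal_dense2[OF c] by blast
  have fr: "\<exists>\<^sub>F s in at_top. f s / g s < c'"
  proof (rule ccontr)
    assume "\<not> ?thesis"
    then have "\<forall>\<^sub>F r in at_top. ereal c' \<le> ereal (f r / g r)" by (simp add: frequently_def not_less)
    then have "ereal c' \<le> Liminf at_top (\<lambda>r. ereal (f r / g r))" by (rule Liminf_bounded)
    then show False using c' by simp
  qed
  have fr': "\<exists>\<^sub>F r in at_top. f (K * r + m) / g (K * r + m) < c'"
    unfolding frequently_def
  proof
    assume "\<forall>\<^sub>F r in at_top. \<not> f (K * r + m) / g (K * r + m) < c'"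
    \<comment> \<open>Good radii \<open>s\<close> of the given lower limit are hit exactly by
      \<open>s = K * r + m\<close>; the inverse substitution also tends to infinity.\<close>
    moreover have "filterlim (\<lambda>s. (s - m) / K) at_top at_top" using K by real_asymp
    ultimately have "\<forall>\<^sub>F s in at_top. \<not> f (K * ((s - m) / K) + m) / g (K * ((s - m) / K) + m) < c'"
      by (rule eventually_compose_filterlim)
    then show False using fr K by (simp add: frequently_def)
  qed
  have "\<forall>\<^sub>F r in at_top. (c' * g (K * r + m) + b) / g r < c * p"
  proof -
    have "((\<lambda>r. b / g r) \<longlongrightarrow> 0) at_top"
      by (intro real_tendsto_divide_at_top[OF _ g]) auto
    then have "((\<lambda>r. c' * (g (K * r + m) / g r) + b / g r) \<longlongrightarrow> c' * p + 0) at_top"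
      by (intro tendsto_intros gk)
    then have "((\<lambda>r. (c' * g (K * r + m) + b) / g r) \<longlongrightarrow> c' * p) at_top"
      by (simp add: add_divide_distrib)
    then show ?thesis using c' p by (intro order_tendstoD) auto
  qed
  moreover have "\<forall>\<^sub>F r in at_top. g r > 0" using g by (simp add: filterlim_at_top_dense)
  moreover have "\<forall>\<^sub>F r in at_top. g (K * r + m) > 0"
  proof -
    have "filterlim (\<lambda>r. K * r + m) at_top at_top" using K by real_asymp
    from filterlim_compose[OF g this] show ?thesis by (simp add: filterlim_at_top_dense)
  qed
  ultimately have "\<forall>\<^sub>F r in at_top. f (K * r + m) / g (K * r + m) < c' \<longrightarrow> f (K * r + m) + b < p * c * g r"
  proof eventually_elim
    case (elim r)
    show ?case
    proof
      assume "f (K * r + m) / g (K * r + m) < c'"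
      with elim have "f (K * r + m) < c' * g (K * r + m)" "c' * g (K * r + m) + b < c * p * g r"
        by (simp_all add: pos_divide_less_eq)
      then show "f (K * r + m) + b < p * c * g r" by (simp add: mult.commute)
    qed
  qed
  then show ?thesis using fr' by (rule frequently_mp)
qed

section \<open>Growth along dense leaves\<close>

text \<open>The classes of \<open>step\<^sup>*\<close> stand for the leaves, and
  \<open>dense_not_closed\<close> amounts to none of them being all of \<open>X\<close>. The growth
  \<open>v\<close> is known only up to the factor \<open>card I\<close>, to which the exponents are
  insensitive.\<close>

locale growth_atlas = roomy_atlas +
  fixes v :: "'a \<Rightarrow> real \<Rightarrow> nat"
  assumes Hausdorff_X: "Hausdorff_space X" and second_countable_X: "second_countable X"
    and v_le_nreach: "x \<in> topspace X \<Longrightarrow> 1 < r \<Longrightarrow> v x r \<le> nreach (nat \<lceil>r\<rceil>) x"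
    and nreach_le_v: "x \<in> topspace X \<Longrightarrow> 1 < r \<Longrightarrow> nreach (nat \<lceil>r\<rceil>) x \<le> card I * v x r"
    and dense_not_closed: "x \<in> topspace X \<Longrightarrow> dense_set X (step\<^sup>* `` {x}) \<Longrightarrow> \<not> closedin X (step\<^sup>* `` {x})"
    and transitive: "\<exists>x\<in>topspace X. dense_set X (step\<^sup>* `` {x})"
begin

definition dense_leaf :: "'a set" where
  "dense_leaf = {x \<in> topspace X. dense_set X (step\<^sup>* `` {x})}"

definition generic :: "'a set" where
  "generic = {x \<in> dense_leaf. unbranched x}"

abbreviation N :: nat where "N \<equiv> card I"

section \<open>Growth at nearby points and on nearby leaves\<close>

lemma leaf_topspace: "x \<in> topspace X \<Longrightarrow> (x, y) \<in> step\<^sup>* \<Longrightarrow> y \<in> topspace X"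
  by (meson relpow_step_topspace rtrancl_imp_relpow)

lemma N_pos: "0 < N"
  using transitive cover finite_I by (auto simp: card_gt_0_iff)

lemma v_pos: "x \<in> topspace X \<Longrightarrow> 1 < r \<Longrightarrow> 0 < v x r"
  using nreach_pos[of x "nat \<lceil>r\<rceil>"] nreach_le_v[of x r] by (cases "v x r") auto

lemma eventually_v_ge:
  assumes x: "x \<in> topspace X" and k: "(x', x) \<in> step ^^ k" and x': "x' \<in> topspace X" and r: "1 < r"
  shows "\<forall>\<^sub>F y in nhdsin X x'. v x r \<le> N * v y (r + real k)"
proof -
  have n: "0 < nat \<lceil>r\<rceil>" using r by auto
  have ceil: "nat \<lceil>r + real k\<rceil> = nat \<lceil>r\<rceil> + k" using r by linarith
  have "v x r \<le> nreach (nat \<lceil>r\<rceil>) x" using v_le_nreach x r by blast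
  also have "\<dots> \<le> nreach (nat \<lceil>r\<rceil> + k) x'" using nreach_leaf[OF x' k n] .
  finally have le: "v x r \<le> nreach (nat \<lceil>r\<rceil> + k) x'" .
  have "0 < nat \<lceil>r\<rceil> + k" using n by simp
  from eventually_nreach_ge[OF this, of x'] eventually_nhdsin_topspace[of X x'] show ?thesis
  proof eventually_elim
    case (elim y)
    have "nreach (nat \<lceil>r\<rceil> + k) y \<le> N * v y (r + real k)"
      using nreach_le_v[of y "r + real k"] elim(2) r ceil by simp
    then show ?case using elim(1) le by linarith
  qed
qed

text \<open>One factor \<open>N\<close> comes from \<open>eventually_nreach_le\<close>, the other
  from comparing \<open>nreach\<close> with \<open>v\<close>. In the radius, \<open>k\<close> is the
  displacement along the leaf and the additional \<open>K\<close> pays for rounding \<open>r\<close>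
  up to an integer.\<close>

lemma eventually_v_le:
  assumes x: "x \<in> topspace X" and k: "(x, x') \<in> step ^^ k" and x': "unbranched x'" and r: "1 < r"
  shows "\<forall>\<^sub>F y in nhdsin X x'. v y r \<le> N * N * v x (real K * r + real (K + k))"
proof -
  let ?n = "nat \<lceil>r\<rceil>" and ?s = "real K * r + real (K + k)"
  have n: "0 < ?n" using r by auto
  have "real (K * ?n + k) \<le> ?s"
  proof -
    have "real ?n \<le> r + 1" using r by linarith
    then have "real K * real ?n \<le> real K * (r + 1)" by (intro mult_left_mono) auto
    then show ?thesis by (simp add: algebra_simps)
  qed
  then have ceil: "K * ?n + k \<le> nat \<lceil>?s\<rceil>" by linarith
  have s: "1 < ?s" using r K_pos
    by (smt (verit) mult_le_cancel_right1 of_nat_0_le_iff of_nat_add of_nat_1 of_nat_le_iff One_nat_def Suc_leI)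
  have "nreach (K * ?n) x' \<le> nreach (K * ?n + k) x" using nreach_leaf[OF x k] K_pos n by simp
  also have "\<dots> \<le> nreach (nat \<lceil>?s\<rceil>) x" using nreach_mono[OF x _ ceil] K_pos n by simp
  also have "\<dots> \<le> N * v x ?s" using nreach_le_v[OF x s] .
  finally have le: "N * nreach (K * ?n) x' \<le> N * (N * v x ?s)" by simp
  show ?thesis using eventually_nreach_le[OF x' n] eventually_nhdsin_topspace[of X x']
  proof eventually_elim
    case (elim y)
    then have "v y r \<le> N * nreach (K * ?n) x'" using v_le_nreach[of y r] r by linarith
    also note le
    finally show ?case by (simp only: mult.assoc)
  qed
qed

text \<open>The points whose leaf meets a nonempty open \<open>V\<close> form an open set that
  contains the given dense leaf entirely. Letting \<open>V\<close> run through a countable base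
  leaves only points on dense leaves.\<close>

lemma residual_dense_leaf: "residually_many X (\<lambda>x. x \<in> dense_leaf)"
proof -
  obtain B where B: "countable B" "\<And>V. V \<in> B \<Longrightarrow> openin X V"
    "\<And>U x. openin X U \<Longrightarrow> x \<in> U \<Longrightarrow> \<exists>V\<in>B. x \<in> V \<and> V \<subseteq> U"
    using second_countable_X unfolding second_countable_def by metis
  define G where "G V = {x \<in> topspace X. \<exists>y\<in>V. (x, y) \<in> step\<^sup>*}" for V
  obtain x0 where x0: "x0 \<in> topspace X" "dense_set X (step\<^sup>* `` {x0})" using transitive by blast
  have "residually_many X (\<lambda>x. \<forall>V\<in>B - {{}}. x \<in> G V)"
  proof (rule residually_many_ball)
    show "countable (B - {{}})" using B(1) by blast
    fix V assume V: "V \<in> B - {{}}"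
    have o: "openin X V" using V B by blast
    have "G V = (\<Union>is\<in>lists I. {x. \<exists>y\<in>V. (x, y) \<in> chain is})"
    proof (intro equalityI subsetI)
      fix x assume "x \<in> G V"
      then obtain y n where "x \<in> topspace X" "y \<in> V" "(x, y) \<in> step ^^ n"
        unfolding G_def by (auto dest: rtrancl_imp_relpow)
      then show "x \<in> (\<Union>is\<in>lists I. {x. \<exists>y\<in>V. (x, y) \<in> chain is})"
        using relpow_step_iff[of x y n] by blast
    next
      fix x assume "x \<in> (\<Union>is\<in>lists I. {x. \<exists>y\<in>V. (x, y) \<in> chain is})"
      then obtain "is" y where i: "is \<in> lists I" "y \<in> V" "(x, y) \<in> chain is" by blast
      then have x: "x \<in> topspace X" using chain_topspace by blast
      then have "(x, y) \<in> step ^^ length is" using i relpow_step_iff[OF x] by blast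
      then show "x \<in> G V" using x i relpow_imp_rtrancl unfolding G_def by blast
    qed
    then have oG: "openin X (G V)" using chain_preimage_open[OF _ o] by (simp only:) (rule openin_Union, blast)
    obtain y where y: "y \<in> V" "(x0, y) \<in> step\<^sup>*"
      using x0(2) V o unfolding dense_set_def dense_intersects_open by blast
    have "step\<^sup>* `` {x0} \<subseteq> G V"
    proof
      fix x assume "x \<in> step\<^sup>* `` {x0}"
      then have x: "(x0, x) \<in> step\<^sup>*" by simp
      then have "(x, x0) \<in> step\<^sup>*" using step_sym by (meson sym_rtrancl symD)
      then have "(x, y) \<in> step\<^sup>*" using y by auto
      then show "x \<in> G V" unfolding G_def using y x leaf_topspace[OF x0(1) x] by blast
    qed
    then have dG: "dense_set X (G V)"
      using x0(2) closure_of_mono[of _ "G V" X] closure_of_subset_topspace[of X "G V"]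
      unfolding dense_set_def by blast
    show "residually_many X (\<lambda>x. x \<in> G V)"
      unfolding residually_many_iff using oG dG by (intro exI[of _ "{G V}"]) auto
  qed
  then show ?thesis
  proof (rule residually_many_mono)
    fix x assume x: "x \<in> topspace X" "\<forall>V\<in>B - {{}}. x \<in> G V"
    have "step\<^sup>* `` {x} \<inter> U \<noteq> {}" if U: "openin X U" "U \<noteq> {}" for U
    proof -
      obtain u where "u \<in> U" using U by blast
      then obtain V where V: "V \<in> B" "u \<in> V" "V \<subseteq> U" using B(3) U by blast
      then have "x \<in> G V" using x by blast
      then show ?thesis using V unfolding G_def by blast
    qed
    then show "x \<in> dense_leaf" unfolding dense_leaf_def dense_set_def dense_intersects_open using x by blast
  qed
qed

lemma residual_generic: "residually_many X (\<lambda>x. x \<in> generic)"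
proof -
  have "residually_many X unbranched"
    using residual_unbranched unfolding residually_many_def by blast
  from residually_many_conj[OF residual_dense_leaf this] show ?thesis
    by (rule residually_many_mono) (simp add: generic_def)
qed

section \<open>Residual bounds for the exponents\<close>

lemma dense_leaf_image: "x \<in> dense_leaf \<Longrightarrow> step\<^sup>* `` {x} \<subseteq> topspace X \<and> dense_set X (step\<^sup>* `` {x})"
  using leaf_topspace by (auto simp: dense_leaf_def)

text \<open>The dense set is the leaf of \<open>x\<close> itself. The displacement \<open>k\<close>
  depends on the point \<open>x'\<close> of the leaf, but it is absorbed for each \<open>x'\<close>
  separately, so no uniformity along the leaf is required.\<close>

lemma residually_Limsup_ge:
  assumes x: "x \<in> dense_leaf" and g: "filterlim g at_top at_top" and gk: "\<And>k. ((\<lambda>r. g r / g (r + k)) \<longlongrightarrow> 1) at_top"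
    and c: "ereal c < Limsup at_top (\<lambda>r. ereal (ln (real (v x r)) / g r))"
  shows "residually_many X (\<lambda>y. ereal c \<le> Limsup at_top (\<lambda>r. ereal (ln (real (v y r)) / g r)))"
proof -
  have xt: "x \<in> topspace X" using x by (simp add: dense_leaf_def)
  have "residually_many X (\<lambda>y. \<exists>\<^sub>F r in at_top. g r > 0 \<and> 1 < r \<and> y \<in> topspace X \<and> c * g r \<le> ln (real (v y r)))"
  proof (rule residually_many_frequently)
    fix x' R assume x': "x' \<in> step\<^sup>* `` {x}"
    then obtain k where "(x, x') \<in> step ^^ k" using rtrancl_imp_relpow by blast
    then have k: "(x', x) \<in> step ^^ k" by (rule relpow_step_sym)
    have x't: "x' \<in> topspace X" using dense_leaf_image[OF x] x' by blast
    have fr: "\<exists>\<^sub>F r in at_top. c * g (r + real k) < ln (real (v x r)) - ln (real N)"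
      by (rule frequently_shift_of_Limsup[OF g gk c])
    have ev: "\<forall>\<^sub>F r in at_top. r \<ge> R \<and> r > 1 \<and> g (r + real k) > 0"
    proof -
      have "filterlim (\<lambda>r. r + real k) at_top at_top" by real_asymp
      from filterlim_compose[OF g this] have "\<forall>\<^sub>F r in at_top. g (r + real k) > 0"
        by (simp add: filterlim_at_top_dense)
      then show ?thesis by (intro eventually_conj eventually_ge_at_top eventually_gt_at_top)
    qed
    from frequently_ex[OF frequently_eventually_frequently[OF fr ev]]
    obtain r where r: "c * g (r + real k) < ln (real (v x r)) - ln (real N)" "r \<ge> R" "r > 1" "g (r + real k) > 0"
      by blast
    have "\<forall>\<^sub>F y in nhdsin X x'. 0 < g (r + real k) \<and> 1 < r + real k \<and> y \<in> topspace X \<and>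
        c * g (r + real k) \<le> ln (real (v y (r + real k)))"
      using eventually_v_ge[OF xt k x't r(3)] eventually_nhdsin_topspace[of X x']
    proof eventually_elim
      case (elim y)
      have "0 < v y (r + real k)" using v_pos[of y "r + real k"] elim r by simp
      have "real (v x r) \<le> real N * real (v y (r + real k))" using elim(1) by (metis of_nat_le_iff of_nat_mult)
      then have "ln (real (v x r)) \<le> ln (real N * real (v y (r + real k)))"
        using v_pos[OF xt r(3)] by simp
      also have "\<dots> = ln (real N) + ln (real (v y (r + real k)))"
        using N_pos \<open>0 < v y (r + real k)\<close> by (simp add: ln_mult)
      finally show ?case using r elim by simp
    qed
    then show "\<exists>r\<ge>R. \<forall>\<^sub>F y in nhdsin X x'. g r > 0 \<and> 1 < r \<and> y \<in> topspace X \<and> c * g r \<le> ln (real (v y r))"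
      using r by (intro exI[of _ "r + real k"]) auto
  qed (use dense_leaf_image[OF x] in auto)
  then show ?thesis
  proof (rule residually_many_mono)
    fix y assume "\<exists>\<^sub>F r in at_top. g r > 0 \<and> 1 < r \<and> y \<in> topspace X \<and> c * g r \<le> ln (real (v y r))"
    then have "\<exists>\<^sub>F r in at_top. ereal c \<le> ereal (ln (real (v y r)) / g r)"
      by (rule frequently_elim1) (simp add: pos_le_divide_eq)
    then show "ereal c \<le> Limsup at_top (\<lambda>r. ereal (ln (real (v y r)) / g r))"
      by (rule frequently_imp_le_Limsup)
  qed
qed

text \<open>The upper bound near \<open>x'\<close> requires \<open>x'\<close> to be unbranched; for
  \<open>x\<close> in \<open>generic\<close> this holds along the whole leaf.\<close>

lemma residually_Liminf_le:
  assumes x: "x \<in> generic" and g: "filterlim g at_top at_top"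
    and gk: "\<And>k. ((\<lambda>r. g (real K * r + k) / g r) \<longlongrightarrow> p) at_top" and p: "p > 0"
    and c: "Liminf at_top (\<lambda>r. ereal (ln (real (v x r)) / g r)) < ereal c"
  shows "residually_many X (\<lambda>y. Liminf at_top (\<lambda>r. ereal (ln (real (v y r)) / g r)) \<le> ereal (p * c))"
proof -
  have xD: "x \<in> dense_leaf" and xu: "unbranched x" using x by (auto simp: generic_def)
  have xt: "x \<in> topspace X" using xD by (simp add: dense_leaf_def)
  have "residually_many X (\<lambda>y. \<exists>\<^sub>F r in at_top. g r > 0 \<and> ln (real (v y r)) \<le> p * c * g r)"
  proof (rule residually_many_frequently)
    fix x' R assume x': "x' \<in> step\<^sup>* `` {x}"
    then obtain k where k: "(x, x') \<in> step ^^ k" using rtrancl_imp_relpow by blast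
    have x'u: "unbranched x'" using unbranched_step_rtrancl xu x' by blast
    let ?s = "\<lambda>r. real K * r + real (K + k)"
    have fr: "\<exists>\<^sub>F r in at_top. ln (real (v x (?s r))) + ln (real (N * N)) < p * c * g r"
      by (rule frequently_scale_of_Liminf[OF g gk _ p c]) (use K_pos in simp)
    have "\<forall>\<^sub>F r in at_top. g r > 0" using g by (simp add: filterlim_at_top_dense)
    then have ev: "\<forall>\<^sub>F r in at_top. r \<ge> R \<and> r > 1 \<and> g r > 0"
      by (intro eventually_conj eventually_ge_at_top eventually_gt_at_top)
    from frequently_ex[OF frequently_eventually_frequently[OF fr ev]]
    obtain r where r: "ln (real (v x (?s r))) + ln (real (N * N)) < p * c * g r" "r \<ge> R" "r > 1" "g r > 0"
      by blast
    have "real K * r \<ge> r" using r K_pos by simp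
    then have "1 < ?s r" using r by linarith
    then have vs: "0 < v x (?s r)" using v_pos xt by blast
    have "\<forall>\<^sub>F y in nhdsin X x'. g r > 0 \<and> ln (real (v y r)) \<le> p * c * g r"
      using eventually_v_le[OF xt k x'u r(3)] eventually_nhdsin_topspace[of X x']
    proof eventually_elim
      case (elim y)
      have "real (v y r) \<le> real (N * N) * real (v x (?s r))" using elim(1) by (metis of_nat_le_iff of_nat_mult)
      then have "ln (real (v y r)) \<le> ln (real (N * N) * real (v x (?s r)))"
        using v_pos[of y r] elim r by simp
      also have "\<dots> = ln (real (N * N)) + ln (real (v x (?s r)))"
        using N_pos vs by (subst ln_mult) auto
      finally show ?case using r by simp
    qed
    then show "\<exists>r\<ge>R. \<forall>\<^sub>F y in nhdsin X x'. g r > 0 \<and> ln (real (v y r)) \<le> p * c * g r"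
      using r by blast
  qed (use dense_leaf_image[OF xD] in auto)
  then show ?thesis
  proof (rule residually_many_mono)
    fix y assume "\<exists>\<^sub>F r in at_top. g r > 0 \<and> ln (real (v y r)) \<le> p * c * g r"
    then have "\<exists>\<^sub>F r in at_top. ereal (ln (real (v y r)) / g r) \<le> ereal (p * c)"
      by (rule frequently_elim1) (simp add: pos_divide_le_eq)
    then show "Liminf at_top (\<lambda>r. ereal (ln (real (v y r)) / g r)) \<le> ereal (p * c)"
      by (rule frequently_imp_Liminf_le)
  qed
qed

text \<open>Rational thresholds below the supremum suffice, which keeps the number of residual
  conditions countable.\<close>

lemma residually_Limsup_ge_SUP:
  assumes g: "filterlim g at_top at_top" and gk: "\<And>k. ((\<lambda>r. g r / g (r + k)) \<longlongrightarrow> 1) at_top"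
  shows "residually_many X (\<lambda>y. (SUP x\<in>dense_leaf. Limsup at_top (\<lambda>r. ereal (ln (real (v x r)) / g r)))
    \<le> Limsup at_top (\<lambda>r. ereal (ln (real (v y r)) / g r)))" (is "residually_many X (\<lambda>y. ?S \<le> ?L y)")
proof -
  have "residually_many X (\<lambda>y. \<forall>c\<in>{c::rat. ereal (of_rat c) < ?S}. ereal (of_rat c) \<le> ?L y)"
  proof (rule residually_many_ball)
    fix c :: rat assume "c \<in> {c. ereal (of_rat c) < ?S}"
    then obtain x where "x \<in> dense_leaf" "ereal (of_rat c) < ?L x" by (auto simp: less_SUP_iff)
    then show "residually_many X (\<lambda>y. ereal (of_rat c) \<le> ?L y)"
      by (rule residually_Limsup_ge[OF _ g gk])
  qed auto
  then show ?thesis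
  proof (rule residually_many_mono)
    fix y assume y: "\<forall>c\<in>{c::rat. ereal (of_rat c) < ?S}. ereal (of_rat c) \<le> ?L y"
    show "?S \<le> ?L y"
    proof (rule ccontr)
      assume "\<not> ?S \<le> ?L y"
      then have "?L y < ?S" by simp
      then obtain c where "?L y < ereal (real_of_rat c)" "ereal (real_of_rat c) < ?S"
        using ereal_dense3 by blast
      then show False using y by force
    qed
  qed
qed

text \<open>Phrased through real numbers \<open>c\<close> above the infimum, because the infimum may
  be infinite; in that case there is nothing to show.\<close>

lemma residually_Liminf_le_INF:
  assumes g: "filterlim g at_top at_top"
    and gk: "\<And>k. ((\<lambda>r. g (real K * r + k) / g r) \<longlongrightarrow> p) at_top" and p: "p > 0"
  shows "residually_many X (\<lambda>y. \<forall>c. (INF x\<in>generic. Liminf at_top (\<lambda>r. ereal (ln (real (v x r)) / g r))) < ereal c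
    \<longrightarrow> Liminf at_top (\<lambda>r. ereal (ln (real (v y r)) / g r)) \<le> ereal (p * c))"
    (is "residually_many X (\<lambda>y. \<forall>c. ?S < ereal c \<longrightarrow> ?L y \<le> ereal (p * c))")
proof -
  have "residually_many X (\<lambda>y. \<forall>c\<in>{c::rat. ?S < ereal (of_rat c)}. ?L y \<le> ereal (p * of_rat c))"
  proof (rule residually_many_ball)
    fix c :: rat assume "c \<in> {c. ?S < ereal (of_rat c)}"
    then obtain x where "x \<in> generic" "?L x < ereal (of_rat c)" by (auto simp: INF_less_iff)
    then show "residually_many X (\<lambda>y. ?L y \<le> ereal (p * of_rat c))"
      by (rule residually_Liminf_le[OF _ g gk p])
  qed auto
  then show ?thesis
  proof (rule residually_many_mono, intro allI impI)
    fix y c assume y: "\<forall>c\<in>{c::rat. ?S < ereal (of_rat c)}. ?L y \<le> ereal (p * of_rat c)"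
      and c: "?S < ereal c"
    then obtain c' where c': "?S < ereal (real_of_rat c')" "ereal (real_of_rat c') < ereal c"
      using ereal_dense3 by blast
    then have "?L y \<le> ereal (p * of_rat c')" using y by blast
    also have "\<dots> \<le> ereal (p * c)" using c' p by simp
    finally show "?L y \<le> ereal (p * c)" .
  qed
qed

end

section \<open>A priori bounds and the choice of the exponents\<close>

context growth_atlas begin

lemma v_ge_linear:
  assumes "x \<in> dense_leaf" "1 < r" shows "r \<le> real N * real (v x r)"
proof -
  have x: "x \<in> topspace X" "\<not> closedin X (step\<^sup>* `` {x})"
    using assms dense_not_closed by (auto simp: dense_leaf_def)
  have "Suc (nat \<lceil>r\<rceil> - 1) \<le> nreach (Suc (nat \<lceil>r\<rceil> - 1)) x" by (rule nreach_ge[OF x(1) Hausdorff_X x(2)])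
  moreover have "Suc (nat \<lceil>r\<rceil> - 1) = nat \<lceil>r\<rceil>" using assms(2) by linarith
  ultimately have "nat \<lceil>r\<rceil> \<le> nreach (nat \<lceil>r\<rceil>) x" by simp
  also have "\<dots> \<le> N * v x r" using nreach_le_v x assms by blast
  finally have "real (nat \<lceil>r\<rceil>) \<le> real N * real (v x r)" by (metis of_nat_le_iff of_nat_mult)
  then show ?thesis using assms(2) by linarith
qed

lemma v_le_power:
  assumes "x \<in> topspace X" "1 < r" shows "ln (real (v x r)) \<le> (r + 1) * ln (real N)"
proof -
  have "v x r \<le> N ^ nat \<lceil>r\<rceil>" using v_le_nreach[OF assms] nreach_le_power le_trans by blast
  then have "real (v x r) \<le> real N ^ nat \<lceil>r\<rceil>" by (metis of_nat_le_iff of_nat_power)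
  then have "ln (real (v x r)) \<le> ln (real N ^ nat \<lceil>r\<rceil>)"
    using v_pos[OF assms] N_pos by simp
  also have "\<dots> = real (nat \<lceil>r\<rceil>) * ln (real N)" using N_pos by (simp add: ln_realpow)
  also have "\<dots> \<le> (r + 1) * ln (real N)"
    using N_pos assms(2) by (intro mult_right_mono) (linarith, simp)
  finally show ?thesis .
qed

lemma Liminf_polynomial_ge_1:
  assumes "x \<in> dense_leaf" shows "1 \<le> Liminf at_top (\<lambda>r. ereal (ln (real (v x r)) / ln r))"
proof -
  have x: "x \<in> topspace X" using assms by (simp add: dense_leaf_def)
  have "((\<lambda>r. (ln r - ln (real N)) / ln r) \<longlongrightarrow> 1) at_top" by real_asymp
  then have "((\<lambda>r. ereal ((ln r - ln (real N)) / ln r)) \<longlongrightarrow> ereal 1) at_top"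
    by (simp only: lim_ereal)
  then have "ereal 1 = Liminf at_top (\<lambda>r. ereal ((ln r - ln (real N)) / ln r))"
    by (intro lim_imp_Liminf[symmetric]) auto
  also have "\<dots> \<le> Liminf at_top (\<lambda>r. ereal (ln (real (v x r)) / ln r))"
  proof (rule Liminf_mono)
    show "\<forall>\<^sub>F r in at_top. ereal ((ln r - ln (real N)) / ln r) \<le> ereal (ln (real (v x r)) / ln r)"
      using eventually_gt_at_top[of 1]
    proof eventually_elim
      case (elim r)
      have "ln r \<le> ln (real N * real (v x r))" using v_ge_linear[OF assms elim] elim by simp
      also have "\<dots> = ln (real N) + ln (real (v x r))" using N_pos v_pos[OF x elim] by (simp add: ln_mult)
      finally show ?case using elim by (simp add: divide_right_mono)
    qed
  qed
  finally show ?thesis by (simp add: one_ereal_def)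
qed

lemma Limsup_exponential_le:
  assumes "x \<in> topspace X" shows "Limsup at_top (\<lambda>r. ereal (ln (real (v x r)) / r)) \<le> ereal (ln (real N))"
proof -
  have "((\<lambda>r. (r + 1) * ln (real N) / r) \<longlongrightarrow> ln (real N)) at_top" by real_asymp
  then have "((\<lambda>r. ereal ((r + 1) * ln (real N) / r)) \<longlongrightarrow> ereal (ln (real N))) at_top"
    by (simp only: lim_ereal)
  then have "ereal (ln (real N)) = Limsup at_top (\<lambda>r. ereal ((r + 1) * ln (real N) / r))"
    by (intro lim_imp_Limsup[symmetric]) auto
  moreover have "Limsup at_top (\<lambda>r. ereal (ln (real (v x r)) / r)) \<le> \<dots>"
  proof (rule Limsup_mono)
    show "\<forall>\<^sub>F r in at_top. ereal (ln (real (v x r)) / r) \<le> ereal ((r + 1) * ln (real N) / r)"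
      using eventually_gt_at_top[of 1]
      by eventually_elim (use v_le_power[OF assms] in \<open>simp add: divide_right_mono\<close>)
  qed
  ultimately show ?thesis by simp
qed

lemma Liminf_exponential_ge_0:
  assumes "x \<in> topspace X" shows "0 \<le> Liminf at_top (\<lambda>r. ereal (ln (real (v x r)) / r))"
proof (rule Liminf_bounded)
  show "\<forall>\<^sub>F r in at_top. 0 \<le> ereal (ln (real (v x r)) / r)"
    using eventually_gt_at_top[of 1]
  proof eventually_elim
    case (elim r)
    then show ?case using v_pos[OF assms elim] by simp
  qed
qed

text \<open>A residual point is itself generic, so being a member of the families behind the suprema
  and infima gives one inequality for each exponent, and the residual bounds give the other.\<close>

theorem growth_exponents:
  "\<exists>(a1::ereal) (a3::ereal) (a2::real) (a4::real) (p::real).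
    1 \<le> a1 \<and> 1 \<le> a3 \<and> 0 \<le> a2 \<and> 0 \<le> a4 \<and> 1 \<le> p \<and>
    residually_many X (\<lambda>x.
      Limsup at_top (\<lambda>r::real. ereal (ln (real (v x r)) / ln r)) = a1 \<and>
      ereal a2 \<le> Liminf at_top (\<lambda>r::real. ereal (ln (real (v x r)) / r)) \<and>
      Liminf at_top (\<lambda>r::real. ereal (ln (real (v x r)) / r)) \<le> ereal (p * a2) \<and>
      Liminf at_top (\<lambda>r::real. ereal (ln (real (v x r)) / ln r)) = a3 \<and>
      Limsup at_top (\<lambda>r::real. ereal (ln (real (v x r)) / r)) = ereal a4) \<and>
    (\<forall>x \<in> generic.
      Liminf at_top (\<lambda>r::real. ereal (ln (real (v x r)) / ln r)) \<ge> a3 \<and>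
      Limsup at_top (\<lambda>r::real. ereal (ln (real (v x r)) / r)) \<le> ereal a4)"
proof (cases "generic = {}")
  case True
  txt \<open>Impossible by Baire's theorem, but then every statement holds residually anyway.\<close>
  have "residually_many X P" for P
    by (rule residually_many_mono[OF residual_generic]) (simp add: True)
  then show ?thesis using True
    by (intro exI[of _ "1 :: ereal"] exI[of _ "0 :: real"] exI[of _ "1 :: real"] conjI) simp_all
next
  case False
  define sp where "sp x = Limsup at_top (\<lambda>r::real. ereal (ln (real (v x r)) / ln r))" for x
  define ip where "ip x = Liminf at_top (\<lambda>r::real. ereal (ln (real (v x r)) / ln r))" for x
  define se where "se x = Limsup at_top (\<lambda>r::real. ereal (ln (real (v x r)) / r))" for x
  define ie where "ie x = Liminf at_top (\<lambda>r::real. ereal (ln (real (v x r)) / r))" for x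
  obtain x0 where x0: "x0 \<in> generic" using False by blast
  have Dt: "x \<in> topspace X" if "x \<in> dense_leaf" for x using that by (simp add: dense_leaf_def)
  have D0D: "generic \<subseteq> dense_leaf" by (auto simp: generic_def)
  have ie_se: "ie x \<le> se x" for x unfolding ie_def se_def by (rule Liminf_le_Limsup) simp
  have ip_sp: "ip x \<le> sp x" for x unfolding ip_def sp_def by (rule Liminf_le_Limsup) simp
  have ie0: "0 \<le> ie x" if "x \<in> dense_leaf" for x
    using Liminf_exponential_ge_0 Dt that unfolding ie_def by blast
  have seN: "se x \<le> ereal (ln (real N))" if "x \<in> dense_leaf" for x
    using Limsup_exponential_le Dt that unfolding se_def by blast
  have ip1: "1 \<le> ip x" if "x \<in> dense_leaf" for x
    using Liminf_polynomial_ge_1 that unfolding ip_def by blast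
  let ?a1 = "SUP x\<in>dense_leaf. sp x" and ?a3 = "INF x\<in>generic. ip x"
  have "0 \<le> (INF x\<in>generic. ie x)" using ie0 D0D by (intro INF_greatest) blast
  moreover have "(INF x\<in>generic. ie x) \<le> ereal (ln (real N))"
    using x0 D0D ie_se[of x0] seN[of x0] by (intro INF_lower2[OF x0]) (auto intro: order_trans)
  ultimately obtain a2 where a2: "(INF x\<in>generic. ie x) = ereal a2" "0 \<le> a2"
    by (cases "INF x\<in>generic. ie x") auto
  have "0 \<le> (SUP x\<in>dense_leaf. se x)"
    using x0 D0D ie0[of x0] ie_se[of x0] by (intro SUP_upper2[of x0]) (auto intro: order_trans)
  moreover have "(SUP x\<in>dense_leaf. se x) \<le> ereal (ln (real N))" using seN by (intro SUP_least)
  ultimately obtain a4 where a4: "(SUP x\<in>dense_leaf. se x) = ereal a4" "0 \<le> a4"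
    by (cases "SUP x\<in>dense_leaf. se x") auto
  have "1 \<le> ?a1"
    using x0 D0D ip1[of x0] ip_sp[of x0] by (intro SUP_upper2[of x0]) (auto intro: order_trans)
  moreover have "1 \<le> ?a3" using ip1 D0D by (intro INF_greatest) blast
  moreover have "residually_many X (\<lambda>x. sp x = ?a1 \<and> ereal a2 \<le> ie x \<and> ie x \<le> ereal (real K * a2) \<and>
      ip x = ?a3 \<and> se x = ereal a4)"
  proof -
    have K: "real K > 0" using K_pos by simp
    have lnt: "filterlim (\<lambda>r::real. ln r) at_top at_top" by (rule ln_at_top)
    have idt: "filterlim (\<lambda>r::real. r) at_top at_top" by (rule filterlim_ident)
    have "((\<lambda>r::real. ln r / ln (r + k)) \<longlongrightarrow> 1) at_top" for k by real_asymp
    from residually_Limsup_ge_SUP[OF lnt this]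
    have 1: "residually_many X (\<lambda>y. ?a1 \<le> sp y)" unfolding sp_def .
    have "((\<lambda>r::real. r / (r + k)) \<longlongrightarrow> 1) at_top" for k by real_asymp
    from residually_Limsup_ge_SUP[OF idt this]
    have 2: "residually_many X (\<lambda>y. (SUP x\<in>dense_leaf. se x) \<le> se y)" unfolding se_def .
    \<comment> \<open>The dilation of the radius disappears in the limit for \<open>ln\<close> and
      survives as \<open>real K\<close> for the identity: \<open>a3\<close> is exact,
      \<open>a2\<close> only up to that factor.\<close>
    have "((\<lambda>r::real. ln (real K * r + k) / ln r) \<longlongrightarrow> 1) at_top" for k using K by real_asymp
    from residually_Liminf_le_INF[OF lnt this]
    have 3: "residually_many X (\<lambda>y. \<forall>c. ?a3 < ereal c \<longrightarrow> ip y \<le> ereal (1 * c))" unfolding ip_def by simp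
    have "((\<lambda>r::real. (real K * r + k) / r) \<longlongrightarrow> real K) at_top" for k using K by real_asymp
    from residually_Liminf_le_INF[OF idt this K]
    have 4: "residually_many X (\<lambda>y. \<forall>c. (INF x\<in>generic. ie x) < ereal c \<longrightarrow> ie y \<le> ereal (real K * c))"
      unfolding ie_def .
    from residually_many_conj[OF residually_many_conj[OF 1 2] residually_many_conj[OF residually_many_conj[OF 3 4] residual_generic]]
    show ?thesis
    proof (rule residually_many_mono)
      fix y assume y: "(?a1 \<le> sp y \<and> (SUP x\<in>dense_leaf. se x) \<le> se y) \<and>
        ((\<forall>c. ?a3 < ereal c \<longrightarrow> ip y \<le> ereal (1 * c)) \<and>
         (\<forall>c. (INF x\<in>generic. ie x) < ereal c \<longrightarrow> ie y \<le> ereal (real K * c))) \<and> y \<in> generic"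
      then have yD: "y \<in> dense_leaf" "y \<in> generic" using D0D by auto
      have "sp y = ?a1" using y SUP_upper[OF yD(1), of sp] by (auto intro: antisym)
      moreover have "se y = ereal a4" using y SUP_upper[OF yD(1), of se] a4(1) by (auto intro: antisym)
      moreover have "ip y = ?a3"
      proof (rule antisym)
        show "ip y \<le> ?a3"
        proof (rule ccontr)
          assume "\<not> ip y \<le> ?a3"
          then have "?a3 < ip y" by (simp only: not_le)
          then obtain c where c: "?a3 < ereal c" "ereal c < ip y" using ereal_dense2 by blast
          then have "ip y \<le> ereal (1 * c)" using y by blast
          then show False using c(2) by (simp add: leD)
        qed
      qed (rule INF_lower[OF yD(2)])
      moreover have "ereal a2 \<le> ie y" using INF_lower[OF yD(2), of ie] a2(1) by simp
      moreover have "ie y \<le> ereal (real K * a2)"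
      proof (rule ccontr)
        assume "\<not> ie y \<le> ereal (real K * a2)"
        then have "ereal (real K * a2) < ie y" by (simp only: not_le)
        then obtain c where c: "ereal (real K * a2) < ereal c" "ereal c < ie y"
          using ereal_dense2 by blast
        then have "a2 < c / real K" using K by (simp add: pos_less_divide_eq mult.commute)
        then have "(INF x\<in>generic. ie x) < ereal (c / real K)" unfolding a2(1) by simp
        then have "ie y \<le> ereal (real K * (c / real K))" using y by blast
        then have "ie y \<le> ereal c" using K_pos by simp
        then show False using c(2) by (simp add: leD)
      qed
      ultimately show "sp y = ?a1 \<and> ereal a2 \<le> ie y \<and> ie y \<le> ereal (real K * a2) \<and>
        ip y = ?a3 \<and> se y = ereal a4" by blast
    qed
  qed
  moreover have "\<forall>x\<in>generic. ip x \<ge> ?a3 \<and> se x \<le> ereal a4"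
  proof
    fix x assume x: "x \<in> generic"
    then have "se x \<le> (SUP x\<in>dense_leaf. se x)" using D0D by (intro SUP_upper) blast
    then show "ip x \<ge> ?a3 \<and> se x \<le> ereal a4" using INF_lower[OF x, of ip] a4(1) by simp
  qed
  moreover have "1 \<le> real K" using K_pos by simp
  ultimately show ?thesis using a2(2) a4(2)
    unfolding sp_def[symmetric] ip_def[symmetric] se_def[symmetric] ie_def[symmetric]
    by (intro exI[of _ ?a1] exI[of _ ?a3] exI[of _ a2] exI[of _ a4] exI[of _ "real K"] conjI)
qed

end

section \<open>Foliated charts\<close>

definition plaque :: "('a, 'n::finite, 'z) fchart \<Rightarrow> 'z \<Rightarrow> 'a set" where
  "plaque c z = {x \<in> fchart.dom c. transverse_proj c x = z}"

lemma foliated_chartE: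
  assumes "foliated_chart X c"
  obtains g where
    "continuous_map (subtopology X (fchart.dom c))
      (prod_topology (top_of_set (fchart.cball c)) (fchart.trans c)) (fchart.chart c)"
    "continuous_map (prod_topology (top_of_set (fchart.cball c)) (fchart.trans c))
      (subtopology X (fchart.dom c)) g"
    "\<And>x. x \<in> fchart.dom c \<Longrightarrow> g (fchart.chart c x) = x"
    "\<And>b z. b \<in> fchart.cball c \<Longrightarrow> z \<in> topspace (fchart.trans c) \<Longrightarrow>
      g (b, z) \<in> fchart.dom c \<and> fchart.chart c (g (b, z)) = (b, z)"
proof -
  have sub: "fchart.dom c \<subseteq> topspace X" using assms openin_subset unfolding foliated_chart_def by blast
  obtain g where g: "homeomorphic_maps (subtopology X (fchart.dom c))
       (prod_topology (top_of_set (fchart.cball c)) (fchart.trans c)) (fchart.chart c) g"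
    using assms unfolding foliated_chart_def homeomorphic_map_maps by blast
  show thesis
  proof
    show 1: "continuous_map (prod_topology (top_of_set (fchart.cball c)) (fchart.trans c))
      (subtopology X (fchart.dom c)) g"
      using g by (simp add: homeomorphic_maps_def)
    show "g (b, z) \<in> fchart.dom c \<and> fchart.chart c (g (b, z)) = (b, z)"
      if "b \<in> fchart.cball c" "z \<in> topspace (fchart.trans c)" for b z
    proof
      have "(b, z) \<in> topspace (prod_topology (top_of_set (fchart.cball c)) (fchart.trans c))" using that by simp
      then show "g (b, z) \<in> fchart.dom c" "fchart.chart c (g (b, z)) = (b, z)"
        using continuous_map_image_subset_topspace[OF 1] g by (auto simp: homeomorphic_maps_def)
    qed
  qed (use g sub in \<open>auto simp: homeomorphic_maps_def\<close>)
qed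

lemma foliated_chart_open: "foliated_chart X c \<Longrightarrow> openin X (fchart.dom c)"
  by (simp add: foliated_chart_def)

lemma foliated_chart_topspace: "foliated_chart X c \<Longrightarrow> x \<in> fchart.dom c \<Longrightarrow> x \<in> topspace X"
  using foliated_chart_open openin_subset by blast

lemma foliated_chart_topspace_sub:
  "foliated_chart X c \<Longrightarrow> topspace (subtopology X (fchart.dom c)) = fchart.dom c"
  using foliated_chart_topspace[of X c] by auto

lemma foliated_chart_mem:
  assumes "foliated_chart X c" "x \<in> fchart.dom c"
  shows "fst (fchart.chart c x) \<in> fchart.cball c" "transverse_proj c x \<in> topspace (fchart.trans c)"
proof -
  obtain g where "continuous_map (subtopology X (fchart.dom c))
      (prod_topology (top_of_set (fchart.cball c)) (fchart.trans c)) (fchart.chart c)"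
    using foliated_chartE[OF assms(1)] by metis
  from continuous_map_image_subset_topspace[OF this] assms(2)
  have "fchart.chart c x \<in> fchart.cball c \<times> topspace (fchart.trans c)"
    by (auto simp: foliated_chart_topspace_sub[OF assms(1)] simp del: topspace_subtopology)
  then show "fst (fchart.chart c x) \<in> fchart.cball c" "transverse_proj c x \<in> topspace (fchart.trans c)"
    by (auto simp: transverse_proj_def mem_Times_iff)
qed

lemma foliated_chart_inj: "foliated_chart X c \<Longrightarrow> inj_on (fchart.chart c) (fchart.dom c)"
  by (rule foliated_chartE[of X c]) (auto intro: inj_on_inverseI)

lemma transverse_proj_continuous:
  assumes "foliated_chart X c"
  shows "continuous_map (subtopology X (fchart.dom c)) (fchart.trans c) (transverse_proj c)"
proof -
  obtain g where "continuous_map (subtopology X (fchart.dom c))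
      (prod_topology (top_of_set (fchart.cball c)) (fchart.trans c)) (fchart.chart c)"
    using foliated_chartE[OF assms] by metis
  from continuous_map_compose[OF this continuous_map_snd] show ?thesis
    by (simp add: transverse_proj_def[abs_def] comp_def)
qed

lemma transverse_proj_open:
  assumes "foliated_chart X c"
  shows "open_map (subtopology X (fchart.dom c)) (fchart.trans c) (transverse_proj c)"
proof -
  have "open_map (subtopology X (fchart.dom c))
      (prod_topology (top_of_set (fchart.cball c)) (fchart.trans c)) (fchart.chart c)"
    using assms homeomorphic_imp_open_map unfolding foliated_chart_def by blast
  from open_map_compose[OF this open_map_snd] show ?thesis
    by (simp add: transverse_proj_def[abs_def] comp_def)
qed

lemma foliated_chart_trans_Hausdorff: "foliated_chart X c \<Longrightarrow> Hausdorff_space (fchart.trans c)"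
  unfolding foliated_chart_def polish_space_def
  using completely_metrizable_imp_metrizable_space metrizable_imp_Hausdorff_space by blast

lemma plaques_eq:
  assumes "foliated_chart X c"
  shows "plaques c = plaque c ` topspace (fchart.trans c)"
proof -
  have "{x \<in> fchart.dom c. fchart.chart c x \<in> fchart.cball c \<times> {z}} = plaque c z" for z
    using foliated_chart_mem[OF assms] by (auto simp: plaque_def transverse_proj_def mem_Times_iff)
  then show ?thesis by (auto simp: plaques_def)
qed

lemma plaque_nonempty:
  assumes "foliated_chart X c" "z \<in> topspace (fchart.trans c)"
  shows "plaque c z \<noteq> {}"
proof -
  obtain b r where "0 < r" "fchart.cball c = ball b r" using assms(1) unfolding foliated_chart_def by blast
  then have b: "b \<in> fchart.cball c" by simp
  obtain g where "g (b, z) \<in> fchart.dom c \<and> fchart.chart c (g (b, z)) = (b, z)"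
    using foliated_chartE[OF assms(1)] b assms(2) by metis
  then show ?thesis by (auto simp: plaque_def transverse_proj_def)
qed

text \<open>What remains of a change of coordinates \<open>(x, h)\<close>: since \<open>h\<close>
  depends on the transverse coordinate alone, plaques go into plaques locally.\<close>

lemma foliated_change_local:
  assumes "foliated_chart X c" "foliated_change X c d" "u \<in> fchart.dom c" "u \<in> fchart.dom d"
  obtains W where "openin X W" "u \<in> W" "W \<subseteq> fchart.dom c \<inter> fchart.dom d"
    "\<And>y y'. y \<in> W \<Longrightarrow> y' \<in> W \<Longrightarrow> transverse_proj c y = transverse_proj c y' \<Longrightarrow>
      transverse_proj d y = transverse_proj d y'"
proof -
  from bspec[OF assms(2)[unfolded foliated_change_def] IntI[OF assms(3,4)]]
  obtain W x h where W: "openin X W" "u \<in> W" "W \<subseteq> fchart.dom c \<inter> fchart.dom d"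
    and h: "\<forall>(b, z) \<in> fchart.chart c ` W.
      fchart.chart d (inv_into (fchart.dom c) (fchart.chart c) (b, z)) = (x (b, z), h z)"
    by (elim exE conjE) (rule that)
  have "transverse_proj d y = h (transverse_proj c y)" if "y \<in> W" for y
  proof -
    have "fchart.chart d (inv_into (fchart.dom c) (fchart.chart c) (fchart.chart c y)) =
        (x (fchart.chart c y), h (snd (fchart.chart c y)))"
      using bspec[OF h imageI[OF that]] by (simp add: case_prod_unfold)
    moreover have "inv_into (fchart.dom c) (fchart.chart c) (fchart.chart c y) = y"
      using that W(3) by (intro inv_into_f_f foliated_chart_inj[OF assms(1)]) auto
    ultimately show ?thesis by (simp add: transverse_proj_def)
  qed
  then show thesis by (intro that[OF W]) simp
qed

text \<open>Members of \<open>charts_of X F\<close> are by definition compatible with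
  \<open>F\<close>, not with one another, so the change is made in two stages through a chart of
  \<open>F\<close> at \<open>u\<close>.\<close>

lemma charts_of_change_local:
  assumes F: "foliated_atlas X F" and c: "c \<in> charts_of X F" and d: "d \<in> charts_of X F"
    and u: "u \<in> fchart.dom c" "u \<in> fchart.dom d"
  obtains W where "openin X W" "u \<in> W" "W \<subseteq> fchart.dom c \<inter> fchart.dom d"
    "\<And>y y'. y \<in> W \<Longrightarrow> y' \<in> W \<Longrightarrow> transverse_proj c y = transverse_proj c y' \<Longrightarrow>
      transverse_proj d y = transverse_proj d y'"
proof -
  have "u \<in> topspace X" using c u(1) foliated_chart_topspace[of X c] unfolding charts_of_def by blast
  then obtain f where f: "f \<in> F" "u \<in> fchart.dom f" using F unfolding foliated_atlas_def by blast
  have ch: "foliated_chart X c" "foliated_chart X f" "foliated_change X c f" "foliated_change X f d"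
    using F c d f unfolding foliated_atlas_def charts_of_def by blast+
  obtain W1 where W1: "openin X W1" "u \<in> W1" "W1 \<subseteq> fchart.dom c \<inter> fchart.dom f"
    "\<And>y y'. y \<in> W1 \<Longrightarrow> y' \<in> W1 \<Longrightarrow> transverse_proj c y = transverse_proj c y' \<Longrightarrow>
      transverse_proj f y = transverse_proj f y'"
    using foliated_change_local[OF ch(1,3) u(1) f(2)] by blast
  obtain W2 where W2: "openin X W2" "u \<in> W2" "W2 \<subseteq> fchart.dom f \<inter> fchart.dom d"
    "\<And>y y'. y \<in> W2 \<Longrightarrow> y' \<in> W2 \<Longrightarrow> transverse_proj f y = transverse_proj f y' \<Longrightarrow>
      transverse_proj d y = transverse_proj d y'"
    using foliated_change_local[OF ch(2,4) f(2) u(2)] by blast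
  show thesis
  proof (rule that[of "W1 \<inter> W2"])
    show "openin X (W1 \<inter> W2)" using W1 W2 by blast
    show "u \<in> W1 \<inter> W2" "W1 \<inter> W2 \<subseteq> fchart.dom c \<inter> fchart.dom d" using W1 W2 by auto
    show "transverse_proj d y = transverse_proj d y'"
      if "y \<in> W1 \<inter> W2" "y' \<in> W1 \<inter> W2" "transverse_proj c y = transverse_proj c y'" for y y'
      using W1(4)[of y y'] W2(4)[of y y'] that by blast
  qed
qed

lemma compactin_finite_nbhds:
  assumes "compactin X K" "\<And>x. x \<in> K \<Longrightarrow> openin X (V x) \<and> x \<in> V x"
  obtains S where "finite S" "S \<subseteq> K" "K \<subseteq> \<Union>(V ` S)"
proof -
  have "(\<forall>U\<in>V ` K. openin X U) \<and> K \<subseteq> \<Union>(V ` K)" using assms(2) by auto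
  then obtain \<F> where "finite \<F>" "\<F> \<subseteq> V ` K" "K \<subseteq> \<Union>\<F>"
    using assms(1) unfolding compactin_def by meson
  then show thesis using that by (metis finite_subset_image)
qed

section \<open>A regular atlas as a transverse atlas, and its shrinking\<close>

locale regular_foliation =
  fixes X :: "'a topology" and F A :: "('a, 'n::finite, 'z) fchart set"
  assumes space: "compact_polish_foliated_space X F"
    and regular: "regular_foliated_atlas X F A"
begin

text \<open>Local finiteness does not bound the number of charts with empty domain, so these are
  discarded to obtain a finite index set.\<close>

definition I :: "('a, 'n, 'z) fchart set" where
  "I = {c \<in> A. fchart.dom c \<noteq> {}}"

lemma
  shows compact_X: "compact_space X" and Hausdorff_X: "Hausdorff_space X"
    and second_countable_X: "second_countable X" and atlas_F: "foliated_atlas X F"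
  using space by (auto simp: compact_polish_foliated_space_def)

lemma
  shows atlas_A: "foliated_atlas X A" and A_charts_of: "A \<subseteq> charts_of X F"
  using regular by (auto simp: regular_foliated_atlas_def)

lemma chart_A: "c \<in> A \<Longrightarrow> foliated_chart X c"
  using atlas_A by (simp add: foliated_atlas_def)

lemma cover_A: "(\<Union>c\<in>A. fchart.dom c) = topspace X"
  using atlas_A by (simp add: foliated_atlas_def)

text \<open>Both points lie on one plaque of \<open>c\<close>, and regularity forbids that its
  closure meets the closures of two plaques of \<open>d\<close>.\<close>

lemma coherent_A:
  assumes "c \<in> A" "d \<in> A" "x \<in> fchart.dom c \<inter> fchart.dom d" "y \<in> fchart.dom c \<inter> fchart.dom d"
    "transverse_proj c x = transverse_proj c y"
  shows "transverse_proj d x = transverse_proj d y"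
proof -
  let ?P = "plaque c (transverse_proj c x)" and ?Q = "\<lambda>x. plaque d (transverse_proj d x)"
  have pl: "plaque e (transverse_proj e u) \<in> plaques e \<and> u \<in> X closure_of plaque e (transverse_proj e u)"
    if "e \<in> A" "u \<in> fchart.dom e" for e u
  proof
    show "plaque e (transverse_proj e u) \<in> plaques e"
      using plaques_eq[OF chart_A[OF that(1)]] foliated_chart_mem(2)[OF chart_A[OF that(1)] that(2)] by blast
    have "plaque e (transverse_proj e u) \<subseteq> topspace X"
      using foliated_chart_topspace[OF chart_A[OF that(1)]] by (auto simp: plaque_def)
    then show "u \<in> X closure_of plaque e (transverse_proj e u)"
      using closure_of_subset that by (fastforce simp: plaque_def)
  qed
  have "x \<in> X closure_of ?P" "y \<in> X closure_of ?P" "?P \<in> plaques c"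
    using pl[of c x] pl[of c y] assms by auto
  moreover have "x \<in> X closure_of ?Q x" "y \<in> X closure_of ?Q y" "?Q x \<in> plaques d" "?Q y \<in> plaques d"
    using pl[of d x] pl[of d y] assms by auto
  ultimately have "?Q x = ?Q y"
    using regular assms(1,2) unfolding regular_foliated_atlas_def by blast
  moreover have "y \<in> ?Q y" using assms by (simp add: plaque_def)
  ultimately have "y \<in> ?Q x" by simp
  then show ?thesis by (simp add: plaque_def)
qed

lemma finite_I: "finite I"
proof -
  have "\<forall>x\<in>topspace X. \<exists>V. openin X V \<and> x \<in> V \<and> finite {c\<in>A. fchart.dom c \<inter> V \<noteq> {}}"
    using regular by (simp add: regular_foliated_atlas_def)
  from bchoice[OF this] obtain V where
    V: "\<And>x. x \<in> topspace X \<Longrightarrow> openin X (V x) \<and> x \<in> V x \<and> finite {c\<in>A. fchart.dom c \<inter> V x \<noteq> {}}"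
    by blast
  obtain S where S: "finite S" "S \<subseteq> topspace X" "topspace X \<subseteq> \<Union>(V ` S)"
    using compactin_finite_nbhds[OF compact_X[unfolded compact_space_def], of V] V by blast
  have "I \<subseteq> (\<Union>x\<in>S. {c\<in>A. fchart.dom c \<inter> V x \<noteq> {}})"
  proof
    fix c assume c: "c \<in> I"
    then obtain u where u: "u \<in> fchart.dom c" "c \<in> A" by (auto simp: I_def)
    then have "u \<in> topspace X" using foliated_chart_topspace[OF chart_A[OF u(2)]] by blast
    then obtain x where "x \<in> S" "u \<in> V x" using S by blast
    then show "c \<in> (\<Union>x\<in>S. {c\<in>A. fchart.dom c \<inter> V x \<noteq> {}})" using u by blast
  qed
  moreover have "finite \<dots>"
  proof (rule finite_UN_I[OF S(1)])
    fix x assume "x \<in> S"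
    then show "finite {c\<in>A. fchart.dom c \<inter> V x \<noteq> {}}" using S(2) V[of x] by blast
  qed
  ultimately show ?thesis by (rule finite_subset)
qed

lemma cover_I: "(\<Union>c\<in>I. fchart.dom c) = topspace X"
  using cover_A by (fastforce simp: I_def)

sublocale transverse_atlas X I fchart.dom fchart.trans transverse_proj
proof
  show "finite I" by (rule finite_I)
  show "(\<Union>c\<in>I. fchart.dom c) = topspace X" by (rule cover_I)
  fix c assume "c \<in> I"
  then have c: "foliated_chart X c" using chart_A by (simp add: I_def)
  show "openin X (fchart.dom c)" using c by (rule foliated_chart_open)
  show "continuous_map (subtopology X (fchart.dom c)) (fchart.trans c) (transverse_proj c)"
    using c by (rule transverse_proj_continuous)
  show "open_map (subtopology X (fchart.dom c)) (fchart.trans c) (transverse_proj c)"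
    using c by (rule transverse_proj_open)
  show "Hausdorff_space (fchart.trans c)" using c by (rule foliated_chart_trans_Hausdorff)
next
  fix c d x y assume "c \<in> I" "d \<in> I" "x \<in> fchart.dom c \<inter> fchart.dom d" "y \<in> fchart.dom c \<inter> fchart.dom d"
    "transverse_proj c x = transverse_proj c y"
  then show "transverse_proj d x = transverse_proj d y"
    by (intro coherent_A[of c d]) (simp_all add: I_def)
qed

text \<open>By regularity of compact Hausdorff spaces each point has a closed neighbourhood inside a
  chart; finitely many of them suffice and are collected chart by chart. The interiors must cover,
  so that around every point a whole neighbourhood fits into one \<open>C c\<close>.\<close>

lemma shrinking:
  obtains C where "\<And>c. c \<in> I \<Longrightarrow> closedin X (C c)" "\<And>c. c \<in> I \<Longrightarrow> C c \<subseteq> fchart.dom c"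
    "\<And>x. x \<in> topspace X \<Longrightarrow> \<exists>c\<in>I. x \<in> X interior_of C c"
proof -
  have "regular_space X"
    using compact_X Hausdorff_X compact_Hausdorff_imp_regular_space by blast
  then have nb: "neighbourhood_base_of (closedin X) X" by (simp add: neighbourhood_base_of_closedin)
  have "\<exists>c U V. c \<in> I \<and> openin X U \<and> closedin X V \<and> x \<in> U \<and> U \<subseteq> V \<and> V \<subseteq> fchart.dom c"
    if x: "x \<in> topspace X" for x
  proof -
    obtain c where "c \<in> I" "x \<in> fchart.dom c" using x cover_I by blast
    moreover have "openin X (fchart.dom c)" using \<open>c \<in> I\<close> by (rule open_U)
    ultimately obtain U V where "openin X U" "closedin X V" "x \<in> U" "U \<subseteq> V" "V \<subseteq> fchart.dom c"
      using nb[unfolded neighbourhood_base_of, rule_format, of "fchart.dom c" x] by blast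
    then show ?thesis using \<open>c \<in> I\<close> by blast
  qed
  then have "\<forall>x\<in>topspace X. \<exists>p. fst p \<in> I \<and> openin X (fst (snd p)) \<and> closedin X (snd (snd p)) \<and>
      x \<in> fst (snd p) \<and> fst (snd p) \<subseteq> snd (snd p) \<and> snd (snd p) \<subseteq> fchart.dom (fst p)"
    by (metis fst_conv snd_conv)
  from bchoice[OF this] obtain p where p: "\<forall>x\<in>topspace X. fst (p x) \<in> I \<and> openin X (fst (snd (p x))) \<and>
      closedin X (snd (snd (p x))) \<and> x \<in> fst (snd (p x)) \<and> fst (snd (p x)) \<subseteq> snd (snd (p x)) \<and>
      snd (snd (p x)) \<subseteq> fchart.dom (fst (p x))"
    by blast
  define c where "c x = fst (p x)" for x
  define U where "U x = fst (snd (p x))" for x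
  define V where "V x = snd (snd (p x))" for x
  have cUV: "\<And>x. x \<in> topspace X \<Longrightarrow> c x \<in> I \<and> openin X (U x) \<and> closedin X (V x) \<and>
      x \<in> U x \<and> U x \<subseteq> V x \<and> V x \<subseteq> fchart.dom (c x)" for x
    using p by (simp add: c_def U_def V_def)
  obtain S where S: "finite S" "S \<subseteq> topspace X" "topspace X \<subseteq> \<Union>(U ` S)"
    using compactin_finite_nbhds[OF compact_X[unfolded compact_space_def], of U] cUV by blast
  define C where "C d = \<Union>(V ` {x \<in> S. c x = d})" for d
  show thesis
  proof (rule that[of C])
    show "closedin X (C d)" for d
      unfolding C_def using S cUV by (intro closedin_Union) auto
    show "C d \<subseteq> fchart.dom d" for d using S cUV by (fastforce simp: C_def)
    show "\<exists>d\<in>I. x \<in> X interior_of C d" if x: "x \<in> topspace X" for x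
    proof -
      obtain y where y: "y \<in> S" "x \<in> U y" using S x by blast
      then have "y \<in> topspace X" using S by blast
      from cUV[OF this] have "openin X (U y)" "U y \<subseteq> V y" "c y \<in> I" by auto
      moreover have "V y \<subseteq> C (c y)" using y by (auto simp: C_def)
      ultimately have "U y \<subseteq> X interior_of C (c y)" by (intro interior_of_maximal) auto
      then show ?thesis using y \<open>c y \<in> I\<close> by blast
    qed
  qed
qed

end

section \<open>Uniform shrinking of plaques\<close>

context regular_foliation begin

text \<open>The point \<open>u0\<close> may lie on the boundary of the chart \<open>c\<close>, where
  its coordinates are lost. In the larger chart \<open>c'\<close> provided by regularity,
  \<open>u0\<close> has a product neighbourhood that lies inside one \<open>C e\<close> and on which
  plaques of \<open>c'\<close> go into plaques of \<open>e\<close>.\<close>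

lemma uniform_room_local:
  assumes C: "\<And>x. x \<in> topspace X \<Longrightarrow> \<exists>c\<in>I. x \<in> X interior_of C c"
    and C_sub: "\<And>c. c \<in> I \<Longrightarrow> C c \<subseteq> fchart.dom c"
    and c: "c \<in> I" and u0: "u0 \<in> X closure_of fchart.dom c"
  obtains V \<delta> where "openin X V" "u0 \<in> V" "0 < \<delta>"
    "\<And>u u'. \<lbrakk>u \<in> V; u \<in> fchart.dom c; u' \<in> fchart.dom c; transverse_proj c u = transverse_proj c u';
      dist (fst (fchart.chart c u)) (fst (fchart.chart c u')) < \<delta>\<rbrakk> \<Longrightarrow>
      \<exists>e\<in>I. u \<in> C e \<and> u' \<in> C e \<and> transverse_proj e u = transverse_proj e u'"
proof -
  have "\<forall>c\<in>A. \<exists>c'\<in>charts_of X F. X closure_of fchart.dom c \<subseteq> fchart.dom c' \<and>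
      (\<forall>x\<in>fchart.dom c. fchart.chart c x = fchart.chart c' x)"
    using regular by (simp add: regular_foliated_atlas_def)
  then obtain c' where c': "c' \<in> charts_of X F" "X closure_of fchart.dom c \<subseteq> fchart.dom c'"
    "\<And>x. x \<in> fchart.dom c \<Longrightarrow> fchart.chart c x = fchart.chart c' x"
    using c unfolding I_def by blast
  have ch: "foliated_chart X c'" using c'(1) by (simp add: charts_of_def)
  have "fchart.dom c \<subseteq> topspace X" using open_U[OF c] by (rule openin_subset)
  then have sub: "fchart.dom c \<subseteq> fchart.dom c'" using c'(2) closure_of_subset by blast
  have u0c: "u0 \<in> fchart.dom c'" using u0 c'(2) by blast
  have u0t: "u0 \<in> topspace X" using foliated_chart_topspace[OF ch u0c] .
  then obtain e where e: "e \<in> I" "u0 \<in> X interior_of C e" using C by blast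
  have "u0 \<in> fchart.dom e" using e(2) C_sub[OF e(1)] interior_of_subset[of X "C e"] by blast
  have "e \<in> charts_of X F" using e A_charts_of by (auto simp: I_def)
  from charts_of_change_local[OF atlas_F c'(1) this u0c \<open>u0 \<in> fchart.dom e\<close>]
  obtain W where W: "openin X W" "u0 \<in> W" "W \<subseteq> fchart.dom c' \<inter> fchart.dom e"
    and We: "\<And>y y'. y \<in> W \<Longrightarrow> y' \<in> W \<Longrightarrow> transverse_proj c' y = transverse_proj c' y' \<Longrightarrow>
      transverse_proj e y = transverse_proj e y'" by blast
  let ?Y = "subtopology X (fchart.dom c')"
  let ?P = "prod_topology (top_of_set (fchart.cball c')) (fchart.trans c')"
  define W' where "W' = W \<inter> X interior_of C e"
  have W'c: "W' \<subseteq> fchart.dom c'" using W by (auto simp: W'_def)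
  have "openin ?Y W'"
    unfolding openin_subtopology using W W'c by (intro exI[of _ W']) (auto simp: W'_def)
  moreover have "open_map ?Y ?P (fchart.chart c')"
    using ch homeomorphic_imp_open_map unfolding foliated_chart_def by blast
  ultimately have oW': "openin ?P (fchart.chart c' ` W')" by (simp add: open_map_def)
  obtain b0 z0 where bz: "fchart.chart c' u0 = (b0, z0)" by fastforce
  then have "(b0, z0) \<in> fchart.chart c' ` W'" using W e by (metis IntI W'_def imageI)
  from oW'[unfolded openin_prod_topology_alt, rule_format, OF this]
  obtain B N where BN: "openin (top_of_set (fchart.cball c')) B" "openin (fchart.trans c') N"
    "b0 \<in> B" "z0 \<in> N" "B \<times> N \<subseteq> fchart.chart c' ` W'"
    by blast
  have "open (fchart.cball c')" using ch unfolding foliated_chart_def by auto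
  then have "open B" using BN(1) openin_open_trans by blast
  then obtain \<epsilon> where \<epsilon>: "0 < \<epsilon>" "ball b0 \<epsilon> \<subseteq> B" using BN(3) open_contains_ball by blast
  \<comment> \<open>Half of \<open>\<epsilon>\<close> locates \<open>u\<close>; the other half
    remains for the distance from \<open>u\<close> to \<open>u'\<close>.\<close>
  define V where "V = {u \<in> topspace ?Y. fchart.chart c' u \<in> (ball b0 (\<epsilon>/2) \<inter> fchart.cball c') \<times> N}"
  have cont: "continuous_map ?Y ?P (fchart.chart c')"
    using foliated_chartE[OF ch] by metis
  have "openin ?P ((ball b0 (\<epsilon>/2) \<inter> fchart.cball c') \<times> N)"
    using BN(2) by (auto simp: openin_prod_Times_iff openin_open)
  then have "openin ?Y V" unfolding V_def by (rule openin_continuous_map_preimage[OF cont])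
  then have oV: "openin X V" using foliated_chart_open[OF ch] openin_trans_full by blast
  have "u0 \<in> V"
  proof -
    have "b0 \<in> fchart.cball c'" using foliated_chart_mem(1)[OF ch u0c] bz by simp
    then show ?thesis using bz \<epsilon> BN(4) u0c u0t by (simp add: V_def)
  qed
  moreover have "\<exists>e\<in>I. u \<in> C e \<and> u' \<in> C e \<and> transverse_proj e u = transverse_proj e u'"
    if u: "u \<in> V" "u \<in> fchart.dom c" "u' \<in> fchart.dom c" "transverse_proj c u = transverse_proj c u'"
      "dist (fst (fchart.chart c u)) (fst (fchart.chart c u')) < \<epsilon>/2" for u u'
  proof -
    have tr: "transverse_proj c' y = transverse_proj c y" if "y \<in> fchart.dom c" for y
      using c'(3)[OF that] by (simp add: transverse_proj_def)
    have mem: "y \<in> W'" if "y \<in> fchart.dom c'" "fst (fchart.chart c' y) \<in> ball b0 \<epsilon>"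
      "transverse_proj c' y \<in> N" for y
    proof -
      have "fchart.chart c' y \<in> B \<times> N"
        using that \<epsilon>(2) by (auto simp only: transverse_proj_def mem_Times_iff)
      then have "fchart.chart c' y \<in> fchart.chart c' ` W'" by (rule subsetD[OF BN(5)])
      then show ?thesis
        using inj_on_image_mem_iff[OF foliated_chart_inj[OF ch] that(1) W'c] by simp
    qed
    have ub: "fst (fchart.chart c' u) \<in> ball b0 (\<epsilon>/2)" "transverse_proj c' u \<in> N"
      using u(1) by (auto simp: V_def mem_Times_iff transverse_proj_def)
    have "u \<in> W'" using ub \<epsilon>(1) sub u by (intro mem) auto
    moreover have "u' \<in> W'"
    proof (rule mem)
      have "dist b0 (fst (fchart.chart c' u')) \<le>
          dist b0 (fst (fchart.chart c' u)) + dist (fst (fchart.chart c' u)) (fst (fchart.chart c' u'))"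
        by (rule dist_triangle)
      also have "\<dots> < \<epsilon>" using ub(1) u c'(3) by simp
      finally show "fst (fchart.chart c' u') \<in> ball b0 \<epsilon>" by simp
      show "transverse_proj c' u' \<in> N" using ub(2) u tr by simp
    qed (use u sub in auto)
    moreover have "transverse_proj c' u = transverse_proj c' u'" using u tr by simp
    moreover have "W' \<subseteq> W" "W' \<subseteq> C e" using interior_of_subset[of X "C e"] by (auto simp: W'_def)
    ultimately show ?thesis using We[of u u'] e(1) by (intro bexI[of _ e]) auto
  qed
  ultimately show thesis using that[OF oV, of "\<epsilon>/2"] \<epsilon>(1) by simp
qed

text \<open>A Lebesgue number: finitely many of the local neighbourhoods cover the compact closure
  of the chart domain, and the least of their \<open>\<delta>\<close> serves everywhere.\<close>

lemma uniform_room: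
  assumes C: "\<And>x. x \<in> topspace X \<Longrightarrow> \<exists>c\<in>I. x \<in> X interior_of C c"
    and C_sub: "\<And>c. c \<in> I \<Longrightarrow> C c \<subseteq> fchart.dom c" and c: "c \<in> I"
  obtains \<delta> where "0 < \<delta>"
    "\<And>u u'. \<lbrakk>u \<in> fchart.dom c; u' \<in> fchart.dom c; transverse_proj c u = transverse_proj c u';
      dist (fst (fchart.chart c u)) (fst (fchart.chart c u')) < \<delta>\<rbrakk> \<Longrightarrow>
      \<exists>e\<in>I. u \<in> C e \<and> u' \<in> C e \<and> transverse_proj e u = transverse_proj e u'"
proof -
  let ?R = "\<lambda>u u'. \<exists>e\<in>I. u \<in> C e \<and> u' \<in> C e \<and> transverse_proj e u = transverse_proj e u'"
  let ?Q = "\<lambda>V \<delta>. \<forall>u u'. u \<in> V \<longrightarrow> u \<in> fchart.dom c \<longrightarrow> u' \<in> fchart.dom c \<longrightarrow>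
    transverse_proj c u = transverse_proj c u' \<longrightarrow>
    dist (fst (fchart.chart c u)) (fst (fchart.chart c u')) < \<delta> \<longrightarrow> ?R u u'"
  let ?K = "X closure_of fchart.dom c"
  have "\<forall>u0\<in>?K. \<exists>p. openin X (fst p) \<and> u0 \<in> fst p \<and> (0::real) < snd p \<and> ?Q (fst p) (snd p)"
  proof
    fix u0 assume "u0 \<in> ?K"
    from uniform_room_local[OF C C_sub c this] obtain V \<delta> where
      V: "openin X V" "u0 \<in> V" "(0::real) < \<delta>" and Q: "?Q V \<delta>" by metis
    show "\<exists>p. openin X (fst p) \<and> u0 \<in> fst p \<and> (0::real) < snd p \<and> ?Q (fst p) (snd p)"
      by (rule exI[of _ "(V, \<delta>)"]) (use V Q in simp)
  qed
  from bchoice[OF this] obtain p where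
    p: "\<And>u0. u0 \<in> ?K \<Longrightarrow> openin X (fst (p u0)) \<and> u0 \<in> fst (p u0)"
    and p0: "\<And>u0. u0 \<in> ?K \<Longrightarrow> (0::real) < snd (p u0)" and pQ: "\<And>u0. u0 \<in> ?K \<Longrightarrow> ?Q (fst (p u0)) (snd (p u0))"
    by blast
  have "compactin X ?K" using compact_X by (simp add: closedin_compact_space)
  then obtain S where S: "finite S" "S \<subseteq> ?K" "?K \<subseteq> \<Union>((\<lambda>u. fst (p u)) ` S)"
    using p by (rule compactin_finite_nbhds)
  define \<delta> where "\<delta> = Min (insert 1 ((\<lambda>u. snd (p u)) ` S))"
  have "0 < \<delta>" unfolding \<delta>_def using S p0 by (subst Min_gr_iff) auto
  moreover have "?R u u'" if u: "u \<in> fchart.dom c" "u' \<in> fchart.dom c"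
    "transverse_proj c u = transverse_proj c u'"
    "dist (fst (fchart.chart c u)) (fst (fchart.chart c u')) < \<delta>" for u u'
  proof -
    have "fchart.dom c \<subseteq> topspace X" using open_U[OF c] by (rule openin_subset)
    then have "u \<in> ?K" using closure_of_subset u by blast
    then obtain u0 where u0: "u0 \<in> S" "u \<in> fst (p u0)" using S by blast
    have "\<delta> \<le> snd (p u0)" unfolding \<delta>_def using S u0 by (intro Min_le) auto
    then have "dist (fst (fchart.chart c u)) (fst (fchart.chart c u')) < snd (p u0)" using u by linarith
    then show ?thesis using pQ[of u0] u0 S(2) u by blast
  qed
  ultimately show thesis using that by blast
qed

text \<open>Balls are convex: at fixed transverse coordinate the segment between the two ball
  coordinates is cut into \<open>n\<close> pieces shorter than \<open>\<delta>\<close>. As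
  \<open>n\<close> depends on the diameter of the ball and on \<open>\<delta>\<close> only, it
  serves all plaques of \<open>c\<close>.\<close>

lemma plaque_room_steps:
  assumes C: "\<And>x. x \<in> topspace X \<Longrightarrow> \<exists>c\<in>I. x \<in> X interior_of C c"
    and C_sub: "\<And>c. c \<in> I \<Longrightarrow> C c \<subseteq> fchart.dom c" and c: "c \<in> I"
  obtains n where "0 < n"
    "\<And>u u'. \<lbrakk>u \<in> fchart.dom c; u' \<in> fchart.dom c; transverse_proj c u = transverse_proj c u'\<rbrakk> \<Longrightarrow>
      (u, u') \<in> (\<Union>j\<in>I. {(x, y). x \<in> C j \<and> y \<in> C j \<and> transverse_proj j x = transverse_proj j y}) ^^ n"
proof -
  let ?R = "\<Union>j\<in>I. {(x, y). x \<in> C j \<and> y \<in> C j \<and> transverse_proj j x = transverse_proj j y}"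
  obtain \<delta> where \<delta>: "0 < \<delta>" and room:
    "\<And>u u'. \<lbrakk>u \<in> fchart.dom c; u' \<in> fchart.dom c; transverse_proj c u = transverse_proj c u';
      dist (fst (fchart.chart c u)) (fst (fchart.chart c u')) < \<delta>\<rbrakk> \<Longrightarrow>
      \<exists>e\<in>I. u \<in> C e \<and> u' \<in> C e \<and> transverse_proj e u = transverse_proj e u'"
    using uniform_room[OF C C_sub c] by blast
  have ch: "foliated_chart X c" using c chart_A by (simp add: I_def)
  then obtain m \<rho> where B: "0 < \<rho>" "fchart.cball c = ball m \<rho>" unfolding foliated_chart_def by blast
  obtain g where g: "\<And>x. x \<in> fchart.dom c \<Longrightarrow> g (fchart.chart c x) = x"
    "\<And>b z. b \<in> fchart.cball c \<Longrightarrow> z \<in> topspace (fchart.trans c) \<Longrightarrow>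
      g (b, z) \<in> fchart.dom c \<and> fchart.chart c (g (b, z)) = (b, z)"
    using foliated_chartE[OF ch] by metis
  obtain n where n: "2 * \<rho> / \<delta> < real n" using reals_Archimedean2 by blast
  have "0 < 2 * \<rho> / \<delta>" using B \<delta> by simp
  then have n0: "0 < n" using n by (cases n) auto
  have n\<delta>: "2 * \<rho> < \<delta> * real n" using n \<delta> by (simp add: pos_divide_less_eq mult.commute)
  have "(u, u') \<in> ?R ^^ n"
    if u: "u \<in> fchart.dom c" "u' \<in> fchart.dom c" "transverse_proj c u = transverse_proj c u'" for u u'
  proof -
    define b b' z where "b = fst (fchart.chart c u)" and "b' = fst (fchart.chart c u')"
      and "z = transverse_proj c u"
    have bz: "fchart.chart c u = (b, z)" "fchart.chart c u' = (b', z)"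
      using u(3) by (simp_all add: b_def b'_def z_def transverse_proj_def prod_eq_iff)
    have mem: "b \<in> ball m \<rho>" "b' \<in> ball m \<rho>" "z \<in> topspace (fchart.trans c)"
      using foliated_chart_mem[OF ch] u B(2) unfolding b_def b'_def z_def by metis+
    have "dist b b' < 2 * \<rho>"
      using mem dist_triangle[of b b' m] by (simp add: dist_commute)
    then have "dist b b' < \<delta> * real n" using n\<delta> by linarith
    then have small: "dist b b' / real n < \<delta>" using n0 by (simp add: pos_divide_less_eq)
    define \<gamma> where "\<gamma> i = b + (real i / real n) *\<^sub>R (b' - b)" for i
    have \<gamma>: "\<gamma> i \<in> ball m \<rho>" if "i \<le> n" for i
    proof -
      have "(1 - real i / real n) *\<^sub>R b + (real i / real n) *\<^sub>R b' \<in> ball m \<rho>"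
        using mem that n0 by (intro convexD[OF convex_ball]) auto
      then show ?thesis by (simp add: \<gamma>_def algebra_simps)
    qed
    have gi: "g (\<gamma> i, z) \<in> fchart.dom c \<and> fchart.chart c (g (\<gamma> i, z)) = (\<gamma> i, z)" if "i \<le> n" for i
      using g(2)[of "\<gamma> i" z] \<gamma>[OF that] mem(3) B(2) by simp
    have "(u, g (\<gamma> i, z)) \<in> ?R ^^ i" if "i \<le> n" for i
      using that
    proof (induction i)
      case 0
      then show ?case using g(1)[OF u(1)] bz by (simp add: \<gamma>_def)
    next
      case (Suc i)
      have "\<gamma> (Suc i) - \<gamma> i = (1 / real n) *\<^sub>R (b' - b)"
        by (simp add: \<gamma>_def scaleR_diff_left[symmetric] add_divide_distrib algebra_simps)
      then have "dist (\<gamma> i) (\<gamma> (Suc i)) = dist b b' / real n"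
        by (simp add: dist_norm norm_minus_commute[of "\<gamma> i"] norm_minus_commute[of b])
      then have "\<exists>e\<in>I. g (\<gamma> i, z) \<in> C e \<and> g (\<gamma> (Suc i), z) \<in> C e \<and>
          transverse_proj e (g (\<gamma> i, z)) = transverse_proj e (g (\<gamma> (Suc i), z))"
        using small gi[of i] gi[of "Suc i"] Suc.prems
        by (intro room) (auto simp: transverse_proj_def)
      then have "(g (\<gamma> i, z), g (\<gamma> (Suc i), z)) \<in> ?R" by blast
      moreover have "(u, g (\<gamma> i, z)) \<in> ?R ^^ i" using Suc by simp
      ultimately show ?case by (rule relpow_Suc_I[rotated])
    qed
    from this[of n] show ?thesis using g(1)[OF u(2)] bz n0 by (simp add: \<gamma>_def)
  qed
  then show thesis using n0 that by blast
qed

lemma room_cover: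
  obtains C K where "\<And>c. c \<in> I \<Longrightarrow> closedin X (C c)" "\<And>c. c \<in> I \<Longrightarrow> C c \<subseteq> fchart.dom c" "0 < (K::nat)"
    "\<And>c u u'. \<lbrakk>c \<in> I; u \<in> fchart.dom c; u' \<in> fchart.dom c; transverse_proj c u = transverse_proj c u'\<rbrakk> \<Longrightarrow>
      (u, u') \<in> (\<Union>j\<in>I. {(x, y). x \<in> C j \<and> y \<in> C j \<and> transverse_proj j x = transverse_proj j y}) ^^ K"
proof -
  obtain C where C: "\<And>c. c \<in> I \<Longrightarrow> closedin X (C c)" "\<And>c. c \<in> I \<Longrightarrow> C c \<subseteq> fchart.dom c"
    "\<And>x. x \<in> topspace X \<Longrightarrow> \<exists>c\<in>I. x \<in> X interior_of C c"
    using shrinking by metis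
  let ?R = "\<Union>j\<in>I. {(x, y). x \<in> C j \<and> y \<in> C j \<and> transverse_proj j x = transverse_proj j y}"
  have "\<forall>c\<in>I. \<exists>n. \<forall>u u'. u \<in> fchart.dom c \<longrightarrow> u' \<in> fchart.dom c \<longrightarrow>
      transverse_proj c u = transverse_proj c u' \<longrightarrow> (u, u') \<in> ?R ^^ n"
  proof
    fix c assume "c \<in> I"
    show "\<exists>n. \<forall>u u'. u \<in> fchart.dom c \<longrightarrow> u' \<in> fchart.dom c \<longrightarrow>
        transverse_proj c u = transverse_proj c u' \<longrightarrow> (u, u') \<in> ?R ^^ n"
    proof (rule plaque_room_steps[OF C(3,2) \<open>c \<in> I\<close>], assumption, assumption)
      fix n assume n: "\<And>u u'. \<lbrakk>u \<in> fchart.dom c; u' \<in> fchart.dom c; transverse_proj c u = transverse_proj c u'\<rbrakk> \<Longrightarrow>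
        (u, u') \<in> ?R ^^ n"
      show ?thesis by (intro exI[of _ n] allI impI n)
    qed
  qed
  from bchoice[OF this] obtain n where n: "\<And>c u u'. \<lbrakk>c \<in> I; u \<in> fchart.dom c; u' \<in> fchart.dom c;
      transverse_proj c u = transverse_proj c u'\<rbrakk> \<Longrightarrow> (u, u') \<in> ?R ^^ n c"
    by blast
  \<comment> \<open>At least every \<open>n c\<close>, and positive. Shorter walks are padded with
    constant steps, possible because every point lies in some \<open>C j\<close>.\<close>
  define K where "K = Suc (\<Sum>c\<in>I. n c)"
  have refl: "(x, x) \<in> ?R ^^ m" if "x \<in> topspace X" for x m
  proof (induction m)
    case (Suc m)
    have "(x, x) \<in> ?R" using C(3)[OF that] interior_of_subset[of X] by blast
    then show ?case using Suc by (intro relpow_Suc_I[of x x _ _ x])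
  qed auto
  show thesis
  proof (rule that[of C K])
    show "closedin X (C c)" "C c \<subseteq> fchart.dom c" if "c \<in> I" for c using C that by auto
    show "0 < K" by (simp add: K_def)
    show "(u, u') \<in> ?R ^^ K" if u: "c \<in> I" "u \<in> fchart.dom c" "u' \<in> fchart.dom c"
      "transverse_proj c u = transverse_proj c u'" for c u u'
    proof -
      have "n c \<le> (\<Sum>c\<in>I. n c)" using finite_I u(1) by (intro member_le_sum) auto
      then obtain m where K: "K = n c + m" unfolding K_def using le_Suc_ex le_SucI by blast
      have "u' \<in> topspace X" using U_topspace u by blast
      then show ?thesis unfolding K relpow_add using n[OF u] refl by blast
    qed
  qed
qed

end

section \<open>The leaf topology\<close>

context regular_foliation begin

lemma chart_I: "c \<in> I \<Longrightarrow> foliated_chart X c"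
  using chart_A by (simp add: I_def)

lemma atlas_plaques_eq: "atlas_plaques A = {plaque c z |c z. c \<in> I \<and> z \<in> topspace (fchart.trans c)}"
proof -
  have iff: "c \<in> A \<and> z \<in> topspace (fchart.trans c) \<longleftrightarrow> c \<in> I \<and> z \<in> topspace (fchart.trans c)" for c z
    using plaque_nonempty[OF chart_A, of c z] by (auto simp: I_def plaque_def)
  have "atlas_plaques A = {plaque c z |c z. c \<in> A \<and> z \<in> topspace (fchart.trans c)}"
    unfolding atlas_plaques_def using plaques_eq[OF chart_A] by auto
  then show ?thesis by (simp only: iff)
qed

lemma atlas_plaque_nonempty: "P \<in> atlas_plaques A \<Longrightarrow> P \<noteq> {}"
  unfolding atlas_plaques_eq by clarify (metis plaque_nonempty[OF chart_I])

lemma plaque_mem: "c \<in> I \<Longrightarrow> x \<in> fchart.dom c \<Longrightarrow> plaque c (transverse_proj c x) \<in> atlas_plaques A"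
  using foliated_chart_mem(2)[OF chart_I] by (auto simp: atlas_plaques_eq)

lemma step_plaque: "(x, y) \<in> step \<longleftrightarrow> (\<exists>P\<in>atlas_plaques A. x \<in> P \<and> y \<in> P)"
proof
  assume "(x, y) \<in> step"
  then obtain c where c: "c \<in> I" "x \<in> fchart.dom c" "y \<in> fchart.dom c" "transverse_proj c x = transverse_proj c y"
    by (auto simp: step_def same_def)
  then show "\<exists>P\<in>atlas_plaques A. x \<in> P \<and> y \<in> P"
    using plaque_mem[of c x] by (intro bexI[of _ "plaque c (transverse_proj c x)"]) (auto simp: plaque_def)
qed (auto simp: atlas_plaques_eq plaque_def step_def same_def)

lemma topspace_leaf_topology: "topspace (leaf_topology X F) = topspace X"
proof -
  have "\<Union>(\<Union>c\<in>charts_of X F. plaques c) = topspace X"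
  proof (intro equalityI subsetI)
    fix x assume "x \<in> \<Union>(\<Union>c\<in>charts_of X F. plaques c)"
    then obtain c where c: "c \<in> charts_of X F" "x \<in> \<Union>(plaques c)" by blast
    then have "foliated_chart X c" "x \<in> fchart.dom c" by (auto simp: charts_of_def plaques_def)
    then show "x \<in> topspace X" by (rule foliated_chart_topspace)
  next
    fix x assume "x \<in> topspace X"
    then obtain c where c: "c \<in> A" "x \<in> fchart.dom c" using cover_A by blast
    then have "x \<in> plaque c (transverse_proj c x)" "plaque c (transverse_proj c x) \<in> plaques c"
      using plaques_eq[OF chart_A] foliated_chart_mem(2)[OF chart_A] by (auto simp: plaque_def)
    then show "x \<in> \<Union>(\<Union>c\<in>charts_of X F. plaques c)" using c A_charts_of by blast
  qed
  then show ?thesis by (simp add: leaf_topology_def topology_generated_by_topspace)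
qed

lemma plaque_open:
  assumes "P \<in> atlas_plaques A" shows "openin (leaf_topology X F) P"
proof -
  have "P \<in> (\<Union>c\<in>charts_of X F. plaques c)" using assms A_charts_of by (auto simp: atlas_plaques_def)
  then show ?thesis unfolding leaf_topology_def by (rule topology_generated_by_Basis)
qed

text \<open>The parametrisation \<open>f\<close> by the ball must be continuous for the plaques of
  all compatible charts \<open>d\<close>, not only those of \<open>A\<close>. It is, because a point
  moving a little along a plaque of \<open>c\<close> keeps its transverse coordinate in
  \<open>d\<close>.\<close>

lemma plaque_connected:
  assumes "P \<in> atlas_plaques A" shows "connectedin (leaf_topology X F) P"
proof -
  obtain c z where cz: "c \<in> I" "z \<in> topspace (fchart.trans c)" "P = plaque c z"
    using assms by (auto simp: atlas_plaques_eq)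
  have ch: "foliated_chart X c" using cz chart_I by blast
  have cF: "c \<in> charts_of X F" using cz A_charts_of by (auto simp: I_def)
  let ?B = "top_of_set (fchart.cball c)"
  obtain g where gc: "continuous_map (prod_topology ?B (fchart.trans c)) (subtopology X (fchart.dom c)) g"
    and g1: "\<And>x. x \<in> fchart.dom c \<Longrightarrow> g (fchart.chart c x) = x"
    and g2: "\<And>b z. b \<in> fchart.cball c \<Longrightarrow> z \<in> topspace (fchart.trans c) \<Longrightarrow>
      g (b, z) \<in> fchart.dom c \<and> fchart.chart c (g (b, z)) = (b, z)"
    using foliated_chartE[OF ch] by metis
  define f where "f b = g (b, z)" for b
  have f: "f b \<in> fchart.dom c" "transverse_proj c (f b) = z" if "b \<in> fchart.cball c" for b
    using g2[OF that cz(2)] by (simp_all add: f_def transverse_proj_def)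
  have "continuous_map ?B (prod_topology ?B (fchart.trans c)) (\<lambda>b. (b, z))"
    using cz(2) by (simp add: continuous_map_pairwise comp_def)
  from continuous_map_compose[OF this gc] have fc: "continuous_map ?B X f"
    by (simp add: f_def[abs_def] comp_def continuous_map_in_subtopology)
  have im: "f ` fchart.cball c = P"
  proof (intro equalityI subsetI)
    fix x assume "x \<in> P"
    then have x: "x \<in> fchart.dom c" "transverse_proj c x = z" using cz by (auto simp: plaque_def)
    then have "f (fst (fchart.chart c x)) = x" using g1 by (auto simp: f_def transverse_proj_def)
    then show "x \<in> f ` fchart.cball c" using foliated_chart_mem(1)[OF ch x(1)] by (metis imageI)
  qed (use f cz in \<open>auto simp: plaque_def\<close>)
  have "continuous_map ?B (leaf_topology X F) f"
    unfolding leaf_topology_def continuous_on_generated_topo_iff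
  proof (intro conjI allI impI)
    fix Q assume "Q \<in> (\<Union>d\<in>charts_of X F. plaques d)"
    then obtain d where dF: "d \<in> charts_of X F" "Q \<in> plaques d" by blast
    then have "foliated_chart X d" by (simp add: charts_of_def)
    then obtain wd where d: "d \<in> charts_of X F" "Q = plaque d wd" using plaques_eq dF by blast
    show "openin ?B (f -` Q \<inter> topspace ?B)"
    proof (subst openin_subopen, intro ballI)
      fix b assume b: "b \<in> f -` Q \<inter> topspace ?B"
      then have bB: "b \<in> fchart.cball c" and fb: "f b \<in> fchart.dom d" "transverse_proj d (f b) = wd"
        using d by (auto simp: plaque_def)
      obtain W where W: "openin X W" "f b \<in> W" "W \<subseteq> fchart.dom c \<inter> fchart.dom d"
        and Wd: "\<And>y y'. y \<in> W \<Longrightarrow> y' \<in> W \<Longrightarrow> transverse_proj c y = transverse_proj c y' \<Longrightarrow>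
          transverse_proj d y = transverse_proj d y'"
        using charts_of_change_local[OF atlas_F cF d(1) f(1)[OF bB] fb(1)] by blast
      let ?T = "{b' \<in> topspace ?B. f b' \<in> W}"
      have "openin ?B ?T" by (rule openin_continuous_map_preimage[OF fc W(1)])
      moreover have "b \<in> ?T" using bB W by simp
      moreover have "?T \<subseteq> f -` Q \<inter> topspace ?B"
      proof
        fix b' assume b': "b' \<in> ?T"
        then have "transverse_proj d (f b') = transverse_proj d (f b)"
          using f bB by (intro Wd W) auto
        then show "b' \<in> f -` Q \<inter> topspace ?B" using b' W(3) fb d by (auto simp: plaque_def)
      qed
      ultimately show "\<exists>T. openin ?B T \<and> b \<in> T \<and> T \<subseteq> f -` Q \<inter> topspace ?B" by blast
    qed
  next
    have "P \<subseteq> \<Union>(\<Union>c\<in>charts_of X F. plaques c)"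
      using assms A_charts_of by (auto simp: atlas_plaques_def)
    then show "f ` topspace ?B \<subseteq> \<Union>(\<Union>c\<in>charts_of X F. plaques c)" using im by simp
  qed
  moreover have "connectedin ?B (fchart.cball c)"
  proof -
    have "connected (fchart.cball c)" using ch unfolding foliated_chart_def by auto
    then show ?thesis by (simp add: connectedin_subtopology)
  qed
  ultimately show ?thesis using connectedin_continuous_map_image im by blast
qed

text \<open>Only an upper bound on the cardinality, since a chain may visit a plaque more than
  once.\<close>

lemma step_relpow_imp_connected:
  assumes "(x, y) \<in> step ^^ Suc k"
  shows "\<exists>\<P>\<subseteq>atlas_plaques A. finite \<P> \<and> card \<P> \<le> Suc k \<and> connectedin (leaf_topology X F) (\<Union>\<P>) \<and>
    x \<in> \<Union>\<P> \<and> y \<in> \<Union>\<P>"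
  using assms
proof (induction k arbitrary: y)
  case 0
  then obtain P where "P \<in> atlas_plaques A" "x \<in> P" "y \<in> P" by (auto simp: step_plaque)
  then show ?case using plaque_connected by (intro exI[of _ "{P}"]) auto
next
  case (Suc k)
  obtain u where u: "(x, u) \<in> step ^^ Suc k" "(u, y) \<in> step" using Suc.prems by (rule relpow_Suc_E)
  obtain \<P> where P: "\<P>\<subseteq>atlas_plaques A" "finite \<P>" "card \<P> \<le> Suc k"
    "connectedin (leaf_topology X F) (\<Union>\<P>)" "x \<in> \<Union>\<P>" "u \<in> \<Union>\<P>"
    using Suc.IH[OF u(1)] by blast
  obtain Q where Q: "Q \<in> atlas_plaques A" "u \<in> Q" "y \<in> Q" using u(2) by (auto simp: step_plaque)
  have "connectedin (leaf_topology X F) (Q \<union> \<Union>\<P>)"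
    using P Q plaque_connected by (intro connectedin_Un) auto
  moreover have "card (insert Q \<P>) \<le> Suc (Suc k)" using P by (simp add: card_insert_if)
  ultimately show ?case using P Q by (intro exI[of _ "insert Q \<P>"]) auto
qed

text \<open>Plaques are open in the leaf topology, so as long as a proper subfamily of a connected family
  has been exhausted, some further plaque meets it: the reached plaques grow by one in each step.\<close>

lemma connected_imp_step_relpow:
  assumes P: "\<P> \<subseteq> atlas_plaques A" "finite \<P>" and con: "connectedin (leaf_topology X F) (\<Union>\<P>)"
    and x: "x \<in> \<Union>\<P>" and y: "y \<in> \<Union>\<P>"
  shows "(x, y) \<in> step ^^ card \<P>"
proof -
  have reached: "\<exists>\<Q>\<subseteq>\<P>. card \<Q> = Suc j \<and> x \<in> \<Union>\<Q> \<and> (\<forall>u\<in>\<Union>\<Q>. (x, u) \<in> step ^^ Suc j)" if "Suc j \<le> card \<P>" for j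
    using that
  proof (induction j)
    case 0
    obtain P where "P \<in> \<P>" "x \<in> P" using x by blast
    then show ?case using P by (intro exI[of _ "{P}"]) (auto simp: step_plaque)
  next
    case (Suc j)
    have "Suc j \<le> card \<P>" using Suc.prems by simp
    from Suc.IH[OF this]
    obtain \<Q> where Q: "\<Q> \<subseteq> \<P>" "card \<Q> = Suc j" "x \<in> \<Union>\<Q>" "\<And>u. u \<in> \<Union>\<Q> \<Longrightarrow> (x, u) \<in> step ^^ Suc j"
      by blast
    have ne: "\<P> - \<Q> \<noteq> {}" using Q Suc.prems by auto
    have "\<Union>\<Q> \<inter> \<Union>(\<P> - \<Q>) \<noteq> {}"
    proof
      assume em: "\<Union>\<Q> \<inter> \<Union>(\<P> - \<Q>) = {}"
      have "openin (leaf_topology X F) (\<Union>\<Q>)" "openin (leaf_topology X F) (\<Union>(\<P> - \<Q>))"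
        using P Q plaque_open by (auto intro!: openin_Union)
      moreover have "\<Union>\<P> \<subseteq> \<Union>\<Q> \<union> \<Union>(\<P> - \<Q>)" by blast
      moreover have "\<Union>\<Q> \<inter> \<Union>\<P> \<noteq> {}" using Q by blast
      moreover obtain P0 where P0: "P0 \<in> \<P> - \<Q>" using ne by blast
      then have "P0 \<noteq> {}" using P atlas_plaque_nonempty by blast
      then have "\<Union>(\<P> - \<Q>) \<inter> \<Union>\<P> \<noteq> {}" using P0 by blast
      ultimately show False using con em unfolding connectedin by blast
    qed
    then obtain u R where u: "u \<in> \<Union>\<Q>" "R \<in> \<P> - \<Q>" "u \<in> R" by blast
    have fQ: "finite \<Q>" using P Q finite_subset by blast
    have xt: "x \<in> topspace X"
      using Q(4)[OF Q(3)] step_topspace by (metis relpow_Suc_E2)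
    have "(x, u') \<in> step ^^ Suc (Suc j)" if "u' \<in> \<Union>(insert R \<Q>)" for u'
    proof (cases "u' \<in> R")
      case True
      then have "(u, u') \<in> step" using u P by (auto simp: step_plaque)
      then show ?thesis using Q(4)[OF u(1)] by (rule relpow_Suc_I[rotated])
    next
      case False
      then show ?thesis using Q(4)[of u'] that relpow_step_mono[OF _ _ xt, of u' "Suc j" "Suc (Suc j)"] by auto
    qed
    then show ?case using u Q fQ by (intro exI[of _ "insert R \<Q>"]) auto
  qed
  obtain j where j: "card \<P> = Suc j"
    using x P(2) by (metis Union_empty card_eq_0_iff empty_iff not0_implies_Suc)
  then obtain \<Q> where Q: "\<Q> \<subseteq> \<P>" "card \<Q> = Suc j" "\<forall>u\<in>\<Union>\<Q>. (x, u) \<in> step ^^ Suc j"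
    using reached[of j] by auto
  have "\<Q> = \<P>" by (rule card_subset_eq[OF P(2) Q(1)]) (simp add: Q(2) j)
  then show ?thesis unfolding j using Q(3) y by blast
qed

text \<open>The plaques that meet the class of \<open>x\<close> and those that miss it fill two
  disjoint open sets of the leaf topology, so a connected set through \<open>x\<close> stays in the
  class.\<close>

lemma leaf_eq:
  assumes x: "x \<in> topspace X" shows "leaf X F x = step\<^sup>* `` {x}"
proof (intro equalityI subsetI)
  fix y assume "y \<in> leaf X F x"
  then obtain S where S: "connectedin (leaf_topology X F) S" "x \<in> S" "y \<in> S"
    by (auto simp: leaf_def connected_component_of_def)
  define O1 where "O1 = \<Union>{P \<in> atlas_plaques A. P \<inter> step\<^sup>* `` {x} \<noteq> {}}"
  define O2 where "O2 = \<Union>{P \<in> atlas_plaques A. P \<inter> step\<^sup>* `` {x} = {}}"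
  have O: "u \<in> step\<^sup>* `` {x}" if u: "u \<in> O1" for u
  proof -
    obtain P u' where "P \<in> atlas_plaques A" "u \<in> P" "u' \<in> P" "(x, u') \<in> step\<^sup>*"
      using u unfolding O1_def by blast
    then have "(u', u) \<in> step" by (auto simp: step_plaque)
    then show ?thesis using \<open>(x, u') \<in> step\<^sup>*\<close> by auto
  qed
  have "openin (leaf_topology X F) O1" "openin (leaf_topology X F) O2"
    unfolding O1_def O2_def using plaque_open by (auto intro!: openin_Union)
  moreover have "S \<subseteq> O1 \<union> O2"
  proof
    fix u assume "u \<in> S"
    then have "u \<in> topspace X" using S(1) connectedin_subset_topspace topspace_leaf_topology by blast
    then have "(u, u) \<in> step" by (rule step_refl)
    then obtain P where "P \<in> atlas_plaques A" "u \<in> P" by (auto simp: step_plaque)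
    then show "u \<in> O1 \<union> O2" unfolding O1_def O2_def by blast
  qed
  moreover have "O1 \<inter> O2 \<inter> S = {}"
  proof -
    have "u \<notin> O2" if "u \<in> O1" for u using O[OF that] unfolding O2_def by blast
    then show ?thesis by blast
  qed
  moreover have "O1 \<inter> S \<noteq> {}"
  proof -
    have "(x, x) \<in> step" using x by (rule step_refl)
    then obtain P where "P \<in> atlas_plaques A" "x \<in> P" by (auto simp: step_plaque)
    then have "x \<in> O1" unfolding O1_def by blast
    then show ?thesis using S by blast
  qed
  ultimately have "O2 \<inter> S = {}" using S(1) unfolding connectedin by blast
  then have "y \<in> O1" using S(3) \<open>S \<subseteq> O1 \<union> O2\<close> by blast
  then show "y \<in> step\<^sup>* `` {x}" by (rule O)
next
  fix y assume "y \<in> step\<^sup>* `` {x}"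
  then obtain k where "(x, y) \<in> step ^^ k" using rtrancl_imp_relpow by blast
  then have "(x, y) \<in> step ^^ Suc k" using relpow_step_mono[of x y k "Suc k"] x by simp
  from step_relpow_imp_connected[OF this] obtain \<P> where
    "connectedin (leaf_topology X F) (\<Union>\<P>)" "x \<in> \<Union>\<P>" "y \<in> \<Union>\<P>" by blast
  then show "y \<in> leaf X F x"
    unfolding leaf_def connected_component_of_def by (auto intro!: exI[of _ "\<Union>\<P>"])
qed

lemma plaque_dist_le_iff:
  assumes x: "x \<in> topspace X" and y: "y \<in> leaf X F x"
  shows "plaque_dist X F A x y \<le> Suc k \<longleftrightarrow> (x, y) \<in> step ^^ Suc k"
proof (cases "x = y")
  case True
  then show ?thesis using relpow_step_mono[of x x 0 "Suc k"] x by (auto simp: plaque_dist_def)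
next
  case False
  let ?P = "\<lambda>k. \<exists>\<P>. \<P> \<subseteq> atlas_plaques A \<and> finite \<P> \<and> card \<P> = k \<and>
             connectedin (leaf_topology X F) (\<Union>\<P>) \<and> x \<in> \<Union>\<P> \<and> y \<in> \<Union>\<P>"
  have d: "plaque_dist X F A x y = (LEAST k. ?P k)" using False by (simp add: plaque_dist_def)
  have up: "\<exists>m\<le>Suc n. ?P m" if "(x, y) \<in> step ^^ Suc n" for n
    using step_relpow_imp_connected[OF that] by blast
  \<comment> \<open>Membership in the leaf makes the set of admissible cardinalities nonempty, so
    that \<open>LEAST\<close> is attained.\<close>
  obtain n where "(x, y) \<in> step ^^ n" using y leaf_eq[OF x] rtrancl_imp_relpow by blast
  then have "(x, y) \<in> step ^^ Suc n" using relpow_step_mono[of x y n "Suc n"] x by simp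
  from up[OF this] have "\<exists>m. ?P m" by blast
  then have "?P (plaque_dist X F A x y)" unfolding d by (rule LeastI_ex)
  then have dist: "(x, y) \<in> step ^^ plaque_dist X F A x y" using connected_imp_step_relpow by metis
  show ?thesis
  proof
    assume "plaque_dist X F A x y \<le> Suc k"
    then show "(x, y) \<in> step ^^ Suc k" by (rule relpow_step_mono[OF dist _ x])
  next
    assume "(x, y) \<in> step ^^ Suc k"
    from up[OF this] obtain m where m: "m \<le> Suc k" "?P m" by blast
    have "plaque_dist X F A x y \<le> m" unfolding d using m(2) by (rule Least_le)
    then show "plaque_dist X F A x y \<le> Suc k" using m(1) by simp
  qed
qed

text \<open>Distances are integers and the ball is open, so \<open>d < r\<close> means
  \<open>d \<le> \<lceil>r\<rceil> - 1\<close>; by \<open>1 < r\<close> this bound is a successor,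
  as \<open>plaque_dist_le_iff\<close> expects.\<close>

lemma leaf_ball_eq:
  assumes x: "x \<in> topspace X" and r: "1 < r"
  shows "leaf_ball X F A x r = (step ^^ (nat \<lceil>r\<rceil> - 1)) `` {x}"
proof -
  obtain k where k: "nat \<lceil>r\<rceil> - 1 = Suc k" using r by (cases "nat \<lceil>r\<rceil> - 1") (linarith, simp)
  have less: "real d < r \<longleftrightarrow> d \<le> Suc k" for d :: nat using k r by linarith
  have "(x, y) \<in> step ^^ Suc k \<Longrightarrow> y \<in> leaf X F x" for y
    using leaf_eq[OF x] relpow_imp_rtrancl by blast
  then show ?thesis unfolding k leaf_ball_def less using plaque_dist_le_iff[OF x] by blast
qed

text \<open>The ball takes \<open>\<lceil>r\<rceil> - 1\<close> steps and the plaque meeting it is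
  one more letter, so the codes have length exactly \<open>\<lceil>r\<rceil>\<close>.\<close>

lemma growth_reach:
  assumes x: "x \<in> topspace X" and r: "1 < r"
  shows "{P \<in> atlas_plaques A. P \<inter> leaf_ball X F A x r \<noteq> {}} = (\<lambda>(c, z). plaque c z) ` reach (nat \<lceil>r\<rceil>) x"
proof -
  obtain n where n: "nat \<lceil>r\<rceil> = Suc n" using r by (cases "nat \<lceil>r\<rceil>") auto
  have b: "leaf_ball X F A x r = (step ^^ n) `` {x}" using leaf_ball_eq[OF x r] n by simp
  show ?thesis unfolding n b
  proof (intro equalityI subsetI)
    fix P assume "P \<in> {P \<in> atlas_plaques A. P \<inter> (step ^^ n) `` {x} \<noteq> {}}"
    then obtain c z y where y: "c \<in> I" "P = plaque c z" "y \<in> P" "(x, y) \<in> step ^^ n"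
      by (auto simp: atlas_plaques_eq)
    then have "(c, z) \<in> reach (Suc n) x" unfolding reach_iff_step[OF x] by (auto simp: plaque_def)
    then show "P \<in> (\<lambda>(c, z). plaque c z) ` reach (Suc n) x" using y(2) by force
  next
    fix P assume "P \<in> (\<lambda>(c, z). plaque c z) ` reach (Suc n) x"
    then obtain c z where "P = plaque c z" "(c, z) \<in> reach (Suc n) x" by auto
    then obtain y where y: "P = plaque c z" "c \<in> I" "y \<in> fchart.dom c" "(x, y) \<in> step ^^ n" "transverse_proj c y = z"
      unfolding reach_iff_step[OF x] by blast
    then have "P \<in> atlas_plaques A" "y \<in> P" using plaque_mem by (auto simp: plaque_def)
    then show "P \<in> {P \<in> atlas_plaques A. P \<inter> (step ^^ n) `` {x} \<noteq> {}}" using y by blast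
  qed
qed

section \<open>Plaques counted as sets and as ends of codes\<close>

lemma growth_le_nreach:
  assumes "x \<in> topspace X" "1 < r" shows "growth X F A x r \<le> nreach (nat \<lceil>r\<rceil>) x"
  unfolding growth_def growth_reach[OF assms] nreach_def by (rule card_image_le) simp

text \<open>One set can be a plaque of several charts. Once the chart is named, a nonempty plaque
  determines its transverse coordinate, so each set is counted at most \<open>card I\<close>
  times.\<close>

lemma nreach_le_growth:
  assumes x: "x \<in> topspace X" and r: "1 < r" shows "nreach (nat \<lceil>r\<rceil>) x \<le> card I * growth X F A x r"
proof -
  obtain n where n: "nat \<lceil>r\<rceil> = Suc n" using r by (cases "nat \<lceil>r\<rceil>") auto
  let ?S = "(\<lambda>(c, z). plaque c z) ` reach (nat \<lceil>r\<rceil>) x"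
  have "card (reach (nat \<lceil>r\<rceil>) x) \<le> card (I \<times> ?S)"
  proof (rule card_inj_on_le)
    show "inj_on (\<lambda>(c, z). (c, plaque c z)) (reach (nat \<lceil>r\<rceil>) x)"
    proof (rule inj_onI)
      fix p p' assume p: "p \<in> reach (nat \<lceil>r\<rceil>) x"
        and eq: "(case p of (c, z) \<Rightarrow> (c, plaque c z)) = (case p' of (c, z) \<Rightarrow> (c, plaque c z))"
      obtain c z z' where pp: "p = (c, z)" "p' = (c, z')" using eq by (cases p; cases p') auto
      have "(c, z) \<in> reach (Suc n) x" using p pp n by simp
      then obtain y where "y \<in> fchart.dom c" "transverse_proj c y = z"
        unfolding reach_iff_step[OF x] by blast
      then have "y \<in> plaque c z" by (simp add: plaque_def)
      then have "y \<in> plaque c z'" using eq pp by simp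
      then show "p = p'" using \<open>transverse_proj c y = z\<close> pp by (simp add: plaque_def)
    qed
    show "(\<lambda>(c, z). (c, plaque c z)) ` reach (nat \<lceil>r\<rceil>) x \<subseteq> I \<times> ?S"
      unfolding n using reach_iff_step[OF x] by force
  qed (simp add: finite_I)
  then show ?thesis
    unfolding nreach_def growth_def growth_reach[OF x r] by (simp add: card_cartesian_product)
qed

end

section \<open>Holonomy\<close>

context regular_foliation begin

text \<open>The composite of the holonomy maps along the code \<open>c # ds\<close>. The first chart
  is a separate argument because each generator joins two consecutive charts.\<close>

fun hchain :: "('a, 'n, 'z) fchart \<Rightarrow> ('a, 'n, 'z) fchart list \<Rightarrow>
    ((('a, 'n, 'z) fchart \<times> 'z) \<times> (('a, 'n, 'z) fchart \<times> 'z)) set" where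
  "hchain c [] = Id_on (topspace (total_transversal A))"
| "hchain c (d # ds) = holonomy_map c d O hchain d ds"

lemma holonomy_map_in: "c \<in> A \<Longrightarrow> d \<in> A \<Longrightarrow> holonomy_map c d \<in> holonomy_pseudogroup A"
  unfolding holonomy_pseudogroup_def by (rule generated_pseudogroup.gen) blast

lemma hchain_in: "c \<in> A \<Longrightarrow> set ds \<subseteq> A \<Longrightarrow> hchain c ds \<in> holonomy_pseudogroup A"
proof (induction ds arbitrary: c)
  case Nil
  then show ?case by (simp add: holonomy_pseudogroup_def generated_pseudogroup.ident)
next
  case (Cons d ds)
  then show ?case using holonomy_map_in[of c d]
    by (auto simp: holonomy_pseudogroup_def intro: generated_pseudogroup.comp)
qed

lemma total_transversal_topspace:
  "c \<in> I \<Longrightarrow> x \<in> fchart.dom c \<Longrightarrow> (c, transverse_proj c x) \<in> topspace (total_transversal A)"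
  using foliated_chart_mem(2)[OF chart_I] by (auto simp: total_transversal_def I_def)

lemma chain_imp_hchain:
  "c \<in> I \<Longrightarrow> set ds \<subseteq> I \<Longrightarrow> (x, y) \<in> chain (c # ds) \<Longrightarrow>
    ((c, transverse_proj c x), (last (c # ds), transverse_proj (last (c # ds)) y)) \<in> hchain c ds"
proof (induction ds arbitrary: c x)
  case Nil
  then have "y \<in> fchart.dom c" "transverse_proj c x = transverse_proj c y"
    by (auto simp: same_def)
  then show ?case using total_transversal_topspace[OF Nil(1)] by (auto simp: Id_on_iff)
next
  case (Cons d ds)
  then obtain u where u: "(x, u) \<in> same c" "(u, y) \<in> chain (d # ds)" by auto
  then have "u \<in> fchart.dom c" "u \<in> fchart.dom d" by (auto simp: same_def)
  then have "((c, transverse_proj c u), (d, transverse_proj d u)) \<in> holonomy_map c d"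
    unfolding holonomy_map_def by blast
  moreover have "transverse_proj c x = transverse_proj c u" using u by (simp add: same_def)
  moreover have "((d, transverse_proj d u), (last (d # ds), transverse_proj (last (d # ds)) y)) \<in> hchain d ds"
    using Cons.IH[of d u] Cons.prems u by simp
  ultimately show ?case by auto
qed

lemma hchain_imp_chain:
  "c \<in> I \<Longrightarrow> set ds \<subseteq> I \<Longrightarrow> x \<in> fchart.dom c \<Longrightarrow> ((c, transverse_proj c x), t) \<in> hchain c ds \<Longrightarrow>
    \<exists>y. (x, y) \<in> chain (c # ds) \<and> t = (last (c # ds), transverse_proj (last (c # ds)) y)"
proof (induction ds arbitrary: c x)
  case Nil
  then have "(x, x) \<in> chain [c]" using U_topspace by (auto simp: same_def)
  then show ?case using Nil by (intro exI[of _ x]) (auto simp: Id_on_iff)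
next
  case (Cons d ds)
  then obtain u where u: "u \<in> fchart.dom c" "u \<in> fchart.dom d" "transverse_proj c u = transverse_proj c x"
    "((d, transverse_proj d u), t) \<in> hchain d ds"
    by (auto simp: holonomy_map_def)
  then obtain y where y: "(u, y) \<in> chain (d # ds)" "t = (last (d # ds), transverse_proj (last (d # ds)) y)"
    using Cons.IH[of d u] Cons.prems by auto
  moreover have "(x, u) \<in> same c" using u Cons.prems by (simp add: same_def)
  ultimately have "(x, y) \<in> chain (c # d # ds)" by (simp only: chain.simps(2)[of c]) blast
  moreover have "last (c # d # ds) = last (d # ds)" by simp
  ultimately show ?case using y(2) by (intro exI[of _ y] conjI) (simp_all only:)
qed

lemma trivial_holonomy_germ:
  assumes c: "c \<in> I" "x \<in> fchart.dom c" and sing: "is_singleton (holonomy_group A c x)"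
    and f: "f \<in> holonomy_pseudogroup A" "((c, transverse_proj c x), (c, transverse_proj c x)) \<in> f"
  obtains V where "openin (total_transversal A) V" "(c, transverse_proj c x) \<in> V"
    "\<And>s. s \<in> V \<Longrightarrow> (s, s) \<in> f"
proof -
  let ?T = "total_transversal A"
  define t where "t = (c, transverse_proj c x)"
  define H where "H = {f \<in> holonomy_pseudogroup A. (t, t) \<in> f}"
  define R where "R = same_germ ?T t \<inter> H \<times> H"
  have t: "t \<in> topspace ?T" unfolding t_def using c by (rule total_transversal_topspace)
  have sing': "is_singleton (H // R)" using sing by (simp add: holonomy_group_def H_def R_def t_def Let_def)
  have fH: "f \<in> H" using f by (simp add: H_def t_def)
  have id: "Id_on (topspace ?T) \<in> H"
    using t by (simp add: H_def holonomy_pseudogroup_def generated_pseudogroup.ident Id_on_iff)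
  \<comment> \<open>Both classes are the single element of the quotient. The second contains the
    identity, hence so does the class of \<open>f\<close>.\<close>
  have "R `` {f} = R `` {Id_on (topspace ?T)}"
    using sing' quotientI[OF fH, of R] quotientI[OF id, of R] by (metis is_singletonE singletonD)
  moreover have "(Id_on (topspace ?T), Id_on (topspace ?T)) \<in> R"
    using id t by (auto simp: R_def same_germ_def)
  ultimately have "(f, Id_on (topspace ?T)) \<in> R" by blast
  then obtain V where V: "openin ?T V" "t \<in> V" "f \<inter> V \<times> UNIV = Id_on (topspace ?T) \<inter> V \<times> UNIV"
    by (auto simp: R_def same_germ_def)
  have "(s, s) \<in> f" if "s \<in> V" for s
  proof -
    have "s \<in> topspace ?T" using V(1) that openin_subset by blast
    then have "(s, s) \<in> Id_on (topspace ?T) \<inter> V \<times> UNIV" using that by (simp add: Id_on_iff)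
    then show ?thesis using V(3) by blast
  qed
  then show thesis using that V(1,2) unfolding t_def by blast
qed

text \<open>Two codes with a common end at \<open>x\<close> form a loop: out along
  \<open>is\<close>, back along \<open>js\<close>, then from the chart \<open>d\<close> to
  \<open>c\<close>. If its germ is trivial, every transverse coordinate near that of
  \<open>x\<close> is returned to itself, which forces the ends of the two codes to agree near
  \<open>x\<close>.\<close>

lemma without_holonomy_imp_unbranched:
  assumes x: "x \<in> topspace X"
    and triv: "\<And>c. c \<in> A \<Longrightarrow> x \<in> fchart.dom c \<Longrightarrow> is_singleton (holonomy_group A c x)"
  shows "unbranched x"
  unfolding unbranched_def
proof (intro conjI ballI impI x)
  fix "is" js assume i: "is \<in> lists I - {[]}" and j: "js \<in> lists I - {[]}"
    and xi: "x \<in> Domain (chain is)" and xj: "x \<in> Domain (chain js)" and eq: "endp is x = endp js x"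
  obtain c is' where is': "is = c # is'" using i by (cases "is") auto
  obtain d js' where js': "js = d # js'" using j by (cases js) auto
  have I: "c \<in> I" "set is' \<subseteq> I" "d \<in> I" "set js' \<subseteq> I" using i j is' js' by auto
  then have A: "c \<in> A" "set is' \<subseteq> A" "d \<in> A" "set js' \<subseteq> A" by (auto simp: I_def)
  have dom: "y \<in> fchart.dom c" if "y \<in> Domain (chain is)" for y using that is' by (auto simp: same_def)
  have dom': "y \<in> fchart.dom d" if "y \<in> Domain (chain js)" for y using that js' by (auto simp: same_def)
  have endi: "endp is y = (last is, transverse_proj (last is) u)" if "(y, u) \<in> chain is" for y u
    using endp_eq[of "is" y u] i that by simp
  have endj: "endp js y = (last js, transverse_proj (last js) u)" if "(y, u) \<in> chain js" for y u
    using endp_eq[of js y u] j that by simp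
  let ?t = "(c, transverse_proj c x)"
  let ?f = "hchain c is' O (hchain d js')\<inverse> O holonomy_map d c"
  have "?f \<in> holonomy_pseudogroup A"
    using hchain_in[OF A(1,2)] hchain_in[OF A(3,4)] holonomy_map_in[OF A(3,1)]
    unfolding holonomy_pseudogroup_def
    by (intro generated_pseudogroup.comp generated_pseudogroup.inverse)
  moreover have "(?t, ?t) \<in> ?f"
  proof -
    obtain u where u: "(x, u) \<in> chain is" using xi by blast
    obtain u' where u': "(x, u') \<in> chain js" using xj by blast
    have "(?t, endp is x) \<in> hchain c is'"
      using chain_imp_hchain[OF I(1,2), of x u] u endi[OF u] is' by simp
    moreover have "((d, transverse_proj d x), endp is x) \<in> hchain d js'"
      using chain_imp_hchain[OF I(3,4), of x u'] u' endj[OF u'] js' eq by simp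
    moreover have "((d, transverse_proj d x), ?t) \<in> holonomy_map d c"
      using dom[OF xi] dom'[OF xj] by (auto simp: holonomy_map_def)
    ultimately show ?thesis by blast
  qed
  ultimately obtain V where V: "openin (total_transversal A) V" "?t \<in> V" "\<And>s. s \<in> V \<Longrightarrow> (s, s) \<in> ?f"
    using trivial_holonomy_germ[OF I(1) dom[OF xi] triv[OF A(1) dom[OF xi]]] by blast
  let ?Y = "subtopology X (fchart.dom c)"
  let ?O = "{y \<in> topspace ?Y. transverse_proj c y \<in> {z. (c, z) \<in> V}}"
  have "openin (fchart.trans c) {z. (c, z) \<in> V}"
    using V(1) A(1) by (simp add: total_transversal_def openin_sum_topology)
  then have "openin ?Y ?O"
    by (rule openin_continuous_map_preimage[OF transverse_proj_continuous[OF chart_I[OF I(1)]]])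
  then have "openin X ?O" using open_U[OF I(1)] by (rule openin_trans_full)
  moreover have "x \<in> ?O" using V(2) x dom[OF xi] by simp
  ultimately have "\<forall>\<^sub>F y in nhdsin X x. y \<in> ?O" unfolding eventually_nhdsin by (intro disjI2 exI[of _ ?O]) simp
  moreover have "\<forall>\<^sub>F y in nhdsin X x. y \<in> Domain (chain is)"
    using i xi by (intro eventually_Domain_chain) auto
  moreover have "\<forall>\<^sub>F y in nhdsin X x. y \<in> Domain (chain js)"
    using j xj by (intro eventually_Domain_chain) auto
  ultimately show "\<forall>\<^sub>F y in nhdsin X x. endp is y = endp js y"
  proof eventually_elim
    case (elim y)
    have yc: "y \<in> fchart.dom c" "y \<in> fchart.dom d" using dom dom' elim by auto
    have "(c, transverse_proj c y) \<in> V" using elim(1) by simp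
    from V(3)[OF this] obtain t1 t2 where t: "((c, transverse_proj c y), t1) \<in> hchain c is'"
      "(t2, t1) \<in> hchain d js'" "(t2, (c, transverse_proj c y)) \<in> holonomy_map d c" by blast
    from t(3) obtain u where u: "u \<in> fchart.dom c" "u \<in> fchart.dom d" "t2 = (d, transverse_proj d u)"
      "transverse_proj c u = transverse_proj c y" by (auto simp: holonomy_map_def)
    \<comment> \<open>The point \<open>u\<close> is merely some point with the coordinate of
      \<open>y\<close> in \<open>c\<close>; coherence lets \<open>y\<close> take its place in
      \<open>d\<close>.\<close>
    have "transverse_proj d u = transverse_proj d y"
      using u yc by (intro coherent_A[OF A(1,3)]) auto
    then have t2: "((d, transverse_proj d y), t1) \<in> hchain d js'" using t(2) u(3) by simp
    from hchain_imp_chain[OF I(1,2) yc(1) t(1), folded is'] have "t1 = endp is y"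
      using endi by metis
    moreover from hchain_imp_chain[OF I(3,4) yc(2) t2, folded js'] have "t1 = endp js y"
      using endj by metis
    ultimately show ?case by simp
  qed
qed

section \<open>From the abstract growth theorem to the foliation\<close>

theorem growth_of_residual_leaves:
  assumes transitive: "transitive_foliation X F" and not_one_leaf: "topspace X \<notin> leaves X F"
  shows "\<exists>(a1::ereal) (a3::ereal) (a2::real) (a4::real) (p::real).
    1 \<le> a1 \<and> 1 \<le> a3 \<and> 0 \<le> a2 \<and> 0 \<le> a4 \<and> 1 \<le> p \<and>
    residually_many X (\<lambda>x.
      Limsup at_top (\<lambda>r::real. ereal (ln (real (growth X F A x r)) / ln r)) = a1 \<and>
      ereal a2 \<le> Liminf at_top (\<lambda>r::real. ereal (ln (real (growth X F A x r)) / r)) \<and>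
      Liminf at_top (\<lambda>r::real. ereal (ln (real (growth X F A x r)) / r)) \<le> ereal (p * a2) \<and>
      Liminf at_top (\<lambda>r::real. ereal (ln (real (growth X F A x r)) / ln r)) = a3 \<and>
      Limsup at_top (\<lambda>r::real. ereal (ln (real (growth X F A x r)) / r)) = ereal a4) \<and>
    (\<forall>x \<in> dense_leaves_without_holonomy X F A.
      Liminf at_top (\<lambda>r::real. ereal (ln (real (growth X F A x r)) / ln r)) \<ge> a3 \<and>
      Limsup at_top (\<lambda>r::real. ereal (ln (real (growth X F A x r)) / r)) \<le> ereal a4)"
proof -
  have leaf_of: "x \<in> topspace X \<and> L = step\<^sup>* `` {x}" if L: "L \<in> leaves X F" and x: "x \<in> L" for L x
  proof -
    have "x \<in> topspace X"
      using L x connected_components_of_subset topspace_leaf_topology unfolding leaves_def by blast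
    moreover have "L = leaf X F x"
    proof -
      obtain x0 where "x0 \<in> topspace (leaf_topology X F)" "L = connected_component_of_set (leaf_topology X F) x0"
        using L unfolding leaves_def connected_components_of_def by blast
      then show ?thesis using x connected_component_of_equiv[of "leaf_topology X F" x0 x]
        unfolding leaf_def by auto
    qed
    ultimately show ?thesis using leaf_eq by blast
  qed
  obtain C K where CK: "\<And>c. c \<in> I \<Longrightarrow> closedin X (C c)" "\<And>c. c \<in> I \<Longrightarrow> C c \<subseteq> fchart.dom c" "0 < (K::nat)"
    "\<And>c u u'. \<lbrakk>c \<in> I; u \<in> fchart.dom c; u' \<in> fchart.dom c; transverse_proj c u = transverse_proj c u'\<rbrakk> \<Longrightarrow>
      (u, u') \<in> (\<Union>j\<in>I. {(x, y). x \<in> C j \<and> y \<in> C j \<and> transverse_proj j x = transverse_proj j y}) ^^ K"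
    using room_cover by blast
  interpret G: growth_atlas X I fchart.dom fchart.trans transverse_proj C K "growth X F A"
  proof
    show "\<exists>x\<in>topspace X. dense_set X (step\<^sup>* `` {x})"
    proof -
      obtain L where L: "L \<in> leaves X F" "dense_set X L"
        using transitive unfolding transitive_foliation_def by blast
      then have "L \<noteq> {}" unfolding leaves_def using nonempty_connected_components_of by blast
      then show ?thesis using leaf_of[OF L(1)] L(2) by blast
    qed
    show "\<not> closedin X (step\<^sup>* `` {x})" if x: "x \<in> topspace X" and d: "dense_set X (step\<^sup>* `` {x})" for x
    proof
      \<comment> \<open>A class both closed and dense is the whole space, which would then be a
        leaf.\<close>
      assume "closedin X (step\<^sup>* `` {x})"
      then have "step\<^sup>* `` {x} = topspace X" using d closure_of_closedin unfolding dense_set_def by metis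
      then have "leaf X F x = topspace X" using leaf_eq[OF x] by simp
      moreover have "leaf X F x \<in> leaves X F"
        using x topspace_leaf_topology unfolding leaf_def leaves_def connected_components_of_def by blast
      ultimately show False using not_one_leaf by simp
    qed
  qed (fact compact_X Hausdorff_X second_countable_X CK growth_le_nreach nreach_le_growth)+
  have sub: "dense_leaves_without_holonomy X F A \<subseteq> G.generic"
  proof
    fix x assume "x \<in> dense_leaves_without_holonomy X F A"
    then obtain L where L: "L \<in> leaves X F" "dense_set X L" "without_holonomy A L" "x \<in> L"
      by (auto simp: dense_leaves_without_holonomy_def)
    have "unbranched x"
      using L(3,4) leaf_of[OF L(1,4)] unfolding without_holonomy_def
      by (intro without_holonomy_imp_unbranched) auto
    then show "x \<in> G.generic" using L(2) leaf_of[OF L(1,4)] by (simp add: G.generic_def G.dense_leaf_def)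
  qed
  from G.growth_exponents show ?thesis
    by (elim exE conjE, intro exI conjI) (assumption | use sub in blast)+
qed

end

text \<open>\<open>not_one_leaf\<close> excludes spaces consisting of a single leaf. For a compact
  connected manifold regarded as one leaf there are finitely many plaques, so \<open>v\<close> is
  bounded, \<open>ln v / ln r\<close> tends to 0 and the bounds \<open>1 \<le> a1\<close> and
  \<open>1 \<le> a3\<close> fail.\<close>

theorem theorem1p8:
  fixes X :: "'a topology"
    and \<F> \<U> :: "('a, 'n::finite, 'z) fchart set"
    and v :: "'a \<Rightarrow> real \<Rightarrow> nat"
  defines "v \<equiv> growth X \<F> \<U>"
  assumes space: "compact_polish_foliated_space X \<F>"
    and transitive: "transitive_foliation X \<F>"
    and not_one_leaf: "topspace X \<notin> leaves X \<F>"
    and regular: "regular_foliated_atlas X \<F> \<U>"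
  shows "\<exists>(a1::ereal) (a3::ereal) (a2::real) (a4::real) (p::real).
    1 \<le> a1 \<and> 1 \<le> a3 \<and> 0 \<le> a2 \<and> 0 \<le> a4 \<and> 1 \<le> p \<and>
    residually_many X (\<lambda>x.
      Limsup at_top (\<lambda>r::real. ereal (ln (real (v x r)) / ln r)) = a1 \<and>
      ereal a2 \<le> Liminf at_top (\<lambda>r::real. ereal (ln (real (v x r)) / r)) \<and>
      Liminf at_top (\<lambda>r::real. ereal (ln (real (v x r)) / r)) \<le> ereal (p * a2) \<and>
      Liminf at_top (\<lambda>r::real. ereal (ln (real (v x r)) / ln r)) = a3 \<and>
      Limsup at_top (\<lambda>r::real. ereal (ln (real (v x r)) / r)) = ereal a4) \<and>
    (\<forall>x \<in> dense_leaves_without_holonomy X \<F> \<U>.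
      Liminf at_top (\<lambda>r::real. ereal (ln (real (v x r)) / ln r)) \<ge> a3 \<and>
      Limsup at_top (\<lambda>r::real. ereal (ln (real (v x r)) / r)) \<le> ereal a4)"
proof -
  interpret regular_foliation X \<F> \<U> by unfold_locales (fact space regular)+
  show ?thesis unfolding v_def by (rule growth_of_residual_leaves[OF transitive not_one_leaf])
qed

end
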